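(* In the setting described in the context, if the mixed-integer linear program (MILP) described in the context has a feasible solution, then there exists a feasible schedule for the SUP instance (with the given job sizes) of makespan at most $(1+3\varepsilon)T$; moreover, given $T$, the set $\mathcal{C}$ and a feasible MILP solution, such a schedule can be found in time polynomial in the input encoding length.
   Context: Let $\varepsilon>0$ be rational with $1/\varepsilon\in\mathbb{Z}$. SUP: an instance consists of a set $\mathcal{J}$ of $n$ jobs with sizes $p_j\ge 0$, $m$ identical machines, a positive integer $k$ and a rational $U\ge0$; the load of a machine assigned a nonempty job set $\sigma$ is $\sum_{j\in\sigma}p_j+U\lfloor(|\sigma|-1)/k\rfloor$; a feasible schedule is a partition of $\mathcal{J}$ into $m$ subsets, and its makespan is the maximum load. Assume every job size is $0$ or an integer power of $1+\varepsilon$, and let $T$ be an integer power of $1+\varepsilon$ with $T\ge\max_j p_j$. A job is small if $p_j<\varepsilon T$ and large otherwise; $\mathcal{S}$, $\mathcal{L}$ denote the sets of small and large jobs, $\Lambda$ the set of distinct large sizes, $\mathcal{L}_\ell$ the large jobs of size $\ell$; $\tilde p_j=p_j+U/k$. Configurations: a configuration $c$ consists of nonnegative integers $\alpha_{c\ell}$ ($\ell\in\Lambda$), $\beta_c$, $\gamma_c$, a bit $\gamma'_c\in\{0,1\}$ (with $\gamma_c=0$ when $\gamma'_c=0$), and an integer $\delta_c\in\{0,\dots,1/\varepsilon\}$; its load is $L_c=\sum_{\ell}\ell\,\alpha_{c\ell}+\beta_c\varepsilon T+\gamma'_c\gamma_c\varepsilon T+U(\delta_c-1+\gamma'_c)$,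 and it is feasible if $L_c\le T$. $\mathcal{C}$ is the set of feasible configurations. The MILP has variables $x_c\in\mathbb{Z}_{\ge0}$ ($c\in\mathcal{C}$), $y_{jc},z_{jc}\in[0,1]$ ($j\in\mathcal{S},c\in\mathcal{C}$) and constraints: $\sum_c x_c=m$; $\sum_c(y_{jc}+z_{jc})=1$ for all $j\in\mathcal{S}$; $\sum_{j\in\mathcal{S}}y_{jc}p_j\le x_c(\beta_c+1)\varepsilon T$ for all $c$; $\sum_{j\in\mathcal{S}}z_{jc}\tilde p_j\le x_c\gamma'_c(\gamma_c+1)\varepsilon T$ for all $c$; $\sum_c\alpha_{c\ell}x_c=|\mathcal{L}_\ell|$ for all $\ell\in\Lambda$; $\sum_\ell\alpha_{c\ell}x_c+\sum_{j\in\mathcal{S}}y_{jc}\le x_c\delta_c k$ for all $c$. *)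

theory Defs
  imports Complex_Main "HOL-Library.Log_Nat" "HOL-Computational_Algebra.Polynomial"
begin

section \<open>Scheduling with setups after every batch of \<open>k\<close> jobs\<close>

text \<open>The jobs are the indices \<open>0, \<dots>, n - 1\<close>, the machines the indices \<open>0, \<dots>, m - 1\<close>.\<close>

record sup_instance =
  num_jobs :: nat
  num_machines :: nat
  batch_size :: nat        \<comment> \<open>\<open>k\<close>\<close>
  setup_time :: rat        \<comment> \<open>\<open>U\<close>\<close>
  job_size :: "nat \<Rightarrow> rat"  \<comment> \<open>\<open>p\<close>; only the values at indices of jobs matter\<close>

definition jobs :: "sup_instance \<Rightarrow> nat set" where
  "jobs I = {..<num_jobs I}"

definition is_sup_instance :: "sup_instance \<Rightarrow> bool" where
  "is_sup_instance I \<longleftrightarrow> num_machines I > 0 \<and> batch_size I > 0 \<and> setup_time I \<ge> 0 \<and>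
     (\<forall>j\<in>jobs I. job_size I j \<ge> 0)"

definition machine_load :: "sup_instance \<Rightarrow> nat set \<Rightarrow> rat" where
  "machine_load I \<sigma> =
     (if \<sigma> = {} then 0
      else (\<Sum>j\<in>\<sigma>. job_size I j) + setup_time I * of_nat ((card \<sigma> - 1) div batch_size I))"

text \<open>Machines may stay idle, so the parts of the partition may be empty.\<close>

definition is_schedule :: "sup_instance \<Rightarrow> (nat \<Rightarrow> nat set) \<Rightarrow> bool" where
  "is_schedule I \<sigma> \<longleftrightarrow>
     (\<Union>i<num_machines I. \<sigma> i) = jobs I \<and>
     (\<forall>i<num_machines I. \<forall>i'<num_machines I. i \<noteq> i' \<longrightarrow> \<sigma> i \<inter> \<sigma> i' = {})"

definition makespan :: "sup_instance \<Rightarrow> (nat \<Rightarrow> nat set) \<Rightarrow> rat" where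
  "makespan I \<sigma> = Max ((\<lambda>i. machine_load I (\<sigma> i)) ` {..<num_machines I})"

definition rounded_setting :: "rat \<Rightarrow> rat \<Rightarrow> sup_instance \<Rightarrow> bool" where
  "rounded_setting \<epsilon> T I \<longleftrightarrow>
     \<epsilon> > 0 \<and> 1 / \<epsilon> \<in> \<int> \<and> is_sup_instance I \<and>
     (\<forall>j\<in>jobs I. job_size I j = 0 \<or> (\<exists>e::int. job_size I j = (1 + \<epsilon>) powi e)) \<and>
     (\<exists>e::int. T = (1 + \<epsilon>) powi e) \<and>
     (\<forall>j\<in>jobs I. job_size I j \<le> T)"

definition small_jobs :: "rat \<Rightarrow> rat \<Rightarrow> sup_instance \<Rightarrow> nat set" where
  "small_jobs \<epsilon> T I = {j \<in> jobs I. job_size I j < \<epsilon> * T}"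

definition large_jobs :: "rat \<Rightarrow> rat \<Rightarrow> sup_instance \<Rightarrow> nat set" where
  "large_jobs \<epsilon> T I = {j \<in> jobs I. \<not> job_size I j < \<epsilon> * T}"

definition large_sizes :: "rat \<Rightarrow> rat \<Rightarrow> sup_instance \<Rightarrow> rat set" where
  "large_sizes \<epsilon> T I = job_size I ` large_jobs \<epsilon> T I"

definition large_jobs_of_size :: "rat \<Rightarrow> rat \<Rightarrow> sup_instance \<Rightarrow> rat \<Rightarrow> nat set" where
  "large_jobs_of_size \<epsilon> T I l = {j \<in> large_jobs \<epsilon> T I. job_size I j = l}"

definition modified_size :: "sup_instance \<Rightarrow> nat \<Rightarrow> rat" where
  "modified_size I j = job_size I j + setup_time I / of_nat (batch_size I)"


section \<open>Configurations\<close>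

record config =
  alpha :: "rat \<Rightarrow> nat"
  beta :: nat
  gamma :: nat
  gamma' :: bool
  delta :: nat

text \<open>The coefficients \<open>alpha\<close> are indexed by the distinct large sizes only; being a total function,
  \<open>alpha\<close> is set to \<open>0\<close> elsewhere, so that a configuration is determined by its coefficients.\<close>

definition is_config :: "rat \<Rightarrow> rat \<Rightarrow> sup_instance \<Rightarrow> config \<Rightarrow> bool" where
  "is_config \<epsilon> T I c \<longleftrightarrow>
     (\<forall>l. l \<notin> large_sizes \<epsilon> T I \<longrightarrow> alpha c l = 0) \<and>
     (\<not> gamma' c \<longrightarrow> gamma c = 0) \<and>
     of_nat (delta c) \<le> 1 / \<epsilon>"

definition config_load :: "rat \<Rightarrow> rat \<Rightarrow> sup_instance \<Rightarrow> config \<Rightarrow> rat" where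
  "config_load \<epsilon> T I c =
     (\<Sum>l\<in>large_sizes \<epsilon> T I. l * of_nat (alpha c l)) + of_nat (beta c) * \<epsilon> * T
     + of_bool (gamma' c) * of_nat (gamma c) * \<epsilon> * T
     + setup_time I * (of_nat (delta c) - 1 + of_bool (gamma' c))"

definition feasible_configs :: "rat \<Rightarrow> rat \<Rightarrow> sup_instance \<Rightarrow> config set" where
  "feasible_configs \<epsilon> T I = {c. is_config \<epsilon> T I c \<and> config_load \<epsilon> T I c \<le> T}"

text \<open>The sums over \<open>feasible_configs\<close> below are sums over a finite set:\<close>

lemma finite_feasible_configs:
  assumes "rounded_setting \<epsilon> T I"
  shows "finite (feasible_configs \<epsilon> T I)"
proof -
  let ?L = "large_sizes \<epsilon> T I" and ?U = "setup_time I"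
  have eps: "\<epsilon> > 0" and U: "?U \<ge> 0"
    using assms by (auto simp: rounded_setting_def is_sup_instance_def)
  have T: "T > 0"
    using assms eps by (auto simp: rounded_setting_def intro!: zero_less_power_int)
  define q where "q = \<epsilon> * T"
  have q: "q > 0" using eps T by (simp add: q_def)
  have L: "finite ?L"
    by (simp add: large_sizes_def large_jobs_def jobs_def)
  have Lq: "l \<ge> q" if "l \<in> ?L" for l
    using that by (auto simp: large_sizes_def large_jobs_def q_def not_less)
  define N where "N = nat \<lceil>(T + ?U) / q\<rceil>"
  define D where "D = nat \<lceil>1 / \<epsilon>\<rceil>"
  have N: "a \<le> N" if "of_nat a * q \<le> T + ?U" for a
  proof -
    have "of_nat a \<le> (T + ?U) / q" using that q by (simp add: pos_le_divide_eq)
    then show ?thesis unfolding N_def by linarith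
  qed
  define A where "A = {f. \<forall>l. (l \<in> ?L \<longrightarrow> f l \<in> {..N}) \<and> (l \<notin> ?L \<longrightarrow> f l = (0::nat))}"
  have A: "finite A" unfolding A_def by (rule finite_set_of_finite_funs) (use L in auto)
  have "c \<in> (\<lambda>(f, b, g, g', d). config.make f b g g' d) ` (A \<times> {..N} \<times> {..N} \<times> UNIV \<times> {..D})"
    if "c \<in> feasible_configs \<epsilon> T I" for c
  proof -
    have ic: "is_config \<epsilon> T I c" and cl: "config_load \<epsilon> T I c \<le> T"
      using that by (auto simp: feasible_configs_def)
    let ?S = "\<Sum>l\<in>?L. l * of_nat (alpha c l)"
    let ?g = "of_bool (gamma' c) * of_nat (gamma c) * q"
    let ?u = "?U * (of_nat (delta c) + of_bool (gamma' c))"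
    have sum: "?S + of_nat (beta c) * q + ?g + ?u \<le> T + ?U"
      using cl by (simp add: config_load_def q_def algebra_simps)
    have nn: "l * of_nat (alpha c l) \<ge> 0" if "l \<in> ?L" for l
      using Lq[OF that] q by simp
    have S: "?S \<ge> 0" by (intro sum_nonneg nn)
    have b0: "of_nat (beta c) * q \<ge> 0" and g0: "?g \<ge> 0" and u0: "?u \<ge> 0"
      using q U by auto
    have "beta c \<le> N" by (rule N) (use sum S g0 u0 in linarith)
    moreover have "gamma c \<le> N"
    proof (cases "gamma' c")
      case True
      show ?thesis by (rule N) (use sum S b0 u0 True in simp)
    qed (use ic in \<open>auto simp: is_config_def\<close>)
    moreover have "delta c \<le> D"
      using ic unfolding is_config_def D_def by linarith
    moreover have "alpha c l \<le> N" if "l \<in> ?L" for l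
    proof (rule N)
      have "of_nat (alpha c l) * q \<le> l * of_nat (alpha c l)"
        using mult_right_mono[OF Lq[OF that], of "of_nat (alpha c l)"] by (simp add: mult.commute)
      also have "\<dots> \<le> ?S" by (rule member_le_sum) (use that L nn in auto)
      finally show "of_nat (alpha c l) * q \<le> T + ?U" using sum b0 g0 u0 by linarith
    qed
    moreover have "alpha c l = 0" if "l \<notin> ?L" for l
      using ic that by (simp add: is_config_def)
    ultimately show ?thesis
      by (intro image_eqI[where x = "(alpha c, beta c, gamma c, gamma' c, delta c)"])
         (auto simp: A_def config.make_def)
  qed
  then have "feasible_configs \<epsilon> T I \<subseteq>
      (\<lambda>(f, b, g, g', d). config.make f b g g' d) ` (A \<times> {..N} \<times> {..N} \<times> UNIV \<times> {..D})"
    by blast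
  then show ?thesis by (rule finite_subset) (use A in auto)
qed


section \<open>The mixed-integer linear program\<close>

definition milp_feasible :: "rat \<Rightarrow> rat \<Rightarrow> sup_instance \<Rightarrow> (config \<Rightarrow> nat) \<Rightarrow>
    (nat \<Rightarrow> config \<Rightarrow> real) \<Rightarrow> (nat \<Rightarrow> config \<Rightarrow> real) \<Rightarrow> bool" where
  "milp_feasible \<epsilon> T I x y z \<longleftrightarrow>
     (let C = feasible_configs \<epsilon> T I; S = small_jobs \<epsilon> T I; \<Lambda> = large_sizes \<epsilon> T I in
      (\<forall>j\<in>S. \<forall>c\<in>C. y j c \<in> {0..1} \<and> z j c \<in> {0..1}) \<and>
      (\<Sum>c\<in>C. x c) = num_machines I \<and>
      (\<forall>j\<in>S. (\<Sum>c\<in>C. y j c + z j c) = 1) \<and>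
      (\<forall>c\<in>C. (\<Sum>j\<in>S. y j c * of_rat (job_size I j))
               \<le> real (x c) * (real (beta c) + 1) * of_rat (\<epsilon> * T)) \<and>
      (\<forall>c\<in>C. (\<Sum>j\<in>S. z j c * of_rat (modified_size I j))
               \<le> real (x c) * of_bool (gamma' c) * (real (gamma c) + 1) * of_rat (\<epsilon> * T)) \<and>
      (\<forall>l\<in>\<Lambda>. (\<Sum>c\<in>C. alpha c l * x c) = card (large_jobs_of_size \<epsilon> T I l)) \<and>
      (\<forall>c\<in>C. real ((\<Sum>l\<in>\<Lambda>. alpha c l * x c)) + (\<Sum>j\<in>S. y j c)
               \<le> real (x c) * real (delta c) * real (batch_size I)))"


section \<open>Polynomial time\<close>

text \<open>
  The machine model is the random access machine with logarithmic cost, in structured form: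
  a fixed program works on finitely many arrays of unbounded integers, indexed by integers
  (a scalar variable is a cell with a constant index). Every evaluated subterm, including every
  address, is charged the bit length of its value. Each elementary operation can be simulated on a
  Turing machine in time polynomial in the cost charged so far plus the input length, and
  conversely a Turing machine step has logarithmic cost, so the model defines
  the usual notion of polynomial time.
\<close>

datatype expr =
    Const int
  | Cell nat expr  \<comment> \<open>\<open>Cell a e\<close> is the cell with index \<open>e\<close> of array \<open>a\<close>\<close>
  | Plus expr expr
  | Minus expr expr
  | Times expr expr
  | Div expr expr
  | Less expr expr

type_synonym store = "nat \<Rightarrow> int \<Rightarrow> int"

fun eval_expr :: "expr \<Rightarrow> store \<Rightarrow> int" where
  "eval_expr (Const i) s = i"
| "eval_expr (Cell a e) s = s a (eval_expr e s)"
| "eval_expr (Plus e f) s = eval_expr e s + eval_expr f s"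
| "eval_expr (Minus e f) s = eval_expr e s - eval_expr f s"
| "eval_expr (Times e f) s = eval_expr e s * eval_expr f s"
| "eval_expr (Div e f) s = eval_expr e s div eval_expr f s"
| "eval_expr (Less e f) s = (if eval_expr e s < eval_expr f s then 1 else 0)"

text \<open>Length of the binary representation, plus one for the sign.\<close>

definition bits :: "int \<Rightarrow> nat" where
  "bits i = 1 + nat (bitlen \<bar>i\<bar>)"

fun expr_cost :: "expr \<Rightarrow> store \<Rightarrow> nat" where
  "expr_cost (Const i) s = bits i"
| "expr_cost (Cell a e) s = expr_cost e s + bits (s a (eval_expr e s))"
| "expr_cost (Plus e f) s = expr_cost e s + expr_cost f s + bits (eval_expr (Plus e f) s)"
| "expr_cost (Minus e f) s = expr_cost e s + expr_cost f s + bits (eval_expr (Minus e f) s)"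
| "expr_cost (Times e f) s = expr_cost e s + expr_cost f s + bits (eval_expr (Times e f) s)"
| "expr_cost (Div e f) s = expr_cost e s + expr_cost f s + bits (eval_expr (Div e f) s)"
| "expr_cost (Less e f) s = expr_cost e s + expr_cost f s + bits (eval_expr (Less e f) s)"

datatype prog =
    Skip
  | Assign nat expr expr  \<comment> \<open>\<open>Assign a e f\<close> stores \<open>f\<close> in the cell with index \<open>e\<close> of array \<open>a\<close>\<close>
  | Seq prog prog
  | If expr prog prog     \<comment> \<open>a condition is true iff its value is nonzero\<close>
  | While expr prog

text \<open>\<open>exec P s t s'\<close>: started in store \<open>s\<close>, the program \<open>P\<close> halts in store \<open>s'\<close> at total cost \<open>t\<close>.\<close>

inductive exec :: "prog \<Rightarrow> store \<Rightarrow> nat \<Rightarrow> store \<Rightarrow> bool" where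
  Skip: "exec Skip s 1 s"
| Assign: "exec (Assign a e f) s (1 + expr_cost e s + expr_cost f s)
             (s(a := (s a)(eval_expr e s := eval_expr f s)))"
| Seq: "exec P s t s' \<Longrightarrow> exec Q s' u s'' \<Longrightarrow> exec (Seq P Q) s (t + u) s''"
| If_True: "eval_expr e s \<noteq> 0 \<Longrightarrow> exec P s t s' \<Longrightarrow> exec (If e P Q) s (expr_cost e s + t) s'"
| If_False: "eval_expr e s = 0 \<Longrightarrow> exec Q s t s' \<Longrightarrow> exec (If e P Q) s (expr_cost e s + t) s'"
| While_False: "eval_expr e s = 0 \<Longrightarrow> exec (While e P) s (expr_cost e s) s"
| While_True: "eval_expr e s \<noteq> 0 \<Longrightarrow> exec P s t s' \<Longrightarrow> exec (While e P) s' u s'' \<Longrightarrow>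
    exec (While e P) s (expr_cost e s + t + u) s''"

inductive_cases exec_elims:
  "exec Skip s t s'" "exec (Assign a e f) s t s'" "exec (Seq P Q) s t s'" "exec (If e P Q) s t s'"

inductive_cases exec_WhileE: "exec (While e P) s t s'"

lemma exec_deterministic:
  "exec P s t s' \<Longrightarrow> exec P s u s'' \<Longrightarrow> t = u \<and> s' = s''"
proof (induction arbitrary: u s'' rule: exec.induct)
  case (Skip s)
  then show ?case by (auto elim: exec_elims)
next
  case (Assign a e f s)
  then show ?case by (auto elim: exec_elims)
next
  case (Seq P s t s' Q v r)
  from Seq.prems obtain t1 r1 u1 where "exec P s t1 r1" "exec Q r1 u1 s''" "u = t1 + u1"
    by (blast elim: exec_elims)
  with Seq.IH show ?case by blast
next
  case (If_True e s P t s' Q)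
  from If_True.prems If_True.hyps(1) obtain t1 where "exec P s t1 s''" "u = expr_cost e s + t1"
    by (blast elim: exec_elims)
  with If_True.IH show ?case by blast
next
  case (If_False e s Q t s' P)
  from If_False.prems If_False.hyps(1) obtain t1 where "exec Q s t1 s''" "u = expr_cost e s + t1"
    by (blast elim: exec_elims)
  with If_False.IH show ?case by blast
next
  case (While_False e s P)
  then show ?case by (auto elim: exec_WhileE)
next
  case (While_True e s P t s' v r)
  from While_True.prems While_True.hyps(1) obtain t1 r1 u1
    where "exec P s t1 r1" "exec (While e P) r1 u1 s''" "u = expr_cost e s + t1 + u1"
    by (blast elim: exec_WhileE)
  with While_True.IH show ?case by blast
qed

text \<open>Input and output are integer lists. The elements are in array \<open>0\<close> from index \<open>0\<close> on, the
  length is in cell \<open>0\<close> of array \<open>1\<close>; all other cells are initially \<open>0\<close>.\<close>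

definition init_store :: "int list \<Rightarrow> store" where
  "init_store xs = (\<lambda>a i.
     if a = 0 \<and> 0 \<le> i \<and> i < int (length xs) then xs ! nat i
     else if a = 1 \<and> i = 0 then int (length xs)
     else 0)"

definition output_list :: "store \<Rightarrow> int list" where
  "output_list s = map (\<lambda>i. s 0 (int i)) [0..<nat (s 1 0)]"

definition encoding_length :: "int list \<Rightarrow> nat" where
  "encoding_length xs = (\<Sum>i\<leftarrow>xs. bits i)"

text \<open>\<open>poly_time_search D enc R\<close>: one program computes, for every admissible input \<open>w \<in> D\<close>, given in
  the encoding \<open>enc\<close>, some output related to \<open>w\<close> by \<open>R\<close>, in time polynomial in the encoding length.\<close>

definition poly_time_search ::
    "'a set \<Rightarrow> ('a \<Rightarrow> int list) \<Rightarrow> ('a \<Rightarrow> int list \<Rightarrow> bool) \<Rightarrow> bool" where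
  "poly_time_search D enc R \<longleftrightarrow>
     (\<exists>P. \<exists>q :: nat poly. \<forall>w\<in>D. \<exists>t s.
        exec P (init_store (enc w)) t s \<and> t \<le> poly q (encoding_length (enc w)) \<and>
        R w (output_list s))"


section \<open>The algorithmic problem\<close>

text \<open>The input: a SUP instance with \<open>\<epsilon>\<close> and \<open>T\<close>, a list of all feasible configurations, and a
  rational feasible solution of the MILP.\<close>

record rounding_input =
  in_eps :: rat
  in_T :: rat
  in_instance :: sup_instance
  in_configs :: "config list"
  in_x :: "config \<Rightarrow> nat"
  in_y :: "nat \<Rightarrow> config \<Rightarrow> rat"
  in_z :: "nat \<Rightarrow> config \<Rightarrow> rat"

definition is_rounding_input :: "rounding_input \<Rightarrow> bool" where
  "is_rounding_input w \<longleftrightarrow>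
     rounded_setting (in_eps w) (in_T w) (in_instance w) \<and>
     distinct (in_configs w) \<and>
     set (in_configs w) = feasible_configs (in_eps w) (in_T w) (in_instance w) \<and>
     milp_feasible (in_eps w) (in_T w) (in_instance w) (in_x w)
       (\<lambda>j c. of_rat (in_y w j c)) (\<lambda>j c. of_rat (in_z w j c))"

text \<open>Rational numbers are encoded by numerator and denominator in lowest terms.\<close>

definition encode_rat :: "rat \<Rightarrow> int list" where
  "encode_rat r = [fst (quotient_of r), snd (quotient_of r)]"

definition encode_instance :: "sup_instance \<Rightarrow> int list" where
  "encode_instance I =
     [int (num_jobs I), int (num_machines I), int (batch_size I)] @ encode_rat (setup_time I) @
     concat (map (\<lambda>j. encode_rat (job_size I j)) [0..<num_jobs I])"

text \<open>The first argument is the list of the distinct large sizes.\<close>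

definition encode_config :: "rat list \<Rightarrow> config \<Rightarrow> int list" where
  "encode_config ls c =
     map (\<lambda>l. int (alpha c l)) ls @
     [int (beta c), int (gamma c), of_bool (gamma' c), int (delta c)]"

definition encode_input :: "rounding_input \<Rightarrow> int list" where
  "encode_input w =
     (let ls = sorted_list_of_set (large_sizes (in_eps w) (in_T w) (in_instance w));
          js = sorted_list_of_set (small_jobs (in_eps w) (in_T w) (in_instance w)) in
      encode_rat (in_eps w) @ encode_rat (in_T w) @ encode_instance (in_instance w) @
      int (length ls) # concat (map encode_rat ls) @
      int (length (in_configs w)) #
      concat (map (\<lambda>c. encode_config ls c @ int (in_x w c) #
                        concat (map (\<lambda>j. encode_rat (in_y w j c) @ encode_rat (in_z w j c)) js))
                  (in_configs w)))"

text \<open>A schedule is output as the list of the machines of the jobs \<open>0, \<dots>, n - 1\<close>.\<close>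

definition schedule_of_list :: "int list \<Rightarrow> nat \<Rightarrow> nat set" where
  "schedule_of_list out i = {j. j < length out \<and> out ! j = int i}"

end

theory Submission
  imports Defs
begin

text \<open>
  Process the jobs in order of non-increasing size. A large job of size \<open>l\<close> goes to any configuration
  \<open>c\<close> that has received fewer than \<open>\<alpha>\<^sub>c\<^sub>l x\<^sub>c\<close> jobs of this size; a small job goes to any configuration \<open>c\<close>
  with \<open>x\<^sub>c > 0\<close> that has received fewer small jobs than the sum of \<open>y\<^sub>j\<^sub>c + z\<^sub>j\<^sub>c\<close> over the small jobs \<open>j\<close>
  seen so far. Such a configuration exists because these bounds add up to the number of jobs seen so
  far; the only exception are jobs of size \<open>0\<close> when \<open>U = 0\<close>, which can be placed anywhere. The jobs of a
  configuration are dealt to its \<open>x\<^sub>c\<close> machines in turn. Then the number of jobs in each prefix of the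
  order on a machine exceeds its fractional counterpart by less than one, so by summation by parts
  the total of any monotone size function on a machine is at most the fractional average plus one job.
  For \<open>\<gamma>' = 1\<close> this is applied to the modified sizes of all jobs on the machine, so that only one
  rounding error occurs: the load is at most \<open>L\<^sub>c + 2 \<epsilon> T\<close> plus one small job.

  This rule only involves sums over ranges shorter than the input. Terms built from arithmetic, array
  access and such sums are evaluated in polynomial time, and so is a bounded number of
  phases that fill an array with the values of a term.
\<close>

section \<open>Terms with bounded sums on the random access machine\<close>

text \<open>Existence is claimed for real solutions, while the algorithmic part asks for an explicit
  program with a cost bound. Rounding via vertex solutions or matchings would mean programming
  linear algebra or flows; comparing counters with prefix sums takes only a few terms. Both parts
  meet in the fixed-point equation \<open>cf r = pick cf r\<close>: the load analysis uses nothing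
  else about the assignment, so \<open>cf\<close> may come from recursion on the ranks or be read
  off an array filled by the program. Scaling by a common multiple of the denominators makes the
  comparisons exact; being a product of input entries, this multiple has bit length at most the
  encoding length. Bit lengths are endangered by phases that read their own results, since every
  cell could multiply the length of the previous ones. There are two such phases: one computes these
  products, the other only counts. When \<open>gamma'\<close> is false and \<open>U > 0\<close>, the
  configuration pays for \<open>delta - 1\<close> setups only, too few for the modified sizes; there
  the number of jobs on a machine is bounded by exactly \<open>delta * k\<close>, its rounding error
  vanishing by integrality.\<close>

abbreviation tmp :: nat where "tmp \<equiv> 11"

datatype binop = Add | Sub | Mul | Quot | Lt

fun op_expr :: "binop \<Rightarrow> expr \<Rightarrow> expr \<Rightarrow> expr" where
  "op_expr Add = Plus"
| "op_expr Sub = Minus"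
| "op_expr Mul = Times"
| "op_expr Quot = Div"
| "op_expr Lt = Less"

fun op_val :: "binop \<Rightarrow> int \<Rightarrow> int \<Rightarrow> int" where
  "op_val Add a b = a + b"
| "op_val Sub a b = a - b"
| "op_val Mul a b = a * b"
| "op_val Quot a b = a div b"
| "op_val Lt a b = of_bool (a < b)"

text \<open>\<open>Sum v t\<close> binds \<open>v\<close> and always ranges below the input length,
  kept in cell 0 of array 1. A term therefore compiles to loops of fixed nesting depth, and its
  polynomial cost follows by structural induction.\<close>

datatype tm = Num int | Var nat | Arr nat tm | Bin binop tm tm | Sum nat tm

fun tval :: "tm \<Rightarrow> (nat \<Rightarrow> int) \<Rightarrow> store \<Rightarrow> int" where
  "tval (Num i) \<rho> s = i"
| "tval (Var v) \<rho> s = \<rho> v"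
| "tval (Arr a t) \<rho> s = s a (tval t \<rho> s)"
| "tval (Bin b t u) \<rho> s = op_val b (tval t \<rho> s) (tval u \<rho> s)"
| "tval (Sum v t) \<rho> s = (\<Sum>i<nat (s 1 0). tval t (\<rho>(v := int i)) s)"

fun arrays :: "tm \<Rightarrow> nat set" where
  "arrays (Num i) = {}"
| "arrays (Var v) = {}"
| "arrays (Arr a t) = insert a (arrays t)"
| "arrays (Bin b t u) = arrays t \<union> arrays u"
| "arrays (Sum v t) = insert 1 (arrays t)"

fun tsize :: "tm \<Rightarrow> nat" where
  "tsize (Num i) = Suc (nat \<bar>i\<bar>)"
| "tsize (Var v) = 1"
| "tsize (Arr a t) = Suc (tsize t)"
| "tsize (Bin b t u) = Suc (tsize t + tsize u)"
| "tsize (Sum v t) = Suc (tsize t)"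

text \<open>The scratch array \<open>tmp\<close> serves as an evaluation stack (arrays 0 to 10
  belong to the input and the phases): the value ends up in cell \<open>d\<close>, the cells below
  \<open>d\<close> are preserved, and \<open>\<rho>\<close> gives the cell that holds each variable.
  For \<open>Sum\<close>, cell \<open>d\<close> is the loop counter and at the same time the bound
  variable, cell \<open>Suc d\<close> the accumulator.\<close>

fun compile :: "tm \<Rightarrow> (nat \<Rightarrow> nat) \<Rightarrow> nat \<Rightarrow> prog" where
  "compile (Num i) \<rho> d = Assign tmp (Const (int d)) (Const i)"
| "compile (Var v) \<rho> d = Assign tmp (Const (int d)) (Cell tmp (Const (int (\<rho> v))))"
| "compile (Arr a t) \<rho> d = Seq (compile t \<rho> d)
     (Assign tmp (Const (int d)) (Cell a (Cell tmp (Const (int d)))))"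
| "compile (Bin b t u) \<rho> d = Seq (compile t \<rho> d) (Seq (compile u \<rho> (Suc d))
     (Assign tmp (Const (int d))
       (op_expr b (Cell tmp (Const (int d))) (Cell tmp (Const (int (Suc d)))))))"
| "compile (Sum v t) \<rho> d =
     Seq (Assign tmp (Const (int d)) (Const 0))
    (Seq (Assign tmp (Const (int (Suc d))) (Const 0))
    (Seq (While (Less (Cell tmp (Const (int d))) (Cell 1 (Const 0)))
           (Seq (compile t (\<rho>(v := d)) (Suc (Suc d)))
           (Seq (Assign tmp (Const (int (Suc d)))
                  (Plus (Cell tmp (Const (int (Suc d)))) (Cell tmp (Const (int (Suc (Suc d)))))))
             (Assign tmp (Const (int d)) (Plus (Cell tmp (Const (int d))) (Const 1))))))
      (Assign tmp (Const (int d)) (Cell tmp (Const (int (Suc d)))))))"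

lemma tval_cong:
  "(\<And>a. a \<in> arrays t \<Longrightarrow> s a = s' a) \<Longrightarrow> tval t \<rho> s = tval t \<rho> s'"
  by (induction t arbitrary: \<rho>) (auto intro!: sum.cong)

section \<open>Bit lengths of the values of terms\<close>

declare of_nat_le_numeral_power_cancel_iff [simp del]

lemma abs_int_le: "j \<le> nat l \<Longrightarrow> \<bar>l\<bar> \<le> b \<Longrightarrow> \<bar>int j\<bar> \<le> b"
  by linarith

text \<open>The scratch array is exempt because its contents are values of subterms, controlled by
  \<open>tval_bound\<close>. With \<open>B \<ge> 1\<close>, multiplying the exponent by the size of
  a term also absorbs additive constants.\<close>

definition bounded_store :: "nat \<Rightarrow> store \<Rightarrow> bool" where
  "bounded_store B s \<longleftrightarrow> B \<ge> 1 \<and> (\<forall>a i. a \<noteq> tmp \<longrightarrow> \<bar>s a i\<bar> \<le> 2 ^ B)"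

lemma bounded_store_mono: "bounded_store B s \<Longrightarrow> B \<le> B' \<Longrightarrow> bounded_store B' s"
  unfolding bounded_store_def
  by (meson le_trans order_trans power_increasing one_le_numeral)

lemma pow2_int_mono: "a \<le> 2 ^ m \<Longrightarrow> m \<le> n \<Longrightarrow> a \<le> (2::int) ^ n"
  by (meson order_trans power_increasing one_le_numeral)

lemma abs_int_div_le: "\<bar>a div b\<bar> \<le> \<bar>a :: int\<bar>"
proof -
  have *: "\<bar>a div b\<bar> \<le> \<bar>a\<bar>" if "b > 0" for a b :: int
  proof (cases "a \<ge> 0")
    case True
    then have "a div b \<le> a div 1" by (rule zdiv_mono2) (use that in auto)
    then show ?thesis using that True by (simp add: pos_imp_zdiv_nonneg_iff)
  next
    case False
    then have "a div 1 \<le> a div b" by (intro zdiv_mono2_neg) (use that in auto)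
    moreover have "a div b < 0" using False that by (simp add: div_neg_pos_less0)
    ultimately show ?thesis by simp
  qed
  consider "b = 0" | "b > 0" | "- b > 0" by linarith
  then show ?thesis
  proof cases
    case 3
    then show ?thesis using *[of "- b" "- a"] by simp
  qed (use * in auto)
qed

lemma op_val_bound:
  assumes "\<bar>a\<bar> \<le> 2 ^ m" "\<bar>b\<bar> \<le> 2 ^ n"
  shows "\<bar>op_val f a b\<bar> \<le> 2 ^ (m + n + 1)"
proof -
  define P where "P = (2::int) ^ (m + n)"
  have "(2::int) ^ m \<le> P" "(2::int) ^ n \<le> P"
    by (auto simp: P_def intro: power_increasing)
  moreover have "\<bar>a * b\<bar> \<le> P"
    using mult_mono[OF assms] by (simp add: P_def power_add abs_mult)
  moreover have "P \<ge> 1" by (simp add: P_def)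
  ultimately have "\<bar>op_val f a b\<bar> \<le> 2 * P"
    using assms abs_int_div_le[of a b] by (cases f) simp_all
  then show ?thesis by (simp add: P_def)
qed

text \<open>A product adds the exponents of its factors, and a sum has at most \<open>2 ^ B\<close>
  summands, which adds \<open>B\<close>. The bound is linear in \<open>B\<close>, so a fixed number
  of successive evaluations costs only a constant factor in the bit length.\<close>

lemma tval_bound:
  assumes "bounded_store B s" "tmp \<notin> arrays t" "\<And>v. \<bar>\<rho> v\<bar> \<le> 2 ^ B"
  shows "\<bar>tval t \<rho> s\<bar> \<le> 2 ^ (B * tsize t)"
  using assms(2,3)
proof (induction t arbitrary: \<rho>)
  case (Num i)
  have "\<bar>i\<bar> \<le> 2 ^ nat \<bar>i\<bar>"
    using less_exp[of "nat \<bar>i\<bar>"]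
    by (metis abs_ge_zero int_nat_eq less_imp_le of_nat_le_iff of_nat_numeral of_nat_power)
  moreover have "nat \<bar>i\<bar> \<le> B * tsize (Num i)"
    using assms(1) by (cases B) (auto simp: bounded_store_def)
  ultimately show ?case by (auto intro: pow2_int_mono)
next
  case (Var v)
  then show ?case by simp
next
  case (Arr a t)
  then have "\<bar>tval (Arr a t) \<rho> s\<bar> \<le> 2 ^ B"
    using assms(1) by (auto simp: bounded_store_def)
  then show ?case by (auto intro: pow2_int_mono)
next
  case (Bin b t u)
  have "\<bar>tval (Bin b t u) \<rho> s\<bar> \<le> 2 ^ (B * tsize t + B * tsize u + 1)"
    unfolding tval.simps by (rule op_val_bound) (use Bin in auto)
  moreover have "B * tsize t + B * tsize u + 1 \<le> B * tsize (Bin b t u)"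
    using assms(1) by (auto simp: bounded_store_def algebra_simps)
  ultimately show ?case by (rule pow2_int_mono)
next
  case (Sum v t)
  have L: "\<bar>s 1 0\<bar> \<le> 2 ^ B" using assms(1) by (auto simp: bounded_store_def)
  have "\<bar>tval (Sum v t) \<rho> s\<bar> \<le> (\<Sum>i<nat (s 1 0). \<bar>tval t (\<rho>(v := int i)) s\<bar>)"
    by simp
  also have "\<dots> \<le> (\<Sum>i<nat (s 1 0). 2 ^ (B * tsize t))"
  proof (rule sum_mono)
    fix i assume "i \<in> {..<nat (s 1 0)}"
    then have "int i < s 1 0" by (simp add: zless_nat_eq_int_zless)
    then have "\<bar>int i\<bar> \<le> 2 ^ B" using L by linarith
    then show "\<bar>tval t (\<rho>(v := int i)) s\<bar> \<le> 2 ^ (B * tsize t)"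
      using Sum.prems by (intro Sum.IH) auto
  qed
  also have "\<dots> = int (nat (s 1 0)) * 2 ^ (B * tsize t)" by simp
  also have "\<dots> \<le> 2 ^ B * 2 ^ (B * tsize t)"
    using L by (intro mult_right_mono) auto
  also have "\<dots> = 2 ^ (B * tsize (Sum v t))" by (simp add: power_add)
  finally show ?case .
qed

section \<open>Cost and correctness of compiled terms\<close>

lemma bits_le: "\<bar>v\<bar> \<le> 2 ^ b \<Longrightarrow> bits v \<le> b + 2"
proof -
  assume "\<bar>v\<bar> \<le> 2 ^ b"
  then have "\<bar>v\<bar> < 2 ^ (b + 1)" 
    using zero_less_power[of "2::int" b] unfolding power_add power_one_right by linarith
  then have "bitlen \<bar>v\<bar> \<le> int (b + 1)"
    using bitlen_le_iff_power[of "\<bar>v\<bar>" "int (b + 1)"] unfolding nat_int by linarith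
  then show ?thesis by (simp add: bits_def)
qed

lemma abs_le_pow_bits: "\<bar>v\<bar> \<le> 2 ^ bits v"
proof -
  have "bitlen \<bar>v\<bar> \<le> int (bits v)" by (simp add: bits_def)
  then have "\<bar>v\<bar> < 2 ^ bits v"
    using bitlen_le_iff_power[of "\<bar>v\<bar>" "int (bits v)"] unfolding nat_int by linarith
  then show ?thesis by simp
qed

lemma bits_nat_le: "bits (int d) \<le> d + 2"
  by (rule bits_le) (metis abs_of_nat less_exp less_imp_le of_nat_le_iff of_nat_numeral of_nat_power)

lemma le_pow_self: "(2::nat) \<le> X \<Longrightarrow> c \<le> X ^ c"
  by (meson le_trans less_exp less_imp_le power_mono zero_le)

lemma le_pow_add:
  fixes X :: nat
  assumes "2 \<le> X" "a \<le> X ^ p" "b \<le> X ^ q"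
  shows "a + b \<le> X ^ (p + q + 1)"
proof -
  have "a \<le> X ^ (p + q)" "b \<le> X ^ (p + q)"
    using assms by (auto intro: order_trans power_increasing)
  then have "a + b \<le> 2 * X ^ (p + q)" by simp
  also have "\<dots> \<le> X * X ^ (p + q)" using assms by (intro mult_right_mono) auto
  finally show ?thesis by simp
qed

lemma le_pow_mult: "a \<le> X ^ p \<Longrightarrow> b \<le> X ^ q \<Longrightarrow> a * b \<le> (X::nat) ^ (p + q)"
  by (simp add: mult_le_mono power_add)

text \<open>\<open>W\<close> covers the guard together with the body; the factor is
  \<open>Suc n\<close> because the guard is evaluated once more when it fails.\<close>

lemma exec_loop:
  assumes step: "\<And>i s. i < n \<Longrightarrow> Inv i s \<Longrightarrow> eval_expr b s \<noteq> 0 \<and>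
      (\<exists>c s'. exec P s c s' \<and> expr_cost b s + c \<le> W \<and> Inv (Suc i) s')"
    and stop: "\<And>s. Inv n s \<Longrightarrow> eval_expr b s = 0 \<and> expr_cost b s \<le> W"
    and init: "Inv 0 s"
  shows "\<exists>c s'. exec (While b P) s c s' \<and> c \<le> Suc n * W \<and> Inv n s'"
proof -
  have "\<exists>c s'. exec (While b P) s c s' \<and> c \<le> Suc (n - i) * W \<and> Inv n s'"
    if "i \<le> n" "Inv i s" for i s
    using that
  proof (induction "n - i" arbitrary: i s)
    case 0
    then show ?case using stop[of s] While_False by fastforce
  next
    case (Suc k)
    then obtain c s' where 1: "eval_expr b s \<noteq> 0" "exec P s c s'" "expr_cost b s + c \<le> W"
      "Inv (Suc i) s'" using step[of i s] by (metis zero_less_Suc zero_less_diff)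
    obtain c' s'' where 2: "exec (While b P) s' c' s''" "c' \<le> Suc (n - Suc i) * W" "Inv n s''"
    proof -
      have "k = n - Suc i" "Suc i \<le> n" using Suc.hyps(2) by auto
      from Suc.hyps(1)[OF this 1(4)] show ?thesis using that by blast
    qed
    have "exec (While b P) s (expr_cost b s + c + c') s''"
      using 1 2 by (intro While_True)
    moreover have "n - i = Suc (n - Suc i)" using Suc.hyps by simp
    then have "expr_cost b s + c + c' \<le> Suc (n - i) * W" using 1(3) 2(2) by simp
    ultimately show ?case using 2(3) by blast
  qed
  from this[of 0 s] init show ?thesis by simp
qed

lemma exec_AssignI:
  "c = 1 + expr_cost e s + expr_cost f s \<Longrightarrow> s' = s(a := (s a)(eval_expr e s := eval_expr f s)) \<Longrightarrow>
    exec (Assign a e f) s c s'"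
  using Assign[of a e f s] by simp

text \<open>Cost bounds have the form \<open>X ^ K\<close> with \<open>X = B + L + 2\<close>, where \<open>B\<close> bounds the bit lengths in
  the store and \<open>L\<close> is the input length: this shape is closed under sums and loops.\<close>

definition comp_ok :: "tm \<Rightarrow> nat \<Rightarrow> nat \<Rightarrow> bool" where
  "comp_ok t d K \<longleftrightarrow> (\<forall>\<rho> s B. (\<forall>v. \<rho> v < d) \<longrightarrow> bounded_store B s \<longrightarrow>
     (\<forall>v. \<bar>s tmp (int (\<rho> v))\<bar> \<le> 2 ^ B) \<longrightarrow>
     (\<exists>c s'. exec (compile t \<rho> d) s c s' \<and> c \<le> (B + nat (s 1 0) + 2) ^ K \<and>
       s' tmp (int d) = tval t (\<lambda>v. s tmp (int (\<rho> v))) s \<and>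
       (\<forall>a. a \<noteq> tmp \<longrightarrow> s' a = s a) \<and> (\<forall>i<d. s' tmp (int i) = s tmp (int i))))"

lemma comp_okD:
  assumes "comp_ok t d K" "\<And>v. \<rho> v < d" "bounded_store B s" "\<And>v. \<bar>s tmp (int (\<rho> v))\<bar> \<le> 2 ^ B"
  obtains c s' where "exec (compile t \<rho> d) s c s'" "c \<le> (B + nat (s 1 0) + 2) ^ K"
    "s' tmp (int d) = tval t (\<lambda>v. s tmp (int (\<rho> v))) s"
    "\<And>a. a \<noteq> tmp \<Longrightarrow> s' a = s a" "\<And>i. i < d \<Longrightarrow> s' tmp (int i) = s tmp (int i)"
  using assms unfolding comp_ok_def by metis

lemma bounded_store_cong:
  "(\<And>a. a \<noteq> tmp \<Longrightarrow> s' a = s a) \<Longrightarrow> bounded_store B s' = bounded_store B s"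
  by (auto simp: bounded_store_def)

lemma op_expr_cost:
  "expr_cost (op_expr b e f) s = expr_cost e s + expr_cost f s + bits (op_val b (eval_expr e s) (eval_expr f s))"
  "eval_expr (op_expr b e f) s = op_val b (eval_expr e s) (eval_expr f s)"
  by (cases b; simp)+

text \<open>The cost of a single assignment is affine in the bit bound \<open>B\<close>; this brings
  it into the common shape of the cost bounds.\<close>

lemma affine_le_pow:
  assumes "a \<le> c + B * k"
  shows "a \<le> (B + L + 2) ^ (c + k + 2)"
proof -
  let ?X = "B + L + 2"
  have "B * k \<le> ?X ^ (1 + k)" by (rule le_pow_mult) (auto intro: le_pow_self)
  then have "c + B * k \<le> ?X ^ (c + (1 + k) + 1)" by (intro le_pow_add le_pow_self) auto
  with assms show ?thesis by simp
qed

lemma comp_ok_Sum: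
  assumes K: "comp_ok t (Suc (Suc d)) K" and "tmp \<notin> arrays t"
  shows "\<exists>K. comp_ok (Sum v t) d K"
proof -
  \<comment> \<open>Generous exponents: \<open>c1\<close> for an affine cost, \<open>KW\<close> for
    one iteration with its guard, \<open>KK\<close> for two initialisations, the loop and the final
    copy. The 2 in \<open>2 + KW\<close> pays for the number of iterations.\<close>
  define c1 where "c1 = (10 * (d + 4) + 30 + 3 * tsize t) + (10 + 3 * tsize t) + 2"
  define KW where "KW = c1 + (K + c1 + 1) + 1"
  define KK where "KK = c1 + (c1 + ((2 + KW) + c1 + 1) + 1) + 1"
  have "comp_ok (Sum v t) d KK"
    unfolding comp_ok_def
  proof (intro allI impI, goal_cases)
    case (1 \<rho> s B)
    let ?\<rho> = "\<lambda>v. s tmp (int (\<rho> v))"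
    let ?L = "nat (s 1 0)"
    let ?X = "B + ?L + 2"
    have Lb: "\<bar>s 1 0\<bar> \<le> 2 ^ B" using 1 by (auto simp: bounded_store_def)
    have tm: "tmp \<notin> arrays t" using assms(2) .
    let ?acc = "\<lambda>i. \<Sum>j<i. tval t (?\<rho>(v := int j)) s"
    have tb: "\<bar>tval t (?\<rho>(v := int j)) s\<bar> \<le> 2 ^ (B * tsize t)" if "j < ?L" for j
    proof (rule tval_bound)
      show "\<bar>(?\<rho>(v := int j)) w\<bar> \<le> 2 ^ B" for w
        using 1(3) abs_int_le[OF less_imp_le[OF that] Lb] by auto
    qed (use 1 tm in auto)
    have acc: "\<bar>?acc i\<bar> \<le> 2 ^ (B * Suc (tsize t))" if "i \<le> ?L" for i
    proof -
      have "\<bar>?acc i\<bar> \<le> (\<Sum>j<i. \<bar>tval t (?\<rho>(v := int j)) s\<bar>)" by simp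
      also have "\<dots> \<le> (\<Sum>j<i. 2 ^ (B * tsize t))" using that by (intro sum_mono tb) auto
      also have "\<dots> = int i * 2 ^ (B * tsize t)" by simp
      also have "\<dots> \<le> 2 ^ B * 2 ^ (B * tsize t)"
        using that Lb by (intro mult_right_mono; linarith?) auto
      finally show ?thesis by (simp add: power_add)
    qed
    \<comment> \<open>The body is always run in a store that differs from \<open>s\<close> only in
      \<open>tmp\<close>, so by \<open>tval_cong\<close> it yields the summands as evaluated in
      \<open>s\<close>.\<close>
    define Inv where "Inv = (\<lambda>i s'. (\<forall>a. a \<noteq> tmp \<longrightarrow> s' a = s a) \<and>
       (\<forall>j<d. s' tmp (int j) = s tmp (int j)) \<and> s' tmp (int d) = int i \<and>
       s' tmp (int (Suc d)) = ?acc i)"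
    let ?b = "Less (Cell tmp (Const (int d))) (Cell 1 (Const 0))"
    let ?P2 = "Assign tmp (Const (int (Suc d)))
                  (Plus (Cell tmp (Const (int (Suc d)))) (Cell tmp (Const (int (Suc (Suc d))))))"
    let ?P3 = "Assign tmp (Const (int d)) (Plus (Cell tmp (Const (int d))) (Const 1))"
    let ?P = "Seq (compile t (\<rho>(v := d)) (Suc (Suc d))) (Seq ?P2 ?P3)"
    have bd: "bits (int d) \<le> d + 4" "bits (int (Suc d)) \<le> d + 4" "bits (int (Suc (Suc d))) \<le> d + 4"
      using bits_nat_le[of d] bits_nat_le[of "Suc d"] bits_nat_le[of "Suc (Suc d)"] by auto
    have bi: "bits (int i) \<le> B + 3" if "i \<le> Suc ?L" for i
    proof -
      have "(1::int) \<le> 2 ^ B" by simp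
      then have "\<bar>int i\<bar> \<le> 2 ^ Suc B" using that Lb unfolding power_Suc by linarith
      from bits_le[OF this] show ?thesis by simp
    qed
    have ba: "bits (?acc i) \<le> B * Suc (tsize t) + 2" if "i \<le> ?L" for i
      using bits_le[OF acc[OF that]] .
    have small: "bits 0 \<le> 2" "bits 1 \<le> 2" using bits_le[of 0 0] bits_le[of 1 0] by auto
    have b_cost: "expr_cost ?b s' \<le> ?X ^ c1" if "Inv i s'" "i \<le> ?L" for i s'
      unfolding c1_def
    proof (rule affine_le_pow)
      have [simp]: "s' (Suc 0) = s (Suc 0)" "s' tmp (int d) = int i"
        using that by (auto simp: Inv_def)
      have "bits (s (Suc 0) 0) \<le> B + 2" using Lb by (intro bits_le) auto
      then show "expr_cost ?b s' \<le> (10 * (d + 4) + 30 + 3 * tsize t) + B * (10 + 3 * tsize t)"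
        using small bd bi[of i] that(2) by (auto simp: algebra_simps)
    qed
    have step: "eval_expr ?b s' \<noteq> 0 \<and>
      (\<exists>c s''. exec ?P s' c s'' \<and> expr_cost ?b s' + c \<le> ?X ^ KW \<and> Inv (Suc i) s'')"
      if i: "i < ?L" and I: "Inv i s'" for i s'
    proof -
      have s'1: "s' (Suc 0) = s (Suc 0)" "\<And>a. a \<noteq> tmp \<Longrightarrow> s' a = s a" using I by (auto simp: Inv_def)
      have bs: "bounded_store B s'" using 1 bounded_store_cong[OF s'1(2)] by auto
      have \<rho>: "(\<lambda>w. s' tmp (int ((\<rho>(v := d)) w))) = ?\<rho>(v := int i)"
        using I 1 by (auto simp: Inv_def fun_eq_iff)
      have tu: "tval t (?\<rho>(v := int i)) s' = tval t (?\<rho>(v := int i)) s"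
        by (intro tval_cong s'1) (use tm in auto)
      obtain c s'' where c: "exec (compile t (\<rho>(v := d)) (Suc (Suc d))) s' c s''" "c \<le> ?X ^ K"
        and s'': "s'' tmp (int (Suc (Suc d))) = tval t (?\<rho>(v := int i)) s"
        "\<And>a. a \<noteq> tmp \<Longrightarrow> s'' a = s' a" "\<And>j. j < Suc (Suc d) \<Longrightarrow> s'' tmp (int j) = s' tmp (int j)"
      proof (rule comp_okD[OF K, of "\<rho>(v := d)" B s'])
        show "(\<rho>(v := d)) w < Suc (Suc d)" for w using 1(1) by (simp add: less_Suc_eq)
        have "\<bar>(?\<rho>(v := int i)) w\<bar> \<le> 2 ^ B" for w
          using 1(3) abs_int_le[OF less_imp_le[OF i] Lb] by auto
        then show "\<bar>s' tmp (int ((\<rho>(v := d)) w))\<bar> \<le> 2 ^ B" for w using fun_cong[OF \<rho>, of w] by simp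
      qed (use bs \<rho> tu s'1 in auto)
      have v: "s'' tmp (int (Suc d)) = ?acc i" "s'' tmp (int d) = int i"
        using s''(3)[of "Suc d"] s''(3)[of d] I by (auto simp: Inv_def)
      define s3 where "s3 = s''(tmp := (s'' tmp)(int (Suc d) := ?acc (Suc i)))"
      define s4 where "s4 = s3(tmp := (s3 tmp)(int d := int (Suc i)))"
      define e2 where "e2 = 1 + expr_cost (Const (int (Suc d))) s'' +
         expr_cost (Plus (Cell tmp (Const (int (Suc d)))) (Cell tmp (Const (int (Suc (Suc d)))))) s''"
      define e3 where "e3 = 1 + expr_cost (Const (int d)) s3 +
         expr_cost (Plus (Cell tmp (Const (int d))) (Const 1)) s3"
      have x2: "exec ?P2 s'' e2 s3"
        by (rule exec_AssignI) (simp_all add: e2_def s3_def v s''(1) del: of_nat_Suc)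
      have x3: "exec ?P3 s3 e3 s4"
        by (rule exec_AssignI) (simp_all add: e3_def s4_def s3_def v add.commute)
      have "bits (tval t (?\<rho>(v := int i)) s) \<le> B * tsize t + 2" using bits_le[OF tb[OF i]] .
      moreover have "bits (?acc i + tval t (?\<rho>(v := int i)) s) \<le> B * Suc (tsize t) + 2"
        using ba[of "Suc i"] i by simp
      moreover have "bits (s3 tmp (int d)) \<le> B + 3" "bits (s3 tmp (int d) + 1) \<le> B + 3"
        using v bi[of i] bi[of "Suc i"] i by (auto simp: s3_def add.commute)
      ultimately have "e2 + e3 \<le> (10 * (d + 4) + 30 + 3 * tsize t) + B * (10 + 3 * tsize t)"
        using bd small ba[of i] i
        by (simp add: e2_def e3_def v s''(1) algebra_simps del: of_nat_Suc)
      then have e: "e2 + e3 \<le> ?X ^ c1" unfolding c1_def by (rule affine_le_pow)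
      have "expr_cost ?b s' + (c + (e2 + e3)) \<le> ?X ^ KW"
        unfolding KW_def using b_cost[OF I] i by (intro le_pow_add c e) auto
      moreover have "exec ?P s' (c + (e2 + e3)) s4" by (rule Seq[OF c(1) Seq[OF x2 x3]])
      moreover have "Inv (Suc i) s4"
        using s'' s'1 I by (auto simp: Inv_def s4_def s3_def)
      moreover have "eval_expr ?b s' \<noteq> 0" using I i s'1 by (auto simp: Inv_def)
      ultimately show ?thesis by blast
    qed
    define s0 where "s0 = s(tmp := (s tmp)(int d := 0))"
    define s1 where "s1 = s0(tmp := (s0 tmp)(int (Suc d) := 0))"
    define e0 where "e0 = 1 + expr_cost (Const (int d)) s + expr_cost (Const 0) s"
    define e1 where "e1 = 1 + expr_cost (Const (int (Suc d))) s0 + expr_cost (Const 0) s0"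
    have x0: "exec (Assign tmp (Const (int d)) (Const 0)) s e0 s0"
      by (rule exec_AssignI) (simp_all add: e0_def s0_def)
    have x1: "exec (Assign tmp (Const (int (Suc d))) (Const 0)) s0 e1 s1"
      by (rule exec_AssignI) (simp_all add: e1_def s1_def del: of_nat_Suc)
    have e0: "e0 \<le> ?X ^ c1" "e1 \<le> ?X ^ c1"
      unfolding c1_def by (rule affine_le_pow, use bd small in \<open>simp add: e0_def e1_def\<close>)+
    have "Inv 0 s1" by (auto simp: Inv_def s1_def s0_def)
    moreover have "eval_expr ?b s' = 0 \<and> expr_cost ?b s' \<le> ?X ^ KW" if "Inv ?L s'" for s'
    proof -
      have "?X ^ c1 \<le> ?X ^ KW" by (rule power_increasing) (auto simp: KW_def)
      then have "expr_cost ?b s' \<le> ?X ^ KW" using b_cost[OF that order_refl] by linarith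
      moreover have "eval_expr ?b s' = 0" using that by (auto simp: Inv_def)
      ultimately show ?thesis by blast
    qed
    ultimately obtain c s' where c: "exec (While ?b ?P) s1 c s'" "c \<le> Suc ?L * ?X ^ KW" and I: "Inv ?L s'"
      using exec_loop[of ?L Inv ?b ?P "?X ^ KW" s1] step by blast
    have c': "c \<le> ?X ^ (2 + KW)"
    proof -
      have "Suc ?L * ?X ^ KW \<le> ?X ^ 1 * ?X ^ KW" by (intro mult_right_mono) auto
      also have "\<dots> \<le> ?X ^ (2 + KW)" unfolding power_add[symmetric] by (rule power_increasing) auto
      finally show ?thesis using c by simp
    qed
    define e4 where "e4 = 1 + expr_cost (Const (int d)) s' + expr_cost (Cell tmp (Const (int (Suc d)))) s'"
    define s5 where "s5 = s'(tmp := (s' tmp)(int d := ?acc ?L))"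
    have sv: "s' tmp (1 + int d) = ?acc ?L" using I by (auto simp: Inv_def)
    have x4: "exec (Assign tmp (Const (int d)) (Cell tmp (Const (int (Suc d))))) s' e4 s5"
      by (rule exec_AssignI) (simp_all add: e4_def s5_def sv)
    have e4: "e4 \<le> ?X ^ c1"
      unfolding c1_def
      by (rule affine_le_pow) (use bd ba[of ?L] in \<open>simp add: e4_def sv algebra_simps\<close>)
    have "exec (compile (Sum v t) \<rho> d) s (e0 + (e1 + (c + e4))) s5"
      unfolding compile.simps by (intro Seq[OF x0] Seq[OF x1] Seq[OF c(1)] x4)
    moreover have "e0 + (e1 + (c + e4)) \<le> ?X ^ KK"
      unfolding KK_def by (intro le_pow_add e0 c' e4) auto
    moreover have "s5 tmp (int d) = tval (Sum v t) ?\<rho> s" by (simp add: s5_def)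
    moreover have "\<forall>a. a \<noteq> tmp \<longrightarrow> s5 a = s a" "\<forall>i<d. s5 tmp (int i) = s tmp (int i)"
      using I by (auto simp: s5_def Inv_def)
    ultimately show ?case by blast
  qed
  then show ?thesis by blast
qed

lemma comp_correct: "tmp \<notin> arrays t \<Longrightarrow> \<exists>K. comp_ok t d K"
proof (induction t arbitrary: d)
  case (Num i)
  have "comp_ok (Num i) d (1 + bits (int d) + bits i + 0 + 2)"
    unfolding comp_ok_def
  proof (intro allI impI, goal_cases)
    case (1 \<rho> s B)
    show ?case
      apply (rule exI, rule exI, rule conjI, unfold compile.simps, rule Assign)
      by (intro conjI affine_le_pow) auto
  qed
  then show ?case by blast
next
  case (Var v)
  have "comp_ok (Var v) d (d + 2 + d + 2 + 3 + 1 + 2)"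
    unfolding comp_ok_def
  proof (intro allI impI, goal_cases)
    case (1 \<rho> s B)
    have "bits (int d) \<le> d + 2" by (rule bits_nat_le)
    moreover have "bits (int (\<rho> v)) \<le> d + 2" using 1(1) bits_nat_le[of "\<rho> v"] less_imp_le[of "\<rho> v" d]
      by (meson add_le_mono1 le_trans)
    moreover have "bits (s tmp (int (\<rho> v))) \<le> B + 2" using 1 by (intro bits_le) auto
    ultimately show ?case
      apply (intro exI conjI)
          apply (unfold compile.simps, rule Assign)
         apply (rule affine_le_pow)
         apply auto
      done
  qed
  then show ?case by blast
next
  case (Arr a t)
  then obtain K where K: "comp_ok t d K" by auto
  have "comp_ok (Arr a t) d (K + ((1 + 3 * (d + 2) + 10) + (tsize t + 1) + 2) + 1)"
    unfolding comp_ok_def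
  proof (intro allI impI, goal_cases)
    case (1 \<rho> s B)
    let ?\<rho> = "\<lambda>v. s tmp (int (\<rho> v))"
    obtain c s' where c: "exec (compile t \<rho> d) s c s'" "c \<le> (B + nat (s 1 0) + 2) ^ K"
      and s': "s' tmp (int d) = tval t ?\<rho> s"
      "\<And>a. a \<noteq> tmp \<Longrightarrow> s' a = s a" "\<And>i. i < d \<Longrightarrow> s' tmp (int i) = s tmp (int i)"
      using comp_okD[OF K, of \<rho> B s] 1 by auto
    let ?e = "Cell a (Cell tmp (Const (int d)))"
    have "\<bar>tval t ?\<rho> s\<bar> \<le> 2 ^ (B * tsize t)" using 1 Arr.prems by (intro tval_bound) auto
    then have b1: "bits (s' tmp (int d)) \<le> B * tsize t + 2" using s' by (intro bits_le) auto
    have b2: "bits (s a (tval t ?\<rho> s)) \<le> B + 2"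
      using 1 Arr.prems by (intro bits_le) (auto simp: bounded_store_def)
    have "1 + expr_cost (Const (int d)) s' + expr_cost ?e s' \<le> (B + nat (s 1 0) + 2) ^
       ((1 + 3 * (d + 2) + 10) + (tsize t + 1) + 2)"
      using b1 b2 s'(1,2) Arr.prems bits_nat_le[of d]
      by (intro affine_le_pow) (auto simp: algebra_simps)
    then have "c + (1 + expr_cost (Const (int d)) s' + expr_cost ?e s') \<le>
       (B + nat (s 1 0) + 2) ^ (K + ((1 + 3 * (d + 2) + 10) + (tsize t + 1) + 2) + 1)"
      by (intro le_pow_add c) auto
    then show ?case
      apply (intro exI conjI)
          apply (unfold compile.simps, rule Seq[OF c(1) Assign])
      using s' Arr.prems by auto
  qed
  then show ?case by blast
next
  case (Bin b t u)
  then obtain K K' where K: "comp_ok t d K" "comp_ok u (Suc d) K'" by (metis UnCI arrays.simps(4))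
  let ?K = "(1 + 3 * (d + 3) + 10) + (2 * tsize t + 2 * tsize u + 1) + 2"
  have "comp_ok (Bin b t u) d (K + (K' + ?K + 1) + 1)"
    unfolding comp_ok_def
  proof (intro allI impI, goal_cases)
    case (1 \<rho> s B)
    let ?\<rho> = "\<lambda>v. s tmp (int (\<rho> v))"
    obtain c s' where c: "exec (compile t \<rho> d) s c s'" "c \<le> (B + nat (s 1 0) + 2) ^ K"
      and s': "s' tmp (int d) = tval t ?\<rho> s"
      "\<And>a. a \<noteq> tmp \<Longrightarrow> s' a = s a" "\<And>i. i < d \<Longrightarrow> s' tmp (int i) = s tmp (int i)"
      using comp_okD[OF K(1), of \<rho> B s] 1 by auto
    have \<rho>: "(\<lambda>v. s' tmp (int (\<rho> v))) = ?\<rho>" using s' 1 by auto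
    have tu: "tval u ?\<rho> s' = tval u ?\<rho> s" using Bin.prems s' by (intro tval_cong) (metis UnCI arrays.simps(4))
    have L: "s' 1 0 = s 1 0" using s'(2)[of 1] by simp
    have bs: "bounded_store B s'" using 1 bounded_store_cong[OF s'(2)] by auto
    obtain c' s'' where c': "exec (compile u \<rho> (Suc d)) s' c' s''" "c' \<le> (B + nat (s 1 0) + 2) ^ K'"
      and s'': "s'' tmp (int (Suc d)) = tval u ?\<rho> s"
      "\<And>a. a \<noteq> tmp \<Longrightarrow> s'' a = s' a" "\<And>i. i < Suc d \<Longrightarrow> s'' tmp (int i) = s' tmp (int i)"
    proof (rule comp_okD[OF K(2), of \<rho> B s'])
      show "\<rho> v < Suc d" for v using 1 by (simp add: less_Suc_eq)
      show "\<bar>s' tmp (int (\<rho> v))\<bar> \<le> 2 ^ B" for v using 1 s' by auto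
    qed (use bs \<rho> tu L in auto)
    let ?e = "op_expr b (Cell tmp (Const (int d))) (Cell tmp (Const (int (Suc d))))"
    have t1: "\<bar>tval t ?\<rho> s\<bar> \<le> 2 ^ (B * tsize t)" and t2: "\<bar>tval u ?\<rho> s\<bar> \<le> 2 ^ (B * tsize u)"
      using 1 Bin.prems by (auto intro: tval_bound)
    have v1: "s'' tmp (int d) = tval t ?\<rho> s" using s'' s' by auto
    have b1: "bits (s'' tmp (int d)) \<le> B * tsize t + 2"
      "bits (s'' tmp (int (Suc d))) \<le> B * tsize u + 2"
      "bits (op_val b (tval t ?\<rho> s) (tval u ?\<rho> s)) \<le> (B * tsize t + B * tsize u + 1) + 2"
      unfolding v1 s''(1) by (intro bits_le op_val_bound t1 t2)+
    have "1 + expr_cost (Const (int d)) s'' + expr_cost ?e s'' \<le> (B + nat (s 1 0) + 2) ^ ?K"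
      apply (intro affine_le_pow)
      using b1 bits_nat_le[of d] bits_nat_le[of "Suc d"] v1 s''(1)
      by (simp add: op_expr_cost algebra_simps del: of_nat_Suc)
    then have "c + (c' + (1 + expr_cost (Const (int d)) s'' + expr_cost ?e s'')) \<le>
       (B + nat (s 1 0) + 2) ^ (K + (K' + ?K + 1) + 1)"
      by (intro le_pow_add c c') auto
    then show ?case
      apply (intro exI conjI)
          apply (unfold compile.simps, rule Seq[OF c(1) Seq[OF c'(1) Assign]])
      using s' s'' v1 by (auto simp: op_expr_cost)
  qed
  then show ?case by blast
next
  case (Sum v t)
  then show ?case using comp_ok_Sum by (metis arrays.simps(5) insertCI)
qed


section \<open>Phases: filling an array with the values of a term\<close>

definition phase_prog :: "nat \<Rightarrow> tm \<Rightarrow> prog" where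
  "phase_prog a t =
     Seq (Assign tmp (Const 0) (Const 0))
       (While (Less (Cell tmp (Const 0)) (Cell 1 (Const 0)))
         (Seq (compile t (\<lambda>_. 0) 1)
         (Seq (Assign a (Cell tmp (Const 0)) (Cell tmp (Const 1)))
              (Assign tmp (Const 0) (Plus (Cell tmp (Const 0)) (Const 1))))))"

text \<open>All variables are initially interpreted as the index being filled; in the program this
  is cell 0 of \<open>tmp\<close>, the loop counter, and the stack starts at cell 1. Since the array
  is updated cell by cell, \<open>t\<close> may refer to cells of \<open>a\<close> written
  earlier.\<close>

fun phase :: "nat \<Rightarrow> tm \<Rightarrow> nat \<Rightarrow> store \<Rightarrow> store" where
  "phase a t 0 s = s"
| "phase a t (Suc i) s = (let s' = phase a t i s
     in s'(a := (s' a)(int i := tval t (\<lambda>_. int i) s')))"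

lemma phase_other: "b \<noteq> a \<Longrightarrow> phase a t i s b = s b"
  by (induction i) (auto simp: Let_def)

text \<open>Agreement is required only outside \<open>tmp\<close>, so that programs compose although
  each leaves garbage on the stack. The condition \<open>bnd\<close> is a parameter because
  intermediate stores have to be bounded too.\<close>

definition realizes :: "prog \<Rightarrow> (nat \<Rightarrow> store \<Rightarrow> bool) \<Rightarrow> (store \<Rightarrow> store) \<Rightarrow> nat \<Rightarrow> bool" where
  "realizes P bnd f K \<longleftrightarrow> (\<forall>s s0 B. (\<forall>b. b \<noteq> tmp \<longrightarrow> s0 b = s b) \<longrightarrow> bnd B s \<longrightarrow>
    (\<exists>c s'. exec P s0 c s' \<and> c \<le> (B + nat (s 1 0) + 2) ^ K \<and> (\<forall>b. b \<noteq> tmp \<longrightarrow> s' b = f s b)))"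

lemma realizesD:
  assumes "realizes P bnd f K" "\<And>b. b \<noteq> tmp \<Longrightarrow> s0 b = s b" "bnd B s"
  obtains c s' where "exec P s0 c s'" "c \<le> (B + nat (s 1 0) + 2) ^ K" "\<And>b. b \<noteq> tmp \<Longrightarrow> s' b = f s b"
proof -
  have "\<exists>c s'. exec P s0 c s' \<and> c \<le> (B + nat (s 1 0) + 2) ^ K \<and> (\<forall>b. b \<noteq> tmp \<longrightarrow> s' b = f s b)"
    by (rule assms(1)[unfolded realizes_def, rule_format]) (use assms in auto)
  then show ?thesis using that by blast
qed

lemma phase_correct:
  assumes "tmp \<notin> arrays t" "a \<noteq> tmp" "a \<noteq> 1"
  shows "\<exists>K. realizes (phase_prog a t) (\<lambda>B s. \<forall>i\<le>nat (s 1 0). bounded_store B (phase a t i s))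
    (\<lambda>s. phase a t (nat (s 1 0)) s) K"
proof -
  obtain K where K: "comp_ok t 1 K" using comp_correct assms by blast
  define c1 where "c1 = 50 + (10 + 3 * tsize t) + 2"
  define KW where "KW = c1 + (K + c1 + 1) + 1"
  show ?thesis
  proof (rule exI[of _ "c1 + (2 + KW) + 1"], unfold realizes_def, intro allI impI)
    fix s s0 :: store and B
    assume s0: "\<forall>b. b \<noteq> tmp \<longrightarrow> s0 b = s b"
      and bnd: "\<forall>i\<le>nat (s 1 0). bounded_store B (phase a t i s)"
    let ?L = "nat (s 1 0)"
    let ?X = "B + ?L + 2"
    have "bounded_store B s" using bnd by (metis phase.simps(1) zero_le)
    then have Lb: "\<bar>s 1 0\<bar> \<le> 2 ^ B" by (auto simp: bounded_store_def)
    define Inv where "Inv = (\<lambda>i s'. (\<forall>b. b \<noteq> tmp \<longrightarrow> s' b = phase a t i s b) \<and> s' tmp 0 = int i)"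
    let ?b = "Less (Cell tmp (Const 0)) (Cell 1 (Const 0))"
    let ?P2 = "Assign a (Cell tmp (Const 0)) (Cell tmp (Const 1))"
    let ?P3 = "Assign tmp (Const 0) (Plus (Cell tmp (Const 0)) (Const 1))"
    let ?P = "Seq (compile t (\<lambda>_. 0) 1) (Seq ?P2 ?P3)"
    have L1: "s' (Suc 0) = s (Suc 0)" if "Inv i s'" for i s'
      using that assms phase_other[of 1 a t i s] by (auto simp: Inv_def)
    have bi: "bits (int i) \<le> B + 3" if "i \<le> Suc ?L" for i
    proof -
      have "(1::int) \<le> 2 ^ B" by simp
      then have "\<bar>int i\<bar> \<le> 2 ^ Suc B" using that Lb unfolding power_Suc by linarith
      from bits_le[OF this] show ?thesis by simp
    qed
    have small: "bits 0 \<le> 2" "bits 1 \<le> 2" using bits_le[of 0 0] bits_le[of 1 0] by auto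
    have b_cost: "expr_cost ?b s' \<le> ?X ^ c1" if I: "Inv i s'" and "i \<le> ?L" for i s'
      unfolding c1_def
    proof (rule affine_le_pow)
      have [simp]: "s' (Suc 0) = s (Suc 0)" "s' tmp 0 = int i"
        using L1[OF I] I by (auto simp: Inv_def)
      have "bits (s (Suc 0) 0) \<le> B + 2" using Lb by (intro bits_le) auto
      then show "expr_cost ?b s' \<le> 50 + B * (10 + 3 * tsize t)"
        using small bi[of i] that(2) by (auto simp: algebra_simps)
    qed
    have step: "eval_expr ?b s' \<noteq> 0 \<and>
      (\<exists>c s''. exec ?P s' c s'' \<and> expr_cost ?b s' + c \<le> ?X ^ KW \<and> Inv (Suc i) s'')"
      if i: "i < ?L" and I: "Inv i s'" for i s'
    proof -
      let ?v = "tval t (\<lambda>_. int i) (phase a t i s)"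
      have bp: "bounded_store B (phase a t i s)" using bnd i by auto
      have bs: "bounded_store B s'" using bounded_store_cong[of s' "phase a t i s" B] bp I
        by (auto simp: Inv_def)
      have ib: "\<bar>int i\<bar> \<le> 2 ^ B" by (rule abs_int_le[OF less_imp_le[OF i] Lb])
      have s'0: "s' tmp 0 = int i" using I by (simp add: Inv_def)
      have tv: "tval t (\<lambda>_. int i) s' = ?v"
        
      proof (rule tval_cong)
        fix b assume "b \<in> arrays t"
        then have "b \<noteq> tmp" using assms(1) by blast
        then show "s' b = phase a t i s b" using I by (simp add: Inv_def)
      qed
      have vb: "\<bar>?v\<bar> \<le> 2 ^ (B * tsize t)" using bp assms ib by (intro tval_bound) auto
      obtain c s'' where c: "exec (compile t (\<lambda>_. 0) 1) s' c s''" "c \<le> ?X ^ K"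
        and s'': "s'' tmp 1 = ?v"
        "\<And>a. a \<noteq> tmp \<Longrightarrow> s'' a = s' a" "\<And>j. j < 1 \<Longrightarrow> s'' tmp (int j) = s' tmp (int j)"
        by (rule comp_okD[OF K, of "\<lambda>_. 0" B s']) (use bs ib L1[OF I] s'0 tv in auto)
      have s''0: "s'' tmp 0 = int i" using s''(3)[of 0] s'0 by simp
      define s3 where "s3 = s''(a := (s'' a)(int i := ?v))"
      define s4 where "s4 = s3(tmp := (s3 tmp)(0 := int (Suc i)))"
      define e2 where "e2 = 1 + expr_cost (Cell tmp (Const 0)) s'' + expr_cost (Cell tmp (Const 1)) s''"
      define e3 where "e3 = 1 + expr_cost (Const 0) s3 +
         expr_cost (Plus (Cell tmp (Const 0)) (Const 1)) s3"
      have x2: "exec ?P2 s'' e2 s3"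
        by (rule exec_AssignI) (simp_all add: e2_def s3_def s''0 s''(1))
      have s30: "s3 tmp 0 = int i" using assms s''0 by (simp add: s3_def)
      have x3: "exec ?P3 s3 e3 s4"
        by (rule exec_AssignI) (simp_all add: e3_def s4_def s30 add.commute)
      have "e2 + e3 \<le> 50 + B * (10 + 3 * tsize t)"
        using small bits_le[OF vb] bi[of i] bi[of "Suc i"] i
        by (simp add: e2_def e3_def s30 s''0 s''(1) algebra_simps)
      then have e: "e2 + e3 \<le> ?X ^ c1" unfolding c1_def by (rule affine_le_pow)
      have "expr_cost ?b s' + (c + (e2 + e3)) \<le> ?X ^ KW"
        unfolding KW_def using b_cost[OF I] i by (intro le_pow_add c e) auto
      moreover have "exec ?P s' (c + (e2 + e3)) s4" by (rule Seq[OF c(1) Seq[OF x2 x3]])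
      moreover have "Inv (Suc i) s4"
        using s''(2) I assms by (auto simp: Inv_def s4_def s3_def Let_def)
      moreover have "eval_expr ?b s' \<noteq> 0" using I i L1[OF I] by (auto simp: Inv_def)
      ultimately show ?thesis by blast
    qed
    define s1 where "s1 = s0(tmp := (s0 tmp)(0 := 0))"
    define e0 where "e0 = 1 + expr_cost (Const 0) s0 + expr_cost (Const 0) s0"
    have x0: "exec (Assign tmp (Const 0) (Const 0)) s0 e0 s1"
      by (rule exec_AssignI) (simp_all add: e0_def s1_def)
    have e0: "e0 \<le> ?X ^ c1"
      unfolding c1_def by (rule affine_le_pow) (use small in \<open>simp add: e0_def\<close>)
    have "Inv 0 s1" using s0 by (auto simp: Inv_def s1_def)
    moreover have "eval_expr ?b s' = 0 \<and> expr_cost ?b s' \<le> ?X ^ KW" if "Inv ?L s'" for s'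
    proof -
      have "?X ^ c1 \<le> ?X ^ KW" by (rule power_increasing) (auto simp: KW_def)
      then have "expr_cost ?b s' \<le> ?X ^ KW" using b_cost[OF that order_refl] by linarith
      moreover have "eval_expr ?b s' = 0" using that L1[OF that] by (auto simp: Inv_def)
      ultimately show ?thesis by blast
    qed
    ultimately obtain c s' where c: "exec (While ?b ?P) s1 c s'" "c \<le> Suc ?L * ?X ^ KW" and I: "Inv ?L s'"
      using exec_loop[of ?L Inv ?b ?P "?X ^ KW" s1] step by blast
    have c': "c \<le> ?X ^ (2 + KW)"
    proof -
      have "Suc ?L * ?X ^ KW \<le> ?X ^ 1 * ?X ^ KW" by (intro mult_right_mono) auto
      also have "\<dots> \<le> ?X ^ (2 + KW)" unfolding power_add[symmetric] by (rule power_increasing) auto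
      finally show ?thesis using c by simp
    qed
    have "exec (phase_prog a t) s0 (e0 + c) s'"
      unfolding phase_prog_def by (rule Seq[OF x0 c(1)])
    moreover have "e0 + c \<le> ?X ^ (c1 + (2 + KW) + 1)"
      by (intro le_pow_add e0 c') auto
    ultimately show "\<exists>c s'. exec (phase_prog a t) s0 c s' \<and> c \<le> ?X ^ (c1 + (2 + KW) + 1) \<and>
      (\<forall>b. b \<noteq> tmp \<longrightarrow> s' b = phase a t ?L s b)"
      using I unfolding Inv_def by blast
  qed
qed

fun phases :: "(nat \<times> tm) list \<Rightarrow> store \<Rightarrow> store" where
  "phases [] s = s"
| "phases ((a, t) # ps) s = phases ps (phase a t (nat (s 1 0)) s)"

fun phases_prog :: "(nat \<times> tm) list \<Rightarrow> prog" where
  "phases_prog [] = Skip"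
| "phases_prog ((a, t) # ps) = Seq (phase_prog a t) (phases_prog ps)"

fun bounded_phases :: "nat \<Rightarrow> (nat \<times> tm) list \<Rightarrow> store \<Rightarrow> bool" where
  "bounded_phases B [] s \<longleftrightarrow> bounded_store B s"
| "bounded_phases B ((a, t) # ps) s \<longleftrightarrow>
     (\<forall>i\<le>nat (s 1 0). bounded_store B (phase a t i s)) \<and>
     bounded_phases B ps (phase a t (nat (s 1 0)) s)"

definition wf_phases :: "(nat \<times> tm) list \<Rightarrow> bool" where
  "wf_phases ps \<longleftrightarrow> (\<forall>(a, t)\<in>set ps. tmp \<notin> arrays t \<and> a \<noteq> tmp \<and> a \<noteq> 1)"

lemma phases_correct:
  "wf_phases ps \<Longrightarrow> \<exists>K. realizes (phases_prog ps) (\<lambda>B. bounded_phases B ps) (phases ps) K"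
proof (induction ps)
  case Nil
  have "realizes (phases_prog []) (\<lambda>B. bounded_phases B []) (phases []) 1"
    unfolding realizes_def by (auto intro!: exI[of _ 1] exec.Skip[simplified])
  then show ?case by blast
next
  case (Cons p ps)
  obtain a t where p: "p = (a, t)" by (cases p)
  have at: "tmp \<notin> arrays t" "a \<noteq> tmp" "a \<noteq> 1" and wf: "wf_phases ps"
    using Cons.prems by (auto simp: wf_phases_def p)
  obtain K where K: "realizes (phases_prog ps) (\<lambda>B. bounded_phases B ps) (phases ps) K"
    using Cons.IH[OF wf] by blast
  obtain K' where K': "realizes (phase_prog a t)
      (\<lambda>B s. \<forall>i\<le>nat (s 1 0). bounded_store B (phase a t i s)) (\<lambda>s. phase a t (nat (s 1 0)) s) K'"
    using phase_correct[OF at] by blast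
  have "realizes (phases_prog (p # ps)) (\<lambda>B. bounded_phases B (p # ps)) (phases (p # ps)) (K' + K + 1)"
    unfolding realizes_def
  proof (intro allI impI)
    fix s s0 :: store and B
    assume s0: "\<forall>b. b \<noteq> tmp \<longrightarrow> s0 b = s b" and bnd: "bounded_phases B (p # ps) s"
    let ?s = "phase a t (nat (s 1 0)) s"
    obtain c s' where c: "exec (phase_prog a t) s0 c s'" "c \<le> (B + nat (s 1 0) + 2) ^ K'"
      and s': "\<And>b. b \<noteq> tmp \<Longrightarrow> s' b = ?s b"
      by (rule realizesD[OF K', of s0 s B]) (use s0 bnd p in auto)
    have "bounded_phases B ps ?s" using bnd by (simp add: p)
    then obtain c' s'' where c': "exec (phases_prog ps) s' c' s''"
      "c' \<le> (B + nat (?s 1 0) + 2) ^ K" and s'': "\<And>b. b \<noteq> tmp \<Longrightarrow> s'' b = phases ps ?s b"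
      using realizesD[OF K, of s' ?s B] s' by blast
    have L: "?s 1 0 = s 1 0" using at by (simp add: phase_other)
    have "exec (phases_prog (p # ps)) s0 (c + c') s''"
      using Seq[OF c(1) c'(1)] by (simp add: p)
    moreover have "c + c' \<le> (B + nat (s 1 0) + 2) ^ (K' + K + 1)"
      by (intro le_pow_add c c'(2)[unfolded L]) auto
    ultimately show "\<exists>c s'. exec (phases_prog (p # ps)) s0 c s' \<and>
        c \<le> (B + nat (s 1 0) + 2) ^ (K' + K + 1) \<and> (\<forall>b. b \<noteq> tmp \<longrightarrow> s' b = phases (p # ps) s b)"
      using s'' by (auto simp: p)
  qed
  then show ?case by blast
qed

text \<open>A phase may read the cells of its own target that it has already written; \<open>causal\<close> says that
  it depends on no others.\<close>

definition causal :: "nat \<Rightarrow> tm \<Rightarrow> bool" where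
  "causal a t \<longleftrightarrow> (\<forall>i s s'. (\<forall>b. b \<noteq> a \<longrightarrow> s b = s' b) \<longrightarrow> (\<forall>j<int i. s a j = s' a j) \<longrightarrow>
     tval t (\<lambda>_. int i) s = tval t (\<lambda>_. int i) s')"

lemma causal_trivial: "a \<notin> arrays t \<Longrightarrow> causal a t"
  unfolding causal_def by (intro allI impI tval_cong) auto

lemma phase_cell:
  "phase a t n s a j = (if 0 \<le> j \<and> j < int n then tval t (\<lambda>_. j) (phase a t (nat j) s) else s a j)"
  by (induction n) (auto simp: Let_def)

text \<open>When cell \<open>j\<close> is written, the cells of \<open>a\<close> from
  \<open>j\<close> on still have their old contents; causality makes the value insensitive to this
  difference, so it can be computed in the final store.\<close>

lemma phase_fixpoint:
  assumes "causal a t" "0 \<le> j" "j < int n"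
  shows "phase a t n s a j = tval t (\<lambda>_. j) (phase a t n s)"
proof -
  have "tval t (\<lambda>_. int (nat j)) (phase a t (nat j) s) = tval t (\<lambda>_. int (nat j)) (phase a t n s)"
    using assms(1)[unfolded causal_def, rule_format, of "phase a t (nat j) s" "phase a t n s" "nat j"]
      assms(2,3) by (auto simp: phase_other phase_cell[of a t])
  then show ?thesis using assms by (simp add: phase_cell[of a t n])
qed

lemma phases_other: "a \<notin> fst ` set ps \<Longrightarrow> phases ps s a = s a"
  by (induction ps arbitrary: s) (auto simp: phase_other)

text \<open>If no array is overwritten by a later phase, all phases hold as equations in the final store.\<close>

lemma phases_fixpoint:
  assumes "wf_phases ps" "distinct (map fst ps)"
    "\<And>a t. (a, t) \<in> set ps \<Longrightarrow> causal a t"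
    "sorted_wrt (\<lambda>(a, t) (a', t'). a' \<notin> arrays t) ps"
    "(a, t) \<in> set ps" "0 \<le> j" "j < s 1 0"
  shows "phases ps s a j = tval t (\<lambda>_. j) (phases ps s)"
  using assms
proof (induction ps arbitrary: s)
  case (Cons p ps)
  obtain b u where p: "p = (b, u)" by (cases p)
  have b: "b \<noteq> tmp" "b \<noteq> 1" using Cons.prems by (auto simp: p wf_phases_def)
  let ?s = "phase b u (nat (s 1 0)) s"
  show ?case
  proof (cases "(a, t) = p")
    case False
    have "?s 1 0 = s 1 0" using b by (simp add: phase_other)
    then have "phases ps ?s a j = tval t (\<lambda>_. j) (phases ps ?s)"
      using Cons.prems False by (intro Cons.IH) (auto simp: wf_phases_def)
    then show ?thesis by (simp add: p)
  next
    case True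
    then have at: "a = b" "t = u" by (auto simp: p)
    have "phases ps ?s a = ?s a"
      using Cons.prems at by (intro phases_other) (auto simp: p)
    moreover have "tval t (\<lambda>_. j) (phases ps ?s) = tval t (\<lambda>_. j) ?s"
      by (rule tval_cong, rule phases_other) (use Cons.prems at in \<open>force simp: p\<close>)
    moreover have "?s a j = tval t (\<lambda>_. j) ?s"
      unfolding at by (rule phase_fixpoint) (use Cons.prems p in auto)
    ultimately show ?thesis by (simp add: p)
  qed
qed simp

section \<open>Bit lengths after a phase\<close>

lemma phase_bounded:
  assumes "bounded_store B s" "B \<le> B'"
    "\<And>j. j < i \<Longrightarrow> \<bar>tval t (\<lambda>_. int j) (phase a t j s)\<bar> \<le> 2 ^ B'"
  shows "bounded_store B' (phase a t i s)"
proof -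
  have "\<bar>phase a t i s b j\<bar> \<le> 2 ^ B'" if "b \<noteq> tmp" for b j
  proof (cases "b = a \<and> 0 \<le> j \<and> j < int i")
    case True
    then show ?thesis using assms(3)[of "nat j"] by (auto simp: phase_cell nat_less_iff)
  next
    case False
    then have "phase a t i s b j = s b j" by (cases "b = a") (auto simp: phase_cell phase_other)
    then show ?thesis using assms(1,2) that by (auto simp: bounded_store_def intro: pow2_int_mono)
  qed
  then show ?thesis using assms by (auto simp: bounded_store_def)
qed

text \<open>Without self-reference every cell is a value of \<open>t\<close> in the original store,
  so the exponent is multiplied by \<open>tsize t\<close> only once, not once per cell.\<close>

lemma phase_bounded_nonrec:
  assumes "bounded_store B s" "a \<notin> arrays t" "tmp \<notin> arrays t" "i \<le> nat (s 1 0)"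
  shows "bounded_store (B * tsize t) (phase a t i s)"
proof (rule phase_bounded[OF assms(1)])
  have "tsize t \<ge> 1" by (cases t) auto
  then show "B \<le> B * tsize t" by simp
  show "\<bar>tval t (\<lambda>_. int j) (phase a t j s)\<bar> \<le> 2 ^ (B * tsize t)" if "j < i" for j
  proof -
    have "tval t (\<lambda>_. int j) (phase a t j s) = tval t (\<lambda>_. int j) s"
      by (rule tval_cong, rule phase_other) (use assms in auto)
    moreover have "\<bar>int j\<bar> \<le> 2 ^ B"
      using abs_int_le[of j "s 1 0" "2 ^ B"] that assms unfolding bounded_store_def by simp
    ultimately show ?thesis using assms by (simp add: tval_bound)
  qed
qed


section \<open>Rounding along the order of sizes\<close>

lemma sum_set_nth: "distinct xs \<Longrightarrow> (\<Sum>c\<in>set xs. f c) = (\<Sum>i<length xs. f (xs ! i))"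
  by (simp add: sum.distinct_set_conv_list sum_list_sum_nth atLeast0LessThan)

lemma sum_antitone_dominated:
  fixes f u v :: "nat \<Rightarrow> real"
  assumes "\<And>r s. r \<le> s \<Longrightarrow> s < n \<Longrightarrow> f s \<le> f r" "\<And>r. r < n \<Longrightarrow> f r \<ge> 0"
    "\<And>r. r < n \<Longrightarrow> (\<Sum>i\<le>r. u i) \<le> (\<Sum>i\<le>r. v i)"
  shows "(\<Sum>r<n. u r * f r) \<le> (\<Sum>r<n. v r * f r)"
proof -
  \<comment> \<open>Summation by parts in inductive form: the partial sums of \<open>v - u\<close>
    are nonnegative, hence passing from the multiplier \<open>f r\<close> to the smaller
    \<open>f (Suc r)\<close> can only decrease the left-hand side.\<close>
  have *: "f r * (\<Sum>i\<le>r. v i - u i) \<le> (\<Sum>i\<le>r. (v i - u i) * f i)" if "r < n" for r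
    using that
  proof (induction r)
    case (Suc r)
    have "(\<Sum>i\<le>r. v i - u i) \<ge> 0" using assms(3)[of r] Suc.prems by (simp add: sum_subtractf)
    then have "f (Suc r) * (\<Sum>i\<le>r. v i - u i) \<le> f r * (\<Sum>i\<le>r. v i - u i)"
      using assms(1)[of r "Suc r"] Suc.prems by (intro mult_right_mono) auto
    then show ?case using Suc by (simp add: algebra_simps)
  qed (simp add: algebra_simps)
  show ?thesis
  proof (cases n)
    case (Suc m)
    have "0 \<le> f m * (\<Sum>i\<le>m. v i - u i)"
      using assms(2,3)[of m] Suc by (intro mult_nonneg_nonneg) (auto simp: sum_subtractf)
    also have "\<dots> \<le> (\<Sum>i\<le>m. (v i - u i) * f i)" using *[of m] Suc by simp
    finally show ?thesis using Suc by (simp add: lessThan_Suc_atMost left_diff_distrib sum_subtractf)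
  qed simp
qed

text \<open>Breaking ties by the index gives a strict total order, so that \<open>rank\<close> is a
  permutation.\<close>

definition before :: "(nat \<Rightarrow> rat) \<Rightarrow> nat \<Rightarrow> nat \<Rightarrow> bool" where
  "before p i j \<longleftrightarrow> p j < p i \<or> p i = p j \<and> i < j"

text \<open>Sorting by counting predecessors, because a bounded sum can count.\<close>

definition rank :: "(nat \<Rightarrow> rat) \<Rightarrow> nat \<Rightarrow> nat \<Rightarrow> nat" where
  "rank p n j = card {i. i < n \<and> before p i j}"

lemma rank_less: "i < n \<Longrightarrow> before p i j \<Longrightarrow> rank p n i < rank p n j"
  unfolding rank_def
  by (rule psubset_card_mono) (auto simp: before_def)

lemma rank_bij: "bij_betw (rank p n) {..<n} {..<n}"
proof -
  have "inj_on (rank p n) {..<n}"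
  proof (rule inj_onI, rule ccontr)
    fix i j assume "i \<in> {..<n}" "j \<in> {..<n}" "rank p n i = rank p n j" "i \<noteq> j"
    moreover from this have "before p i j \<or> before p j i" by (auto simp: before_def)
    ultimately show False using rank_less[of i n p j] rank_less[of j n p i] by auto
  qed
  moreover have "rank p n ` {..<n} \<subseteq> {..<n}"
  proof (rule image_subsetI)
    fix j assume j: "j \<in> {..<n}"
    have "{i. i < n \<and> before p i j} \<subset> {..<n}" using j by (auto simp: before_def)
    from psubset_card_mono[OF _ this] show "rank p n j \<in> {..<n}" by (simp add: rank_def)
  qed
  ultimately show ?thesis by (simp add: bij_betw_def endo_inj_surj)
qed

definition ranked :: "(nat \<Rightarrow> rat) \<Rightarrow> nat \<Rightarrow> nat \<Rightarrow> nat" where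
  "ranked p n = inv_into {..<n} (rank p n)"

lemma ranked_bij: "bij_betw (ranked p n) {..<n} {..<n}"
  unfolding ranked_def by (rule bij_betw_inv_into[OF rank_bij])

lemma rank_ranked: "r < n \<Longrightarrow> rank p n (ranked p n r) = r"
  unfolding ranked_def using bij_betw_inv_into_right[OF rank_bij] by fastforce

lemma ranked_rank: "j < n \<Longrightarrow> ranked p n (rank p n j) = j"
  unfolding ranked_def using bij_betw_inv_into_left[OF rank_bij] by fastforce

lemma ranked_less: "r < n \<Longrightarrow> ranked p n r < n"
  using ranked_bij bij_betwE by blast

lemma rank_less_n: "j < n \<Longrightarrow> rank p n j < n"
  using rank_bij bij_betwE by blast

lemma ranked_antimono:
  assumes "r \<le> s" "s < n"
  shows "p (ranked p n s) \<le> p (ranked p n r)"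
proof (rule ccontr)
  assume "\<not> ?thesis"
  then have "before p (ranked p n s) (ranked p n r)" by (auto simp: before_def)
  from rank_less[OF ranked_less[OF assms(2)] this] show False
    using assms by (simp add: rank_ranked)
qed

section \<open>The rounding rule\<close>

locale rounding =
  fixes \<epsilon> T :: rat and I :: sup_instance and cs :: "config list"
    and x :: "config \<Rightarrow> nat" and y z :: "nat \<Rightarrow> config \<Rightarrow> real"
begin

definition "n = num_jobs I"
definition "ord = ranked (job_size I) n"
definition "small r \<longleftrightarrow> job_size I (ord r) < \<epsilon> * T"
text \<open>The classes of jobs that share a counter: all small jobs form one class, the large jobs
  of each size another. In the second disjunct \<open>r\<close> is large as well, having the size of
  \<open>s\<close>.\<close>

definition "same r s \<longleftrightarrow> small r \<and> small s \<or> \<not> small s \<and> job_size I (ord r) = job_size I (ord s)"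
definition "cnt f r c = card {r'. r' < r \<and> same r' r \<and> f r' = c}"
definition "dem r c = (if small r
   then \<Sum>r' | r' \<le> r \<and> small r'. y (ord r') (cs ! c) + z (ord r') (cs ! c)
   else real (x (cs ! c) * alpha (cs ! c) (job_size I (ord r))))"
text \<open>Positive demand does not imply \<open>x > 0\<close>: if \<open>U = 0\<close>, a job of
  size 0 may have positive \<open>z\<close> for a configuration that no machine uses.\<close>

definition "avail f r c \<longleftrightarrow> x (cs ! c) > 0 \<and> real (cnt f r c) < dem r c"

text \<open>The index \<open>length cs\<close> stands for "no configuration". Taking the least index
  makes the choice a function that the program can reproduce exactly.\<close>

definition pick :: "(nat \<Rightarrow> nat) \<Rightarrow> nat \<Rightarrow> nat" where
  "pick f r = (if \<exists>c<length cs. avail f r c then LEAST c. c < length cs \<and> avail f r c else length cs)"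

definition "off c = (\<Sum>c'<c. x (cs ! c'))"
text \<open>The machines of configuration \<open>c\<close> are the \<open>x\<close> consecutive ones
  from \<open>off c\<close> on. Counters belong to classes, so the dealing restarts at the first of
  them for each large size and for the small jobs. Jobs without a configuration go to machine
  0.\<close>

definition "mach f r = (if f r < length cs then off (f r) + cnt f r (f r) mod x (cs ! f r) else 0)"

primrec pick_upto :: "nat \<Rightarrow> nat \<Rightarrow> nat" where
  "pick_upto 0 = (\<lambda>_. 0)"
| "pick_upto (Suc r) = (pick_upto r)(r := pick (pick_upto r) r)"

lemma cnt_cong: "(\<And>r'. r' < r \<Longrightarrow> f r' = g r') \<Longrightarrow> cnt f r c = cnt g r c"
  unfolding cnt_def by (rule arg_cong[where f = card]) auto

lemma pick_cong: "(\<And>r'. r' < r \<Longrightarrow> f r' = g r') \<Longrightarrow> pick f r = pick g r"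
  unfolding pick_def avail_def using cnt_cong[of r f g] by auto

text \<open>\<open>pick f r\<close> depends only on \<open>f\<close> below \<open>r\<close>, so the
  approximations \<open>pick_upto\<close> stabilise at \<open>r\<close> after \<open>Suc r\<close>
  steps.\<close>

lemma ex_pick: "\<exists>f. \<forall>r. f r = pick f r"
proof -
  have *: "pick_upto N r = pick_upto (Suc r) r" if "r < N" for r N
    using that by (induction N) (auto simp: less_Suc_eq)
  show ?thesis
  proof (rule exI[of _ "\<lambda>r. pick_upto (Suc r) r"], intro allI)
    fix r
    have "pick_upto (Suc r) r = pick (pick_upto r) r" by simp
    also have "\<dots> = pick (\<lambda>r. pick_upto (Suc r) r) r" by (rule pick_cong) (rule *)
    finally show "pick_upto (Suc r) r = pick (\<lambda>r. pick_upto (Suc r) r) r" .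
  qed
qed

end

text \<open>The values \<open>y\<close>, \<open>z\<close> are real, which covers arbitrary solutions
  as well as the rational ones of the program. The equation for \<open>cf\<close> is required at
  ranks of jobs only, so that the contents of an array can be plugged in.\<close>

locale rounding_run = rounding +
  fixes cf :: "nat \<Rightarrow> nat"
  assumes setting: "rounded_setting \<epsilon> T I" and milp: "milp_feasible \<epsilon> T I x y z"
    and dist: "distinct cs" and set_cs: "set cs = feasible_configs \<epsilon> T I"
    and cf: "\<And>r. r < n \<Longrightarrow> cf r = pick cf r"
begin

definition "U = (of_rat (setup_time I) :: real)"
definition "k = batch_size I"
definition "m = num_machines I"
definition "e = (of_rat (\<epsilon> * T) :: real)"
definition "p r = (of_rat (job_size I (ord r)) :: real)"
definition "w c r = (if small r then y (ord r) (cs ! c) + z (ord r) (cs ! c) else 0)"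

lemma pos: "\<epsilon> > 0" "T > 0" "e > 0" "k > 0" "m > 0" "U \<ge> 0"
proof -
  show "\<epsilon> > 0" "k > 0" "m > 0" "U \<ge> 0"
    using setting by (auto simp: rounded_setting_def is_sup_instance_def k_def m_def U_def)
  then show "T > 0" using setting by (auto simp: rounded_setting_def intro!: zero_less_power_int)
  then show "e > 0" using \<open>\<epsilon> > 0\<close> by (simp add: e_def)
qed

section \<open>The constraints in terms of ranks and list positions\<close>

lemma ord_less: "r < n \<Longrightarrow> ord r < n"
  by (simp add: ord_def ranked_less)

lemma ord_bij: "bij_betw ord {..<n} {..<n}"
  unfolding ord_def by (rule ranked_bij)

lemma p_nonneg: "r < n \<Longrightarrow> p r \<ge> 0"
  using setting ord_less[of r] by (auto simp: rounded_setting_def is_sup_instance_def jobs_def p_def n_def)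

lemma p_antimono: "r \<le> s \<Longrightarrow> s < n \<Longrightarrow> p s \<le> p r"
  by (simp add: p_def ord_def ranked_antimono of_rat_less_eq)

lemma small_iff: "small r \<longleftrightarrow> p r < e"
  by (simp add: small_def p_def e_def of_rat_less)

lemma ord_small: "r < n \<Longrightarrow> ord r \<in> small_jobs \<epsilon> T I \<longleftrightarrow> small r"
  using ord_less[of r] by (auto simp: small_jobs_def small_def jobs_def n_def)

lemma sum_small: "(\<Sum>j\<in>small_jobs \<epsilon> T I. f j) = (\<Sum>r | r < n \<and> small r. f (ord r))"
proof (rule sum.reindex_bij_betw[symmetric])
  show "bij_betw ord {r. r < n \<and> small r} (small_jobs \<epsilon> T I)"
    by (rule bij_betw_subset[OF ord_bij])
      (auto simp: ord_small ord_less image_iff small_jobs_def jobs_def n_def[symmetric] small_def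
         dest: bij_betw_imp_surj_on[OF ord_bij, THEN equalityD2, THEN subsetD, OF lessThan_iff[THEN iffD2]])
qed

lemma large_bij:
  "bij_betw ord {r. r < n \<and> \<not> small r \<and> job_size I (ord r) = l} (large_jobs_of_size \<epsilon> T I l)"
  by (rule bij_betw_subset[OF ord_bij])
    (auto simp: ord_less image_iff large_jobs_of_size_def large_jobs_def jobs_def n_def[symmetric] small_def
       dest: bij_betw_imp_surj_on[OF ord_bij, THEN equalityD2, THEN subsetD, OF lessThan_iff[THEN iffD2]])

lemma large_size: "r < n \<Longrightarrow> \<not> small r \<Longrightarrow> job_size I (ord r) \<in> large_sizes \<epsilon> T I"
  using ord_less[of r] by (auto simp: large_sizes_def large_jobs_def jobs_def n_def small_def)

lemma large_size_nonneg: "l \<in> large_sizes \<epsilon> T I \<Longrightarrow> (of_rat l :: real) \<ge> 0"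
proof -
  assume "l \<in> large_sizes \<epsilon> T I"
  then have "\<epsilon> * T \<le> l" by (auto simp: large_sizes_def large_jobs_def)
  moreover have "\<epsilon> * T > 0" using pos by simp
  ultimately show ?thesis by simp
qed

lemma finite_large_sizes: "finite (large_sizes \<epsilon> T I)"
  by (simp add: large_sizes_def large_jobs_def jobs_def)

lemma nth_C: "c < length cs \<Longrightarrow> cs ! c \<in> feasible_configs \<epsilon> T I"
  using set_cs nth_mem by blast

lemma sum_C: "(\<Sum>c\<in>feasible_configs \<epsilon> T I. f c) = (\<Sum>c<length cs. f (cs ! c))"
  using sum_set_nth[OF dist] by (simp add: set_cs)

lemma y_nonneg: "r < n \<Longrightarrow> small r \<Longrightarrow> c < length cs \<Longrightarrow> y (ord r) (cs ! c) \<ge> 0"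
  and z_nonneg: "r < n \<Longrightarrow> small r \<Longrightarrow> c < length cs \<Longrightarrow> z (ord r) (cs ! c) \<ge> 0"
  using milp nth_C ord_small by (auto simp: milp_feasible_def Let_def)

lemma w_nonneg: "r < n \<Longrightarrow> c < length cs \<Longrightarrow> w c r \<ge> 0"
  using y_nonneg z_nonneg by (auto simp: w_def)

lemma sum_x: "(\<Sum>c<length cs. x (cs ! c)) = m"
  using milp by (simp add: milp_feasible_def Let_def sum_C m_def)

lemma sum_w: "r < n \<Longrightarrow> small r \<Longrightarrow> (\<Sum>c<length cs. w c r) = 1"
  using milp ord_small by (auto simp: milp_feasible_def Let_def sum_C w_def)

lemma y_load: "c < length cs \<Longrightarrow> (\<Sum>r | r < n \<and> small r. y (ord r) (cs ! c) * p r)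
    \<le> real (x (cs ! c)) * (real (beta (cs ! c)) + 1) * e"
  using milp nth_C by (simp add: milp_feasible_def Let_def sum_small p_def e_def)

lemma z_load: "c < length cs \<Longrightarrow> (\<Sum>r | r < n \<and> small r. z (ord r) (cs ! c) * (p r + U / k))
    \<le> real (x (cs ! c)) * of_bool (gamma' (cs ! c)) * (real (gamma (cs ! c)) + 1) * e"
  using milp nth_C by (simp add: milp_feasible_def Let_def sum_small p_def e_def modified_size_def
     of_rat_add of_rat_divide U_def k_def)

lemma alpha_sum: "l \<in> large_sizes \<epsilon> T I \<Longrightarrow> (\<Sum>c<length cs. alpha (cs ! c) l * x (cs ! c)) =
    card {r. r < n \<and> \<not> small r \<and> job_size I (ord r) = l}"
  using milp bij_betw_same_card[OF large_bij[of l]] by (simp add: milp_feasible_def Let_def sum_C)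

lemma count_bound: "c < length cs \<Longrightarrow>
    real (\<Sum>l\<in>large_sizes \<epsilon> T I. alpha (cs ! c) l) * real (x (cs ! c)) +
      (\<Sum>r | r < n \<and> small r. y (ord r) (cs ! c))
    \<le> real (x (cs ! c)) * real (delta (cs ! c)) * real k"
  using milp nth_C by (simp add: milp_feasible_def Let_def sum_small k_def sum_distrib_right)

lemma config_bound: "c < length cs \<Longrightarrow>
    (\<Sum>l\<in>large_sizes \<epsilon> T I. of_rat l * real (alpha (cs ! c) l)) + real (beta (cs ! c)) * e
     + of_bool (gamma' (cs ! c)) * real (gamma (cs ! c)) * e
     + U * (real (delta (cs ! c)) - 1 + of_bool (gamma' (cs ! c))) \<le> of_rat T"
proof -
  assume "c < length cs"
  from nth_C[OF this] have "config_load \<epsilon> T I (cs ! c) \<le> T" by (simp add: feasible_configs_def)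
  then have "(of_rat (config_load \<epsilon> T I (cs ! c)) :: real) \<le> of_rat T" by (simp add: of_rat_less_eq)
  then show ?thesis
    by (cases "gamma' (cs ! c)")
      (simp_all add: config_load_def of_rat_add of_rat_mult of_rat_sum of_rat_diff U_def e_def mult.assoc)
qed

section \<open>Availability of a configuration\<close>

lemma pick_avail: "r < n \<Longrightarrow> cf r < length cs \<Longrightarrow> avail cf r (cf r)"
proof -
  assume "r < n" "cf r < length cs"
  then have ex: "\<exists>c. c < length cs \<and> avail cf r c" and eq: "cf r = (LEAST c. c < length cs \<and> avail cf r c)"
    using cf[of r] by (auto simp: pick_def split: if_splits)
  from LeastI_ex[OF ex] show ?thesis unfolding eq[symmetric] by blast
qed

lemma pick_none: "r < n \<Longrightarrow> \<not> cf r < length cs \<Longrightarrow> c < length cs \<Longrightarrow> \<not> avail cf r c"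
proof
  assume a: "r < n" "\<not> cf r < length cs" "c < length cs" "avail cf r c"
  then have "\<exists>c. c < length cs \<and> avail cf r c" by blast
  moreover from this have "cf r = (LEAST c. c < length cs \<and> avail cf r c)"
    using cf[OF a(1)] by (simp add: pick_def)
  ultimately show False using LeastI_ex[of "\<lambda>c. c < length cs \<and> avail cf r c"] a(2) by simp
qed

lemma sum_cnt: "(\<Sum>c<N. cnt cf r c) \<le> card {r'. r' < r \<and> same r' r}"
proof -
  have "(\<Sum>c<N. cnt cf r c) = card (\<Union>c<N. {r'. r' < r \<and> same r' r \<and> cf r' = c})"
    unfolding cnt_def by (rule card_UN_disjoint[symmetric]) auto
  also have "\<dots> \<le> card {r'. r' < r \<and> same r' r}"
    by (rule card_mono) auto
  finally show ?thesis .
qed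

lemma same_small: "small r \<Longrightarrow> same r' r \<longleftrightarrow> small r'"
  by (auto simp: same_def)

lemma same_large: "\<not> small r \<Longrightarrow> same r' r \<longleftrightarrow> \<not> small r' \<and> job_size I (ord r') = job_size I (ord r)"
  by (auto simp: same_def small_def)

text \<open>For \<open>x = 0\<close> the count constraint forces every \<open>y\<close> to vanish,
  and the load constraint for \<open>z\<close> forces \<open>z * (p + U / k) = 0\<close>, where the
  second factor is positive by assumption.\<close>

lemma zero_config:
  assumes "c < length cs" "x (cs ! c) = 0" "r < n" "small r" "p r > 0 \<or> U > 0"
  shows "w c r = 0"
proof -
  have *: "\<forall>r\<in>{r. r < n \<and> small r}. f r = 0"
    if "sum f {r. r < n \<and> small r} \<le> 0" "\<And>r. r < n \<Longrightarrow> small r \<Longrightarrow> f r \<ge> (0::real)" for f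
  proof -
    have "sum f {r. r < n \<and> small r} = 0" using that by (intro antisym sum_nonneg) auto
    then show ?thesis using that by (subst (asm) sum_nonneg_eq_0_iff) auto
  qed
  have "\<forall>r\<in>{r. r < n \<and> small r}. y (ord r) (cs ! c) = 0"
    by (rule *) (use count_bound[of c] assms y_nonneg in auto)
  moreover have "\<forall>r\<in>{r. r < n \<and> small r}. z (ord r) (cs ! c) * (p r + U / k) = 0"
    by (rule *) (use z_load[of c] assms z_nonneg p_nonneg pos in \<open>auto intro!: mult_nonneg_nonneg\<close>)
  moreover have "p r + U / k > 0" using assms(5) pos p_nonneg[OF assms(3)]
    by (auto intro: add_pos_nonneg add_nonneg_pos)
  ultimately show ?thesis using assms by (auto simp: w_def)
qed

lemma dem_w: "small r \<Longrightarrow> dem r c = (\<Sum>r'\<le>r. w c r')"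
  unfolding dem_def w_def by (simp add: sum.If_cases Int_def)

lemma default_job:
  assumes "r < n" "\<not> cf r < length cs"
  shows "p r = 0 \<and> U = 0 \<and> small r"
proof -
  have na: "\<not> avail cf r c" if "c < length cs" for c using pick_none[OF assms that] .
  have "small r"
  proof (rule ccontr)
    assume l: "\<not> small r"
    let ?l = "job_size I (ord r)"
    have "cnt cf r c \<ge> alpha (cs ! c) ?l * x (cs ! c)" if "c < length cs" for c
      using na[OF that] l by (auto simp: avail_def dem_def mult.commute simp del: of_nat_mult)
    then have "(\<Sum>c<length cs. alpha (cs ! c) ?l * x (cs ! c)) \<le> (\<Sum>c<length cs. cnt cf r c)"
      by (intro sum_mono) auto
    also have "\<dots> \<le> card {r'. r' < r \<and> same r' r}" by (rule sum_cnt)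
    also have "\<dots> < card {r'. r' < n \<and> \<not> small r' \<and> job_size I (ord r') = ?l}"
      by (rule psubset_card_mono) (use l assms in \<open>auto simp: same_large\<close>)
    finally show False using alpha_sum[OF large_size[OF assms(1) l]] by simp
  qed
  moreover have False if nz: "p r > 0 \<or> U > 0"
  proof -
    \<comment> \<open>Earlier jobs are at least as large, so \<open>zero_config\<close> applies to
      the whole prefix and configurations without machines contribute nothing to the demand.\<close>
    have nz': "p r' > 0 \<or> U > 0" if "r' \<le> r" for r' using nz p_antimono[OF that assms(1)] by auto
    have small': "small r' \<Longrightarrow> w c r' = 0" if "c < length cs" "x (cs ! c) = 0" "r' \<le> r" for c r'
      using zero_config[OF that(1,2) _ _ nz'[OF that(3)]] that(3) assms(1) by auto
    have dem: "dem r c \<le> real (cnt cf r c)" if c: "c < length cs" for c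
    proof (cases "x (cs ! c) = 0")
      case True
      then have "dem r c = 0" unfolding dem_w[OF \<open>small r\<close>]
        using small'[OF c] by (intro sum.neutral) (auto simp: w_def)
      then show ?thesis by simp
    next
      case False
      then show ?thesis using na[OF c] by (simp add: avail_def)
    qed
    have "real (card {r'. r' \<le> r \<and> small r'}) = (\<Sum>r' | r' \<le> r \<and> small r'. 1)" by simp
    also have "\<dots> = (\<Sum>r' | r' \<le> r \<and> small r'. \<Sum>c<length cs. w c r')"
      by (rule sum.cong) (use assms sum_w in auto)
    also have "\<dots> = (\<Sum>c<length cs. \<Sum>r' | r' \<le> r \<and> small r'. w c r')" by (rule sum.swap)
    also have "\<dots> = (\<Sum>c<length cs. dem r c)"
      using \<open>small r\<close> by (auto simp: dem_def w_def intro!: sum.cong)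
    also have "\<dots> \<le> (\<Sum>c<length cs. real (cnt cf r c))" by (intro sum_mono dem) auto
    also have "\<dots> \<le> real (card {r'. r' < r \<and> small r'})"
      using sum_cnt[where N = "length cs" and r = r] \<open>small r\<close>
      unfolding of_nat_sum[symmetric] of_nat_le_iff by (simp add: same_small)
    also have "\<dots> < real (card {r'. r' \<le> r \<and> small r'})"
      unfolding of_nat_less_iff by (rule psubset_card_mono) (use \<open>small r\<close> in auto)
    finally show False by simp
  qed
  ultimately show ?thesis using p_nonneg[OF assms(1)] pos(6) by force
qed

lemma cnt_strict:
  assumes "r < r'" "same r r'" "cf r = c"
  shows "cnt cf r c < cnt cf r' c"
proof -
  have "{s. s < r \<and> same s r \<and> cf s = c} \<subset> {s. s < r' \<and> same s r' \<and> cf s = c}"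
    using assms by (auto simp: same_def small_def)
  then show ?thesis unfolding cnt_def by (intro psubset_card_mono) auto
qed

text \<open>Jobs of one class and configuration have distinct counters. If these agree modulo
  \<open>X\<close>, their quotients by \<open>X\<close> are distinct, so a bound on the quotients
  bounds the number of jobs.\<close>

lemma round_robin:
  assumes "finite B" "\<And>r s. r \<in> B \<Longrightarrow> s \<in> B \<Longrightarrow> same r s" "\<And>r. r \<in> B \<Longrightarrow> cf r = c"
    "\<And>r. r \<in> B \<Longrightarrow> cnt cf r c mod X = q" "\<And>r. r \<in> B \<Longrightarrow> cnt cf r c div X < a"
  shows "card B \<le> a"
proof -
  have "inj_on (\<lambda>r. cnt cf r c div X) B"
  proof (rule inj_onI)
    fix r s assume rs: "r \<in> B" "s \<in> B" "cnt cf r c div X = cnt cf s c div X"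
    then have "cnt cf r c = cnt cf s c"
      using assms(4) by (metis div_mult_mod_eq)
    then show "r = s"
      using cnt_strict[of r s c] cnt_strict[of s r c] assms(2,3) rs by (metis less_irrefl linorder_neqE_nat)
  qed
  moreover have "(\<lambda>r. cnt cf r c div X) ` B \<subseteq> {..<a}" using assms(5) by auto
  ultimately show ?thesis using card_inj_on_le[of _ B "{..<a}"] by auto
qed

section \<open>Numbering of the machines\<close>

lemma off_mono: "c \<le> c' \<Longrightarrow> off c \<le> off c'"
  unfolding off_def by (rule sum_mono2) auto

lemma off_Suc: "off (Suc c) = off c + x (cs ! c)"
  by (simp add: off_def)

lemma machine_slot: "i < off N \<Longrightarrow> \<exists>c q. c < N \<and> q < x (cs ! c) \<and> i = off c + q"
proof (induction N)
  case (Suc N)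
  show ?case
  proof (cases "i < off N")
    case True
    then show ?thesis using Suc.IH less_SucI by blast
  next
    case False
    then show ?thesis using Suc.prems
      by (intro exI[of _ N] exI[of _ "i - off N"]) (auto simp: off_Suc)
  qed
qed (simp add: off_def)

lemma slot_unique:
  assumes "off c + q = off c' + q'" "q < x (cs ! c)" "q' < x (cs ! c')"
  shows "c = c' \<and> q = q'"
proof -
  have *: "\<not> c < c'" if "off c + q = off c' + q'" "q < x (cs ! c)" for c c' q q'
  proof
    assume "c < c'"
    then have "off c + x (cs ! c) \<le> off c'" using off_mono[of "Suc c" c'] by (simp add: off_Suc)
    with that show False by simp
  qed
  have "c = c'" using *[OF assms(1,2)] *[OF assms(1)[symmetric] assms(3)] by simp
  then show ?thesis using assms by simp
qed

lemma off_all: "off (length cs) = m"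
  by (simp add: off_def sum_x)

lemma mach_less: "r < n \<Longrightarrow> mach cf r < m"
proof -
  assume r: "r < n"
  show ?thesis
  proof (cases "cf r < length cs")
    case True
    have "x (cs ! cf r) > 0" using pick_avail[OF r True] by (simp add: avail_def)
    then have "mach cf r < off (Suc (cf r))" using True by (simp add: mach_def off_Suc)
    also have "\<dots> \<le> off (length cs)" using True by (intro off_mono) auto
    finally show ?thesis by (simp add: off_all)
  qed (use pos in \<open>simp add: mach_def\<close>)
qed

definition "sched i = ord ` {r. r < n \<and> mach cf r = i}"

lemma sched_is_schedule: "is_schedule I sched"
proof -
  have "(\<Union>i<m. sched i) = ord ` {..<n}"
    using mach_less by (auto simp: sched_def)
  then have "(\<Union>i<m. sched i) = jobs I"
    using bij_betw_imp_surj_on[OF ord_bij] by (simp add: jobs_def n_def)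
  moreover have "sched i \<inter> sched i' = {}" if "i \<noteq> i'" for i i'
    using that bij_betw_imp_inj_on[OF ord_bij] by (auto simp: sched_def inj_on_def)
  ultimately show ?thesis by (simp add: is_schedule_def m_def)
qed

text \<open>The jobs of one machine, with configuration \<open>c\<close>, that is the \<open>q\<close>-th among the machines with
  this configuration; the jobs of the default case are left out.\<close>

context
  fixes c q :: nat
  assumes c: "c < length cs" and q: "q < x (cs ! c)"
begin

definition "X = x (cs ! c)"
definition "A = {r. r < n \<and> small r \<and> cf r = c \<and> cnt cf r c mod X = q}"
definition "BL = {r. r < n \<and> \<not> small r \<and> cf r = c \<and> cnt cf r c mod X = q}"
definition "a0 = (\<Sum>l\<in>large_sizes \<epsilon> T I. alpha (cs ! c) l)"

lemma X: "X > 0" using q by (simp add: X_def)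

lemma finite_AB: "finite A" "finite BL" by (auto simp: A_def BL_def)

text \<open>Availability keeps the counter below \<open>alpha * X\<close>, which leaves
  \<open>alpha\<close> possible quotients for \<open>round_robin\<close>.\<close>

lemma large_count: "card {r \<in> BL. job_size I (ord r) = l} \<le> alpha (cs ! c) l"
proof (rule round_robin[where X = X and q = q and c = c])
  fix r assume r: "r \<in> {r \<in> BL. job_size I (ord r) = l}"
  then have "avail cf r c" using pick_avail[of r] c by (auto simp: BL_def)
  then have "cnt cf r c < alpha (cs ! c) l * X"
    using r by (auto simp: avail_def dem_def BL_def X_def mult.commute simp del: of_nat_mult)
  then show "cnt cf r c div X < alpha (cs ! c) l"
    by (simp add: less_mult_imp_div_less)
qed (auto simp: BL_def same_def small_def)

text \<open>The weight \<open>h\<close> is arbitrary because the bound is applied to the sizes and,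
  with constant weight 1, to the number of large jobs.\<close>

lemma large_sum:
  assumes "\<And>l. l \<in> large_sizes \<epsilon> T I \<Longrightarrow> h l \<ge> (0 :: real)"
  shows "(\<Sum>r\<in>BL. h (job_size I (ord r))) \<le> (\<Sum>l\<in>large_sizes \<epsilon> T I. h l * real (alpha (cs ! c) l))"
proof -
  have "(\<Sum>r\<in>BL. h (job_size I (ord r))) =
      (\<Sum>l\<in>large_sizes \<epsilon> T I. \<Sum>r | r \<in> BL \<and> job_size I (ord r) = l. h (job_size I (ord r)))"
    by (rule sum.group[symmetric]) (auto simp: finite_AB finite_large_sizes BL_def large_size)
  also have "\<dots> = (\<Sum>l\<in>large_sizes \<epsilon> T I. h l * real (card {r \<in> BL. job_size I (ord r) = l}))"
    by (rule sum.cong) auto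
  also have "\<dots> \<le> (\<Sum>l\<in>large_sizes \<epsilon> T I. h l * real (alpha (cs ! c) l))"
    using assms large_count by (intro sum_mono mult_left_mono) auto
  finally show ?thesis .
qed

lemma large_card: "card BL \<le> a0"
  using large_sum[of "\<lambda>_. 1"] by (simp add: a0_def of_nat_sum[symmetric] del: of_nat_sum)

text \<open>Consider the last job \<open>a\<close> of the prefix on this machine. The others have
  smaller quotients, so \<open>X\<close> times their number is at most the counter of
  \<open>a\<close>, which is below the demand at \<open>a\<close> because \<open>a\<close> was
  assigned here. Only \<open>a\<close> itself remains unaccounted for, whence the
  \<open>- 1\<close>.\<close>

lemma prefix_count:
  assumes "r < n" "A \<inter> {..r} \<noteq> {}"
  shows "(real (card (A \<inter> {..r})) - 1) * X < (\<Sum>r'\<le>r. w c r')"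
proof -
  define a where "a = Max (A \<inter> {..r})"
  have fin: "finite (A \<inter> {..r})" by simp
  have a: "a \<in> A" "a \<le> r" using Max_in[OF fin assms(2)] by (auto simp: a_def)
  have le: "b \<le> a" if "b \<in> A \<inter> {..r}" for b using Max_ge[OF fin that] by (simp add: a_def)
  have an: "a < n" "small a" "cf a = c" "cnt cf a c mod X = q" using a by (auto simp: A_def)
  have eq: "A \<inter> {..r} = insert a (A \<inter> {..<a})" using a le by (force simp: le_less)
  then have card: "card (A \<inter> {..r}) = Suc (card (A \<inter> {..<a}))" by simp
  have "card (A \<inter> {..<a}) \<le> cnt cf a c div X"
  proof (rule round_robin[where X = X and q = q and c = c])
    fix b assume b: "b \<in> A \<inter> {..<a}"
    then have "cnt cf b c < cnt cf a c"
      using an by (intro cnt_strict) (auto simp: A_def same_def)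
    moreover have "cnt cf b c mod X = cnt cf a c mod X" using b an by (auto simp: A_def)
    ultimately show "cnt cf b c div X < cnt cf a c div X"
      by (metis div_le_mono div_mult_mod_eq less_irrefl less_imp_le nat_less_le)
  qed (auto simp: A_def same_def)
  then have "card (A \<inter> {..<a}) * X \<le> cnt cf a c"
    by (meson div_times_less_eq_dividend le_trans mult_le_mono1)
  then have "real (card (A \<inter> {..<a})) * X \<le> real (cnt cf a c)"
    unfolding of_nat_mult[symmetric] of_nat_le_iff .
  also have "\<dots> < dem a c" using pick_avail[OF an(1)] an c by (simp add: avail_def)
  also have "\<dots> = (\<Sum>r'\<le>a. w c r')" using an by (simp add: dem_w)
  also have "\<dots> \<le> (\<Sum>r'\<le>r. w c r')"
    using a assms c by (intro sum_mono2) (auto intro!: w_nonneg)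
  finally show ?thesis by (simp add: card)
qed

lemma small_sum:
  assumes "h \<ge> 0"
  shows "(\<Sum>r\<in>A. p r + h) \<le> (\<Sum>r | r < n \<and> small r. w c r * (p r + h)) / X + e + h"
proof (cases "n = 0")
  case True
  then show ?thesis using assms pos by (simp add: A_def)
next
  case False
  \<comment> \<open>Large ranks carry no weight in either sum; the value \<open>e\<close> there
    keeps \<open>f\<close> antitone over all ranks.\<close>
  define f where "f r = (if small r then p r else e) + h" for r
  define u where "u r = (of_bool (r \<in> A) :: real)" for r
  \<comment> \<open>The unit mass at rank 0 stands for the excess of less than one job in each
    prefix. It contributes \<open>f 0\<close>, which is at most \<open>e + h\<close>.\<close>
  define v where "v r = w c r / X + of_bool (r = 0)" for r
  have "(\<Sum>r<n. u r * f r) \<le> (\<Sum>r<n. v r * f r)"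
  proof (rule sum_antitone_dominated)
    show "f s \<le> f r" if "r \<le> s" "s < n" for r s
      using p_antimono[OF that] by (auto simp: f_def small_iff)
    show "f r \<ge> 0" if "r < n" for r using p_nonneg[OF that] pos assms by (auto simp: f_def)
    fix r assume r: "r < n"
    have 1: "(\<Sum>i\<le>r. u i) = card (A \<inter> {..r})"
      by (simp add: u_def of_bool_def sum.If_cases Int_commute)
    have 2: "(\<Sum>i\<le>r. v i) = (\<Sum>i\<le>r. w c i) / X + 1"
      by (simp add: v_def sum.distrib sum_divide_distrib of_bool_def)
    have w0: "(\<Sum>i\<le>r. w c i) \<ge> 0" using r c by (intro sum_nonneg w_nonneg) auto
    show "(\<Sum>i\<le>r. u i) \<le> (\<Sum>i\<le>r. v i)"
    proof (cases "A \<inter> {..r} = {}")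
      case True
      then show ?thesis unfolding 1 2 using w0 by simp
    next
      case False
      from prefix_count[OF r False] X show ?thesis unfolding 1 2
        by (simp add: field_simps)
    qed
  qed
  moreover have "(\<Sum>r<n. u r * f r) = (\<Sum>r\<in>A. p r + h)"
  proof -
    have "(\<Sum>r<n. u r * f r) = (\<Sum>r\<in>{..<n} \<inter> A. f r)"
      by (simp add: u_def of_bool_def if_distrib[where f = "\<lambda>a. a * _"] sum.inter_restrict cong: if_cong)
    also have "\<dots> = (\<Sum>r\<in>A. p r + h)"
      by (rule sum.cong) (auto simp: A_def f_def)
    finally show ?thesis .
  qed
  moreover have "(\<Sum>r<n. v r * f r) = (\<Sum>r<n. w c r * f r) / X + f 0"
    using False by (simp add: v_def distrib_right sum.distrib sum_divide_distrib of_bool_def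
        if_distrib[where f = "\<lambda>a. a * _"] cong: if_cong)
  moreover have "(\<Sum>r<n. w c r * f r) = (\<Sum>r | r < n \<and> small r. w c r * (p r + h))"
    by (rule sum.mono_neutral_cong_right) (auto simp: w_def f_def)
  moreover have "f 0 \<le> e + h" by (auto simp: f_def small_iff)
  ultimately show ?thesis by simp
qed

text \<open>The three \<open>e\<close> come from \<open>beta + 1\<close>, from
  \<open>gamma + 1\<close> and from the excess job of \<open>small_sum\<close>. The count constraint
  turns the shares \<open>U / k\<close> of the large jobs and of the \<open>y\<close> part into
  \<open>U * delta\<close>, which is what the configuration pays when \<open>gamma'\<close> holds;
  the share of the excess job cancels against the subtracted \<open>U / k\<close>.\<close>

lemma load_modified:
  assumes "gamma' (cs ! c) \<or> U = 0"
  shows "(\<Sum>r\<in>BL \<union> A. p r) + U / k * (card (BL \<union> A)) - U / k \<le> of_rat T + 3 * e"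
proof -
  let ?c = "cs ! c"
  let ?S = "{r. r < n \<and> small r}"
  have Uk: "U / k \<ge> 0" using pos by simp
  have disj: "BL \<inter> A = {}" by (auto simp: A_def BL_def)
  have "(\<Sum>r\<in>BL. p r) \<le> (\<Sum>l\<in>large_sizes \<epsilon> T I. of_rat l * real (alpha ?c l))"
    unfolding p_def by (rule large_sum[OF large_size_nonneg])
  moreover have "U / k * card BL \<le> U / k * a0" using large_card Uk by (intro mult_left_mono) auto
  moreover have "(\<Sum>r\<in>A. p r) + U / k * card A = (\<Sum>r\<in>A. p r + U / k)"
    by (simp add: sum.distrib)
  moreover have "(\<Sum>r\<in>A. p r + U / k) \<le> (\<Sum>r\<in>?S. w c r * (p r + U / k)) / X + e + U / k"
    by (rule small_sum[OF Uk])
  moreover have "(\<Sum>r\<in>?S. w c r * (p r + U / k)) / X \<le>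
     (real (beta ?c) + 1) * e + U * real (delta ?c) - U / k * a0 + of_bool (gamma' ?c) * (real (gamma ?c) + 1) * e"
  proof -
    have "(\<Sum>r\<in>?S. w c r * (p r + U / k)) =
        (\<Sum>r\<in>?S. y (ord r) ?c * p r) + U / k * (\<Sum>r\<in>?S. y (ord r) ?c) + (\<Sum>r\<in>?S. z (ord r) ?c * (p r + U / k))"
    proof -
      have "(\<Sum>r\<in>?S. w c r * (p r + U / k)) = (\<Sum>r\<in>?S. y (ord r) ?c * p r + U / k * y (ord r) ?c +
          z (ord r) ?c * (p r + U / k))"
        by (rule sum.cong) (auto simp: w_def algebra_simps)
      then show ?thesis by (simp only: sum.distrib sum_distrib_left)
    qed
    also have "\<dots> \<le> X * (real (beta ?c) + 1) * e + U / k * (X * real (delta ?c) * real k - a0 * X) +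
        X * of_bool (gamma' ?c) * (real (gamma ?c) + 1) * e"
      using y_load[OF c] z_load[OF c] count_bound[OF c] Uk unfolding X_def a0_def
      by (intro add_mono mult_left_mono) auto
    also have "\<dots> = X * ((real (beta ?c) + 1) * e + U * real (delta ?c) - U / k * a0 +
        of_bool (gamma' ?c) * (real (gamma ?c) + 1) * e)"
      using pos(4) by (simp add: field_simps)
    finally show ?thesis using X by (simp add: pos_divide_le_eq mult.commute)
  qed
  moreover have "(\<Sum>r\<in>BL \<union> A. p r) = (\<Sum>r\<in>BL. p r) + (\<Sum>r\<in>A. p r)"
    "card (BL \<union> A) = card BL + card A"
    using disj finite_AB by (simp_all add: sum.union_disjoint card_Un_disjoint)
  ultimately have "(\<Sum>r\<in>BL \<union> A. p r) + U / k * (card (BL \<union> A)) - U / k \<le>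
      (\<Sum>l\<in>large_sizes \<epsilon> T I. of_rat l * real (alpha ?c l)) + (real (beta ?c) + 1) * e +
      U * real (delta ?c) + of_bool (gamma' ?c) * (real (gamma ?c) + 1) * e + e"
    by (simp add: distrib_left)
  also have "\<dots> \<le> of_rat T + 3 * e"
    using config_bound[OF c] assms pos by (cases "gamma' ?c") (auto simp: algebra_simps)
  finally show ?thesis .
qed

text \<open>Here the load constraint forces \<open>z = 0\<close>, so the count constraint governs
  all jobs of the configuration. It yields at most \<open>delta * k\<close> jobs on the machine and
  hence at most \<open>delta - 1\<close> setups, as paid for by the configuration. Sizes are rounded
  separately, with weight \<open>h = 0\<close>.\<close>

lemma load_plain:
  assumes "\<not> gamma' (cs ! c)" "U > 0" "BL \<union> A \<noteq> {}"
  shows "(\<Sum>r\<in>BL \<union> A. p r) + U * real ((card (BL \<union> A) - 1) div k) \<le> of_rat T + 3 * e"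
proof -
  let ?c = "cs ! c"
  let ?S = "{r. r < n \<and> small r}"
  have disj: "BL \<inter> A = {}" by (auto simp: A_def BL_def)
  have z0: "z (ord r) ?c = 0" if r: "r \<in> ?S" for r
  proof -
    have "(\<Sum>r\<in>?S. z (ord r) ?c * (p r + U / k)) = 0"
      using z_load[OF c] assms z_nonneg p_nonneg pos c
      by (intro antisym sum_nonneg) (auto intro!: mult_nonneg_nonneg)
    then have "\<forall>r\<in>?S. z (ord r) ?c * (p r + U / k) = 0"
      using z_nonneg p_nonneg pos c by (subst (asm) sum_nonneg_eq_0_iff) (auto intro!: mult_nonneg_nonneg)
    moreover have "p r + U / k > 0" using p_nonneg[of r] r assms pos by (auto intro: add_nonneg_pos)
    ultimately show ?thesis using r by force
  qed
  have wy: "w c r = y (ord r) ?c" if "r \<in> ?S" for r using z0[OF that] that by (simp add: w_def)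
  have y0: "(\<Sum>r\<in>?S. y (ord r) ?c) \<ge> 0" using y_nonneg c by (intro sum_nonneg) auto
  have "real a0 * X \<le> real (delta ?c * k) * X" using count_bound[OF c] y0 by (simp add: a0_def X_def mult_ac)
  then have a0: "a0 \<le> delta ?c * k" using X unfolding mult_le_cancel_right of_nat_le_iff by auto
  have "card A \<le> delta ?c * k - a0"
  proof (cases "A = {}")
    case False
    then have n: "n - 1 < n" "A \<inter> {..n - 1} = A" by (auto simp: A_def)
    from prefix_count[OF n(1)] False have "(real (card A) - 1) * X < (\<Sum>r\<le>n - 1. w c r)" unfolding n(2) by simp
    also have "(\<Sum>r\<le>n - 1. w c r) = (\<Sum>r\<in>?S. y (ord r) ?c)"
      by (rule sum.mono_neutral_cong_right) (use n(1) wy in \<open>auto simp: w_def\<close>)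
    also have "\<dots> \<le> (real (delta ?c * k) - real a0) * X"
      using count_bound[OF c] by (simp add: a0_def X_def algebra_simps)
    \<comment> \<open>Both \<open>card A\<close> and \<open>delta * k - a0\<close> are integers, so
      the strict inequality leaves no excess job in the count.\<close>
    finally have "real (card A) - 1 < real (delta ?c * k) - real a0"
      using X by (simp add: mult_less_cancel_right)
    then show ?thesis using a0 by linarith
  qed simp
  then have N: "card (BL \<union> A) \<le> delta ?c * k"
    using a0 large_card disj finite_AB by (simp add: card_Un_disjoint)
  have "card (BL \<union> A) \<ge> 1" using assms(3) finite_AB by (simp add: Suc_le_eq card_gt_0_iff)
  with N have "card (BL \<union> A) - 1 < delta ?c * k" by simp
  then have "(card (BL \<union> A) - 1) div k < delta ?c" by (simp add: less_mult_imp_div_less)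
  then have "U * real ((card (BL \<union> A) - 1) div k) \<le> U * (real (delta ?c) - 1)"
    using pos by (intro mult_left_mono) auto
  moreover have "(\<Sum>r\<in>BL. p r) \<le> (\<Sum>l\<in>large_sizes \<epsilon> T I. of_rat l * real (alpha ?c l))"
    unfolding p_def by (rule large_sum[OF large_size_nonneg])
  moreover have "(\<Sum>r\<in>A. p r) \<le> (\<Sum>r\<in>?S. y (ord r) ?c * p r) / X + e"
  proof -
    have "(\<Sum>r\<in>?S. w c r * p r) = (\<Sum>r\<in>?S. y (ord r) ?c * p r)" by (rule sum.cong) (auto simp: wy)
    then show ?thesis using small_sum[of 0] by simp
  qed
  moreover have "(\<Sum>r\<in>?S. y (ord r) ?c * p r) / X \<le> (real (beta ?c) + 1) * e"
    using y_load[OF c] X by (simp add: X_def pos_divide_le_eq mult_ac)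
  moreover have "(\<Sum>r\<in>BL \<union> A. p r) = (\<Sum>r\<in>BL. p r) + (\<Sum>r\<in>A. p r)"
    using disj finite_AB by (simp add: sum.union_disjoint)
  moreover note config_bound[OF c]
  ultimately show ?thesis using assms(1) pos by (simp add: algebra_simps)
qed

lemma load_bound: "of_rat (machine_load I (sched (off c + q))) \<le> (of_rat T + 3 * e :: real)"
proof -
  let ?R = "{r. r < n \<and> mach cf r = off c + q}"
  \<comment> \<open>Jobs of the default case, all on machine 0. They have size 0 and occur only for
    \<open>U = 0\<close>, so neither the total size nor the setup time notices them.\<close>
  define D where "D = {r \<in> ?R. \<not> cf r < length cs}"
  have R: "?R = BL \<union> A \<union> D"
  proof -
    have "mach cf r = off c + q \<longleftrightarrow> cf r = c \<and> cnt cf r c mod X = q" if r: "r < n" "cf r < length cs" for r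
    proof -
      have "x (cs ! cf r) > 0" using pick_avail[OF r] by (simp add: avail_def)
      then have "cnt cf r (cf r) mod x (cs ! cf r) < x (cs ! cf r)" by simp
      then show ?thesis using slot_unique[OF _ _ q, of "cf r" "cnt cf r (cf r) mod x (cs ! cf r)"] r
        by (auto simp: mach_def X_def)
    qed
    then show ?thesis using c by (auto simp: A_def BL_def D_def)
  qed
  have D: "p r = 0 \<and> U = 0" if "r \<in> D" for r using default_job that by (auto simp: D_def)
  have inj: "inj_on ord ?R" by (rule inj_on_subset[OF bij_betw_imp_inj_on[OF ord_bij]]) auto
  have load: "of_rat (machine_load I (sched (off c + q))) =
      (if ?R = {} then 0 else (\<Sum>r\<in>?R. p r) + U * real ((card ?R - 1) div k))"
    using card_image[OF inj] sum.reindex[OF inj, of "job_size I"]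
    by (auto simp: machine_load_def sched_def of_rat_add of_rat_mult of_rat_sum U_def p_def k_def)
  have eq: "(\<Sum>r\<in>?R. p r) = (\<Sum>r\<in>BL \<union> A. p r)"
  proof (rule sum.mono_neutral_right)
    show "BL \<union> A \<subseteq> ?R" using R by blast
    show "\<forall>r\<in>?R - (BL \<union> A). p r = 0" using R D by blast
  qed simp
  have eq': "?R = BL \<union> A" if "U > 0"
  proof -
    have "D = {}" using D that by (metis equals0I less_irrefl)
    then show ?thesis using R by simp
  qed
  consider "?R = {}" | "U = 0" "of_rat (machine_load I (sched (off c + q))) = (\<Sum>r\<in>BL \<union> A. p r)"
    | "U > 0" "?R \<noteq> {}" "of_rat (machine_load I (sched (off c + q))) =
        (\<Sum>r\<in>BL \<union> A. p r) + U * real ((card (BL \<union> A) - 1) div k)" "BL \<union> A \<noteq> {}"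
  proof (cases "?R = {}")
    case True
    then show ?thesis using that(1) by blast
  next
    case False
    then have l: "of_rat (machine_load I (sched (off c + q))) =
        (\<Sum>r\<in>?R. p r) + U * real ((card ?R - 1) div k)"
      unfolding load by (rule if_not_P)
    show ?thesis
    proof (cases "U = 0")
      case True
      then show ?thesis using that(2) l eq by simp
    next
      case U: False
      then have "?R = BL \<union> A" using eq' pos(6) by simp
      then show ?thesis using that(3) l False U pos(6) by simp
    qed
  qed
  then show ?thesis
  proof cases
    case 1
    then show ?thesis using load pos by simp
  next
    case 2
    then show ?thesis using load_modified by simp
  next
    case 3
    show ?thesis
    proof (cases "gamma' (cs ! c)")
      case False
      then show ?thesis using load_plain 3 by simp
    next
      case True
      have N: "card (BL \<union> A) \<ge> 1" using 3 finite_AB by (simp add: Suc_le_eq card_gt_0_iff)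
      have "real ((card (BL \<union> A) - 1) div k) \<le> (real (card (BL \<union> A)) - 1) / k"
        using of_nat_div_le_of_nat[of "card (BL \<union> A) - 1" k, where 'a = real] N by (simp add: of_nat_diff)
      then have "U * real ((card (BL \<union> A) - 1) div k) \<le> U * ((real (card (BL \<union> A)) - 1) / k)"
        using pos by (intro mult_left_mono) auto
      also have "\<dots> = U / k * card (BL \<union> A) - U / k" by (simp add: field_simps diff_divide_distrib)
      finally show ?thesis using load_modified True 3(3) by simp
    qed
  qed
qed

end

lemma makespan_bound: "makespan I sched \<le> (1 + 3 * \<epsilon>) * T"
proof -
  have "machine_load I (sched i) \<le> (1 + 3 * \<epsilon>) * T" if im: "i < m" for i
  proof -
    obtain c q where c: "c < length cs" "q < x (cs ! c)" "i = off c + q"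
      using machine_slot[of i "length cs"] im off_all by auto
    have "of_rat (machine_load I (sched i)) \<le> (of_rat ((1 + 3 * \<epsilon>) * T) :: real)"
      using load_bound[OF c(1,2)] c(3) by (simp add: e_def of_rat_mult of_rat_add algebra_simps)
    then show ?thesis by (simp only: of_rat_less_eq)
  qed
  moreover have "0 \<in> {..<m}" using pos by simp
  ultimately show ?thesis unfolding makespan_def m_def[symmetric] by (intro Max.boundedI) auto
qed

end


section \<open>The rounding rule as a sequence of terms\<close>

text \<open>Truth values are 0 and 1: conjunction is multiplication, negation is subtraction from 1,
  and a condition inside a sum is a factor.\<close>

definition ltT :: "tm \<Rightarrow> tm \<Rightarrow> tm" where "ltT = Bin Lt"
definition addT :: "tm \<Rightarrow> tm \<Rightarrow> tm" where "addT = Bin Add"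
definition mulT :: "tm \<Rightarrow> tm \<Rightarrow> tm" where "mulT = Bin Mul"
definition subT :: "tm \<Rightarrow> tm \<Rightarrow> tm" where "subT = Bin Sub"
definition divT :: "tm \<Rightarrow> tm \<Rightarrow> tm" where "divT = Bin Quot"
definition notT :: "tm \<Rightarrow> tm" where "notT = subT (Num 1)"
definition leT :: "tm \<Rightarrow> tm \<Rightarrow> tm" where "leT a b = notT (ltT b a)"
definition eqT :: "tm \<Rightarrow> tm \<Rightarrow> tm" where "eqT a b = mulT (leT a b) (leT b a)"

lemmas opT_defs = ltT_def addT_def mulT_def subT_def divT_def notT_def leT_def eqT_def

lemma tval_op [simp]:
  "tval (ltT a b) \<rho> s = of_bool (tval a \<rho> s < tval b \<rho> s)"
  "tval (addT a b) \<rho> s = tval a \<rho> s + tval b \<rho> s"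
  "tval (mulT a b) \<rho> s = tval a \<rho> s * tval b \<rho> s"
  "tval (subT a b) \<rho> s = tval a \<rho> s - tval b \<rho> s"
  "tval (divT a b) \<rho> s = tval a \<rho> s div tval b \<rho> s"
  "tval (notT a) \<rho> s = 1 - tval a \<rho> s"
  "tval (leT a b) \<rho> s = of_bool (tval a \<rho> s \<le> tval b \<rho> s)"
  "tval (eqT a b) \<rho> s = of_bool (tval a \<rho> s = tval b \<rho> s)"
  by (auto simp: opT_defs)

lemma arrays_op [simp]:
  "arrays (ltT a b) = arrays a \<union> arrays b"
  "arrays (addT a b) = arrays a \<union> arrays b"
  "arrays (mulT a b) = arrays a \<union> arrays b"
  "arrays (subT a b) = arrays a \<union> arrays b"
  "arrays (divT a b) = arrays a \<union> arrays b"
  "arrays (notT a) = arrays a"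
  "arrays (leT a b) = arrays a \<union> arrays b"
  "arrays (eqT a b) = arrays a \<union> arrays b"
  by (auto simp: opT_defs)

section \<open>Terms for the input layout and for the rounding rule\<close>

definition lenT :: tm where "lenT = Arr 1 (Num 0)"
definition inT :: "tm \<Rightarrow> tm" where "inT = Arr 0"
text \<open>Layout of the input: \<open>\<epsilon>\<close> at 0 and 1, \<open>T\<close> at 2 and 3,
  then \<open>n\<close>, \<open>m\<close>, \<open>k\<close> at 4 to 6, \<open>U\<close> at 7 and 8,
  the job sizes from 9 on, the number of large sizes at \<open>9 + 2 * n\<close>, followed by these
  sizes, the number of configurations and one block of fixed length for each of them.\<close>

definition nT :: tm where "nT = inT (Num 4)"
definition lamT :: tm where "lamT = inT (addT (Num 9) (mulT (Num 2) nT))"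
definition CnT :: tm where "CnT = inT (addT (Num 10) (addT (mulT (Num 2) nT) (mulT (Num 2) lamT)))"

text \<open>Array 2 contains the products of the positive input entries up to each position. The last of
  these products is a common multiple of all denominators of the input.\<close>

definition prodT :: tm where
  "prodT = mulT (addT (Arr 2 (subT (Var 0) (Num 1))) (ltT (Var 0) (Num 1)))
     (addT (Num 1) (mulT (ltT (Num 0) (inT (Var 0))) (subT (inT (Var 0)) (Num 1))))"

definition DT :: tm where "DT = Arr 2 (subT lenT (Num 1))"

text \<open>The numerator is at position \<open>t\<close> of the input, the denominator at \<open>t + 1\<close>; multiplied with the
  common multiple, the fraction is an integer.\<close>

definition fracT :: "tm \<Rightarrow> tm" where
  "fracT t = mulT (inT t) (divT DT (inT (addT t (Num 1))))"

definition sizeT :: tm where "sizeT = fracT (addT (Num 9) (mulT (Num 2) (Var 0)))"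
definition pT :: "tm \<Rightarrow> tm" where "pT = Arr 3"

definition rankT :: tm where
  "rankT = Sum 1 (mulT (ltT (Var 1) nT) (addT (ltT (pT (Var 0)) (pT (Var 1)))
     (mulT (eqT (pT (Var 1)) (pT (Var 0))) (ltT (Var 1) (Var 0)))))"

text \<open>Inverts the permutation in array 4 by a sum with a single matching index.\<close>

definition ordT :: tm where
  "ordT = Sum 1 (mulT (mulT (ltT (Var 1) nT) (eqT (Arr 4 (Var 1)) (Var 0))) (Var 1))"

text \<open>The comparison with \<open>\<epsilon> * T\<close>, multiplied by both denominators and
  by the common multiple already contained in the scaled sizes.\<close>

definition smallT :: "tm \<Rightarrow> tm" where
  "smallT t = ltT (mulT (pT t) (mulT (inT (Num 1)) (inT (Num 3))))
     (mulT (mulT (inT (Num 0)) (inT (Num 2))) DT)"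

text \<open>The position of a job in the list of small jobs. At index \<open>n\<close> it gives the
  length of this list, from which \<open>baseT\<close> obtains the block length.\<close>

definition sidxT :: tm where
  "sidxT = Sum 1 (mulT (mulT (ltT (Var 1) nT) (ltT (Var 1) (Var 0))) (smallT (Var 1)))"

definition baseT :: tm where
  "baseT = addT (addT (Num 11) (addT (mulT (Num 2) nT) (mulT (Num 2) lamT)))
     (mulT (Var 0) (addT (addT lamT (Num 5)) (mulT (Num 4) (Arr 6 nT))))"

definition ord_of :: "tm \<Rightarrow> tm" where "ord_of = Arr 5"

definition sameT :: "tm \<Rightarrow> tm \<Rightarrow> tm" where
  "sameT a b = addT (mulT (smallT (ord_of a)) (smallT (ord_of b)))
     (mulT (notT (smallT (ord_of b))) (eqT (pT (ord_of a)) (pT (ord_of b))))"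

text \<open>The bound variable is a parameter so that it can be chosen apart from the variables of
  \<open>r\<close> and \<open>c\<close>.\<close>

definition cntT :: "tm \<Rightarrow> tm \<Rightarrow> nat \<Rightarrow> tm" where
  "cntT r c v = Sum v (mulT (mulT (ltT (Var v) r) (sameT (Var v) r)) (eqT (Arr 8 (Var v)) c))"

definition xT :: "tm \<Rightarrow> tm" where "xT c = inT (addT (Arr 7 c) (addT lamT (Num 4)))"

definition wT :: "tm \<Rightarrow> tm \<Rightarrow> tm" where
  "wT r c = (let b = addT (addT (Arr 7 c) (addT lamT (Num 5))) (mulT (Num 4) (Arr 6 (ord_of r)))
     in addT (fracT b) (fracT (addT b (Num 2))))"

text \<open>The demand times the common multiple. In the large case the inner sum looks up the
  coefficient \<open>alpha\<close> by searching the list of large sizes for the size of the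
  job.\<close>

definition demT :: "tm \<Rightarrow> tm \<Rightarrow> nat \<Rightarrow> tm" where
  "demT r c v = addT
     (mulT (smallT (ord_of r))
       (Sum v (mulT (mulT (leT (Var v) r) (smallT (ord_of (Var v)))) (wT (Var v) c))))
     (mulT (notT (smallT (ord_of r))) (mulT DT (mulT (xT c)
       (Sum v (mulT (mulT (ltT (Var v) lamT)
           (eqT (fracT (addT (addT (Num 10) (mulT (Num 2) nT)) (mulT (Num 2) (Var v)))) (pT (ord_of r))))
         (inT (addT (Arr 7 c) (Var v))))))))"

definition availT :: "tm \<Rightarrow> tm \<Rightarrow> nat \<Rightarrow> tm" where
  "availT r c v = mulT (ltT (Num 0) (xT c)) (ltT (mulT DT (cntT r c v)) (demT r c v))"

text \<open>The least available configuration is the number of configurations without an available one up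
  to them.\<close>

definition pickT :: tm where
  "pickT = Sum 1 (mulT (ltT (Var 1) CnT)
     (ltT (Sum 2 (mulT (leT (Var 2) (Var 1)) (availT (Var 0) (Var 2) 3))) (Num 1)))"

text \<open>The remainder is written as \<open>q - x * (q div x)\<close>, division being the
  primitive operation.\<close>

definition machT :: tm where
  "machT = (let c = Arr 8 (Var 0); q = cntT (Var 0) c 1 in
     mulT (ltT c CnT) (addT (Sum 1 (mulT (ltT (Var 1) c) (xT (Var 1))))
       (subT q (mulT (xT c) (divT q (xT c))))))"

definition outT :: tm where "outT = Arr 9 (Arr 4 (Var 0))"

text \<open>The output phase is kept apart because it overwrites the input; the last phase here
  saves \<open>n\<close> in array 10 beforehand.\<close>

definition main_phases :: "(nat \<times> tm) list" where
  "main_phases = [(3, sizeT), (4, rankT), (5, ordT), (6, sidxT), (7, baseT), (8, pickT), (9, machT), (10, nT)]"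

lemma sum_of_bool_mult: "(\<Sum>i<N. of_bool (P i) * f i) = (\<Sum>i | i < (N :: nat) \<and> P i. (f i :: int))"
proof -
  have "(\<Sum>i<N. of_bool (P i) * f i) = (\<Sum>i\<in>{..<N}. if P i then f i else 0)"
    by (rule sum.cong) auto
  also have "\<dots> = (\<Sum>i\<in>{i \<in> {..<N}. P i}. f i)" by (rule sum.inter_filter[symmetric]) simp
  finally show ?thesis by simp
qed

lemma sum_of_bool_card: "(\<Sum>i<N. of_bool (P i)) = int (card {i. i < (N :: nat) \<and> P i})"
  using sum_of_bool_mult[where f = "\<lambda>_. 1" and P = P and N = N] by simp

lemmas term_defs = lenT_def inT_def nT_def lamT_def CnT_def prodT_def DT_def fracT_def sizeT_def pT_def
  rankT_def ordT_def smallT_def sidxT_def baseT_def ord_of_def sameT_def cntT_def xT_def wT_def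
  demT_def availT_def pickT_def machT_def outT_def Let_def

section \<open>Causality and growth of the phases\<close>

lemma causal_prodT: "causal 2 prodT"
  unfolding causal_def prodT_def inT_def by simp

text \<open>Array 8 is read only inside the counter, where the factor for \<open>v < r\<close>
  annihilates all entries from the current index on.\<close>

lemma causal_pickT: "causal 8 pickT"
  unfolding causal_def
proof (intro allI impI)
  fix i s s'
  assume s: "\<forall>b. b \<noteq> 8 \<longrightarrow> s b = s' b" and 8: "\<forall>j<int i. s 8 j = (s' :: store) 8 j"
  have s1: "s (Suc 0) = s' (Suc 0)" using s by simp
  have cong: "tval t \<rho> s = tval t \<rho> s'" if "8 \<notin> arrays t" for t \<rho>
    by (rule tval_cong) (use s that in metis)
  have cnt: "tval (cntT (Var 0) (Var 2) 3) \<rho> s = tval (cntT (Var 0) (Var 2) 3) \<rho> s'"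
    if "\<rho> 0 = int i" for \<rho>
    unfolding cntT_def tval.simps
  proof (rule sum.cong)
    show "{..<nat (s 1 0)} = {..<nat (s' 1 0)}" using s by simp
    fix j
    have "tval (sameT (Var 3) (Var 0)) (\<rho>(3 := int j)) s = tval (sameT (Var 3) (Var 0)) (\<rho>(3 := int j)) s'"
      by (rule cong) (simp add: term_defs)
    then show "tval (mulT (mulT (ltT (Var 3) (Var 0)) (sameT (Var 3) (Var 0))) (eqT (Arr 8 (Var 3)) (Var 2)))
          (\<rho>(3 := int j)) s =
        tval (mulT (mulT (ltT (Var 3) (Var 0)) (sameT (Var 3) (Var 0))) (eqT (Arr 8 (Var 3)) (Var 2)))
          (\<rho>(3 := int j)) s'"
      using 8 that by simp
  qed
  have "tval (xT (Var 2)) \<rho> s = tval (xT (Var 2)) \<rho> s'" "tval DT \<rho> s = tval DT \<rho> s'"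
    "tval (demT (Var 0) (Var 2) 3) \<rho> s = tval (demT (Var 0) (Var 2) 3) \<rho> s'"
    "tval CnT \<rho> s = tval CnT \<rho> s'" for \<rho>
    by (rule cong, simp add: term_defs)+
  then show "tval pickT (\<lambda>_. int i) s = tval pickT (\<lambda>_. int i) s'"
    using s1 by (simp add: pickT_def availT_def cnt)
qed

text \<open>A tame phase multiplies the bit bound by a constant. The phase for \<open>prodT\<close>
  multiplies as many factors as there are input entries and is bounded separately through the
  encoding length.\<close>

definition tame :: "nat \<times> tm \<Rightarrow> bool" where
  "tame p \<longleftrightarrow> fst p \<noteq> 1 \<and> (\<exists>\<kappa>\<ge>1. \<forall>s B i. bounded_store B s \<longrightarrow> i \<le> nat (s 1 0) \<longrightarrow>
     bounded_store (B * \<kappa>) (phase (fst p) (snd p) i s))"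

lemma tame_nonrec: "a \<notin> arrays t \<Longrightarrow> tmp \<notin> arrays t \<Longrightarrow> a \<noteq> 1 \<Longrightarrow> tame (a, t)"
  unfolding tame_def
  by (auto intro!: exI[of _ "tsize t"] phase_bounded_nonrec simp del: One_nat_def)
    (cases t; simp)

lemma tval_count:
  "tval (Sum v (mulT (ltT a b) (ltT c d))) \<rho> s = int (card {i. i < nat (s 1 0) \<and>
     tval a (\<rho>(v := int i)) s < tval b (\<rho>(v := int i)) s \<and> tval c (\<rho>(v := int i)) s < tval d (\<rho>(v := int i)) s})"
  by (simp add: of_bool_conj[symmetric] sum_of_bool_card del: of_bool_conj)

text \<open>This phase reads its own results, but every value is the number of certain indices below
  the input length, whatever the array contains.\<close>

lemma tame_pickT: "tame (8, pickT)"
proof -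
  have "bounded_store (B * 1) (phase 8 pickT i s)" if s: "bounded_store B s" "i \<le> nat (s 1 0)" for B s i
  proof (rule phase_bounded[OF s(1)])
    fix j
    let ?s = "phase 8 pickT j s"
    have L: "?s 1 0 = s 1 0" by (simp add: phase_other)
    define C where "C = {c. c < nat (?s 1 0) \<and> tval (Var 1) ((\<lambda>_. int j)(1 := int c)) ?s < tval CnT ((\<lambda>_. int j)(1 := int c)) ?s \<and>
        tval (Sum 2 (mulT (leT (Var 2) (Var 1)) (availT (Var 0) (Var 2) 3))) ((\<lambda>_. int j)(1 := int c)) ?s <
        tval (Num 1) ((\<lambda>_. int j)(1 := int c)) ?s}"
    have v: "tval pickT (\<lambda>_. int j) ?s = int (card C)"
      unfolding pickT_def C_def by (rule tval_count)
    have "card C \<le> card {..<nat (s 1 0)}" unfolding C_def L by (rule card_mono) auto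
    moreover have "\<bar>s 1 0\<bar> \<le> 2 ^ B" using s by (auto simp: bounded_store_def)
    ultimately show "\<bar>tval pickT (\<lambda>_. int j) ?s\<bar> \<le> 2 ^ (B * 1)"
      unfolding v using abs_int_le[of "card C" "s 1 0" "2 ^ B"] by simp
  qed simp
  then show ?thesis unfolding tame_def by (auto intro!: exI[of _ 1])
qed

lemma bounded_phases_tame:
  "\<forall>p\<in>set ps. tame p \<Longrightarrow> \<exists>\<kappa>\<ge>1. \<forall>s B. bounded_store B s \<longrightarrow> bounded_phases (B * \<kappa>) ps s"
proof (induction ps)
  case Nil
  then show ?case by (auto intro: exI[of _ 1])
next
  case (Cons p ps)
  obtain a t where p: "p = (a, t)" by (cases p)
  obtain \<kappa> where \<kappa>: "\<kappa> \<ge> 1" "\<And>s B i. bounded_store B s \<Longrightarrow> i \<le> nat (s 1 0) \<Longrightarrow>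
      bounded_store (B * \<kappa>) (phase a t i s)" and a: "a \<noteq> 1"
    using Cons.prems by (auto simp: p tame_def)
  obtain \<kappa>' where \<kappa>': "\<kappa>' \<ge> 1" "\<And>s B. bounded_store B s \<Longrightarrow> bounded_phases (B * \<kappa>') ps s"
    using Cons by auto
  have "bounded_phases (B * (\<kappa> * \<kappa>')) (p # ps) s" if s: "bounded_store B s" for B s
  proof -
    have "bounded_store (B * (\<kappa> * \<kappa>')) (phase a t i s)" if "i \<le> nat (s 1 0)" for i
      using bounded_store_mono[OF \<kappa>(2)[OF s that]] \<kappa>'(1) by (simp add: mult.assoc[symmetric])
    moreover have "bounded_phases (B * \<kappa> * \<kappa>') ps (phase a t (nat (s 1 0)) s)"
      by (intro \<kappa>' \<kappa> s) simp
    ultimately show ?thesis by (simp add: p mult.assoc)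
  qed
  moreover have "\<kappa> * \<kappa>' \<ge> 1" using \<kappa>(1) \<kappa>'(1) by simp
  ultimately show ?case by blast
qed

lemma phases_append: "phases (ps @ qs) s = phases qs (phases ps s)"
  by (induction ps s rule: phases.induct) auto

lemma wf_main: "wf_phases ((2, prodT) # main_phases @ [(0, outT)])"
  by (auto simp: wf_phases_def main_phases_def term_defs)

lemma main_tame: "\<forall>p\<in>set (main_phases @ [(0, outT)]). tame p"
  by (auto simp: main_phases_def tame_pickT intro!: tame_nonrec) (simp_all add: term_defs)

lemma main_fixpoint:
  assumes "(a, t) \<in> set ((2, prodT) # main_phases)" "0 \<le> j" "j < s 1 0"
  shows "phases ((2, prodT) # main_phases) s a j = tval t (\<lambda>_. j) (phases ((2, prodT) # main_phases) s)"
proof (rule phases_fixpoint)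
  show "wf_phases ((2, prodT) # main_phases)" using wf_main by (auto simp: wf_phases_def)
  show "distinct (map fst ((2, prodT) # main_phases))" by (simp add: main_phases_def)
  show "sorted_wrt (\<lambda>(a, t) (a', t'). a' \<notin> arrays t) ((2, prodT) # main_phases)"
    by (simp add: main_phases_def term_defs)
  fix a t assume "(a, t) \<in> set ((2, prodT) # main_phases)"
  then have "(a, t) = (2, prodT) \<or> (a, t) = (8, pickT) \<or> a \<notin> arrays t"
    by (auto simp: main_phases_def term_defs)
  then show "causal a t" using causal_prodT causal_pickT causal_trivial by auto
qed (use assms in auto)

text \<open>The recursion starts from cell -1, which holds 0; the summand for
  \<open>Var 0 < 1\<close> replaces this by the empty product 1.\<close>

lemma prodT_value:
  assumes "s 2 (-1) = 0"
  shows "tval prodT (\<lambda>_. int j) (phase 2 prodT j s) = (\<Prod>i\<le>j. if 0 < s 0 (int i) then s 0 (int i) else 1)"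
proof (induction j)
  case 0
  then show ?case using assms by (simp add: prodT_def inT_def)
next
  case (Suc j)
  have "phase 2 prodT (Suc j) s 2 (int j) = tval prodT (\<lambda>_. int j) (phase 2 prodT j s)"
    by (simp add: Let_def)
  moreover have "phase 2 prodT (Suc j) s 0 = s 0" by (rule phase_other) simp
  ultimately show ?case using Suc.IH
    unfolding prodT_def inT_def by (simp del: phase.simps)
qed


section \<open>The values computed on an encoded input\<close>

lemma length_concat_uniform:
  "(\<And>a. a \<in> set xs \<Longrightarrow> length (f a) = b) \<Longrightarrow> length (concat (map f xs)) = length xs * b"
  by (induction xs) auto

lemma nth_concat_uniform:
  "(\<And>a. a \<in> set xs \<Longrightarrow> length (f a) = b) \<Longrightarrow> i < length xs \<Longrightarrow> j < b \<Longrightarrow>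
     concat (map f xs) ! (i * b + j) = f (xs ! i) ! j"
proof (induction xs arbitrary: i)
  case (Cons a xs)
  show ?case
  proof (cases i)
    case 0
    then show ?thesis using Cons.prems by (simp add: nth_append)
  next
    case (Suc i')
    then have "concat (map f (a # xs)) ! (i * b + j) = concat (map f xs) ! (i' * b + j)"
      using Cons.prems(1)[of a] by (simp add: nth_append)
    then show ?thesis using Cons Suc by simp
  qed
qed simp

text \<open>This justifies finding the fractional values of a small job by counting the small jobs
  with smaller index.\<close>

lemma sorted_list_of_set_nth_card:
  assumes "finite A" "(a :: nat) \<in> A"
  shows "card {b \<in> A. b < a} < card A \<and> sorted_list_of_set A ! card {b \<in> A. b < a} = a"
proof -
  let ?xs = "sorted_list_of_set A"
  obtain t where t: "t < length ?xs" "?xs ! t = a"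
    using assms by (metis in_set_conv_nth set_sorted_list_of_set)
  have s: "sorted_wrt (<) ?xs" by simp
  have "{b \<in> A. b < a} = (!) ?xs ` {..<t}"
  proof
    show "(!) ?xs ` {..<t} \<subseteq> {b \<in> A. b < a}"
      using s t assms(1) by (auto simp: sorted_wrt_iff_nth_less)
        (metis length_sorted_list_of_set less_trans nth_mem set_sorted_list_of_set)
    show "{b \<in> A. b < a} \<subseteq> (!) ?xs ` {..<t}"
    proof clarify
      fix b assume b: "b \<in> A" "b < a"
      obtain u where u: "u < length ?xs" "?xs ! u = b"
        using assms b by (metis in_set_conv_nth set_sorted_list_of_set)
      have "u < t"
      proof (rule ccontr)
        assume "\<not> u < t"
        then consider "u = t" | "t < u" by linarith
        then have "a \<le> b"
          by cases (use t u sorted_wrt_nth_less[OF s, of t u] in auto)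
        with b show False by simp
      qed
      with u show "b \<in> (!) ?xs ` {..<t}" by auto
    qed
  qed
  moreover have "inj_on ((!) ?xs) {..<t}"
    using t by (auto simp: inj_on_def nth_eq_iff_index_eq)
  ultimately have "card {b \<in> A. b < a} = t" by (simp add: card_image)
  then show ?thesis using t assms by simp
qed

lemma card_least:
  "card {c. c < N \<and> (\<forall>c'\<le>c. \<not> P c')} = (if \<exists>c<N. P c then LEAST c. c < N \<and> P c else N)"
proof (cases "\<exists>c<N. P c")
  case True
  let ?l = "LEAST c. c < N \<and> P c"
  have l: "?l < N" "P ?l" using LeastI_ex[of "\<lambda>c. c < N \<and> P c"] True by auto
  have "{c. c < N \<and> (\<forall>c'\<le>c. \<not> P c')} = {..<?l}"
  proof (intro set_eqI iffI)
    fix c assume "c \<in> {c. c < N \<and> (\<forall>c'\<le>c. \<not> P c')}"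
    then have "\<not> ?l \<le> c" using l(2) by blast
    then show "c \<in> {..<?l}" by simp
  next
    fix c assume "c \<in> {..<?l}"
    then have c: "c < ?l" by simp
    have "\<not> P c'" if "c' \<le> c" for c'
      using not_less_Least[of c' "\<lambda>c. c < N \<and> P c"] that c l(1) by linarith
    then show "c \<in> {c. c < N \<and> (\<forall>c'\<le>c. \<not> P c')}" using c l(1) by simp
  qed
  then show ?thesis using True by simp
next
  case False
  then have "{c. c < N \<and> (\<forall>c'\<le>c. \<not> P c')} = {..<N}" by (auto dest: le_less_trans)
  then show ?thesis unfolding if_not_P[OF False] by simp
qed

lemma nth_middle: "k < length ys \<Longrightarrow> (xs @ ys @ zs) ! (length xs + k) = ys ! k"
  by (simp add: nth_append)

lemma encode_rat_simps [simp]: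
  "length (encode_rat q) = 2" "encode_rat q ! 0 = fst (quotient_of q)"
  "encode_rat q ! Suc 0 = snd (quotient_of q)"
  by (auto simp: encode_rat_def)

locale rounding_algorithm =
  fixes inp :: rounding_input
  assumes inp: "is_rounding_input inp"
begin

abbreviation "eps \<equiv> in_eps inp"
abbreviation "TT \<equiv> in_T inp"
abbreviation "I \<equiv> in_instance inp"
abbreviation "cs \<equiv> in_configs inp"

sublocale rounding eps TT I cs "in_x inp" "\<lambda>j c. of_rat (in_y inp j c)" "\<lambda>j c. of_rat (in_z inp j c)" .

section \<open>Layout of the encoding\<close>

definition "ls = sorted_list_of_set (large_sizes eps TT I)"
definition "js = sorted_list_of_set (small_jobs eps TT I)"
definition "enc = encode_input inp"
definition "L = length enc"
definition "blen = length ls + 5 + 4 * length js"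
definition "base c = 11 + 2 * n + 2 * length ls + c * blen"

definition "yz c j = encode_rat (in_y inp j c) @ encode_rat (in_z inp j c)"
definition "block c = encode_config ls c @ int (in_x inp c) # concat (map (yz c) js)"
definition "header = encode_rat eps @ encode_rat TT @
  [int n, int (num_machines I), int (batch_size I)] @ encode_rat (setup_time I)"

lemma enc_eq: "enc = header @ concat (map (\<lambda>j. encode_rat (job_size I j)) [0..<n]) @
    int (length ls) # concat (map encode_rat ls) @ int (length cs) # concat (map block cs)"
  by (simp add: enc_def encode_input_def encode_instance_def header_def block_def[abs_def] yz_def[abs_def] ls_def js_def
      n_def Let_def)

lemma setting: "rounded_setting eps TT I" and milp: "milp_feasible eps TT I (in_x inp)
    (\<lambda>j c. of_rat (in_y inp j c)) (\<lambda>j c. of_rat (in_z inp j c))"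
  and dist: "distinct cs" and set_cs: "set cs = feasible_configs eps TT I"
  using inp by (auto simp: is_rounding_input_def)

lemma pos: "eps > 0" "TT > 0"
proof -
  show "eps > 0" using setting by (auto simp: rounded_setting_def)
  then show "TT > 0" using setting by (auto simp: rounded_setting_def intro!: zero_less_power_int)
qed

lemma length_header: "length header = 9"
  by (simp add: header_def)

lemma length_sizes: "length (concat (map (\<lambda>j. encode_rat (job_size I j)) [0..<n])) = 2 * n"
  by (subst length_concat_uniform[where b = 2]) auto

lemma length_ls: "length (concat (map encode_rat ls)) = 2 * length ls"
  by (subst length_concat_uniform[where b = 2]) auto

lemma length_yz: "length (concat (map (yz c) js)) = 4 * length js"
  by (subst length_concat_uniform[where b = 4]) (auto simp: yz_def)

lemma length_block: "length (block c) = blen"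
  by (simp add: block_def blen_def encode_config_def length_yz)

lemma length_blocks: "length (concat (map block cs)) = length cs * blen"
  by (rule length_concat_uniform) (rule length_block)

lemma L_eq: "L = 11 + 2 * n + 2 * length ls + length cs * blen"
  by (simp add: L_def enc_eq length_header length_sizes length_ls length_blocks)

lemma L_bounds: "n < L" "length ls < L" "length cs < L" "0 < L" "4 < L"
proof -
  have "length cs * 1 \<le> length cs * blen" by (intro mult_le_mono2) (simp add: blen_def)
  then show "length cs < L" unfolding L_eq by linarith
qed (simp_all add: L_eq)

lemma enc_header: "i < 9 \<Longrightarrow> enc ! i = header ! i"
  by (simp add: enc_eq nth_append length_header)

lemma enc_size: "j < n \<Longrightarrow> i < 2 \<Longrightarrow> enc ! (9 + 2 * j + i) = encode_rat (job_size I j) ! i"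
proof -
  assume a: "j < n" "i < 2"
  let ?xs = "concat (map (\<lambda>j. encode_rat (job_size I j)) [0..<n])"
  have "enc ! (length header + (j * 2 + i)) = ?xs ! (j * 2 + i)"
    unfolding enc_eq by (rule nth_middle) (use a in \<open>simp add: length_sizes\<close>)
  also have "\<dots> = encode_rat (job_size I ([0..<n] ! j)) ! i"
    using a by (intro nth_concat_uniform) auto
  finally show ?thesis using a by (simp add: length_header mult.commute add.assoc)
qed

lemma enc_lam: "enc ! (9 + 2 * n) = int (length ls)"
  by (simp add: enc_eq nth_append length_header length_sizes)

lemma enc_ls: "l < length ls \<Longrightarrow> i < 2 \<Longrightarrow> enc ! (10 + 2 * n + 2 * l + i) = encode_rat (ls ! l) ! i"
proof -
  assume a: "l < length ls" "i < 2"
  let ?pre = "header @ concat (map (\<lambda>j. encode_rat (job_size I j)) [0..<n]) @ [int (length ls)]"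
  have "length ?pre = 10 + 2 * n" by (simp add: length_header length_sizes)
  moreover have "enc = ?pre @ concat (map encode_rat ls) @ int (length cs) # concat (map block cs)"
    by (simp add: enc_eq)
  moreover have "l * 2 + i < length (concat (map encode_rat ls))" using a by (simp add: length_ls)
  ultimately have "enc ! (10 + 2 * n + (l * 2 + i)) = concat (map encode_rat ls) ! (l * 2 + i)"
    by (metis nth_middle)
  also have "\<dots> = encode_rat (ls ! l) ! i" using a by (intro nth_concat_uniform) auto
  finally show ?thesis by (simp add: mult.commute add.assoc)
qed

lemma enc_Cn: "enc ! (10 + 2 * n + 2 * length ls) = int (length cs)"
  by (simp add: enc_eq nth_append length_header length_sizes length_ls)

lemma enc_block: "c < length cs \<Longrightarrow> i < blen \<Longrightarrow> enc ! (base c + i) = block (cs ! c) ! i"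
proof -
  assume a: "c < length cs" "i < blen"
  let ?pre = "header @ concat (map (\<lambda>j. encode_rat (job_size I j)) [0..<n]) @ int (length ls) #
    concat (map encode_rat ls) @ [int (length cs)]"
  have "length ?pre = 11 + 2 * n + 2 * length ls" by (simp add: length_header length_sizes length_ls)
  moreover have "enc = ?pre @ concat (map block cs) @ []"
    by (simp add: enc_eq)
  moreover have "c * blen + i < length (concat (map block cs))"
  proof -
    have "Suc c * blen \<le> length cs * blen" using a by (intro mult_le_mono1) simp
    then show ?thesis using a by (simp add: length_blocks)
  qed
  ultimately have "enc ! (11 + 2 * n + 2 * length ls + (c * blen + i)) = concat (map block cs) ! (c * blen + i)"
    by (metis nth_middle)
  also have "\<dots> = block (cs ! c) ! i" using a by (intro nth_concat_uniform length_block) auto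
  finally show ?thesis by (simp add: base_def add.assoc)
qed

lemma base_bound: "c < length cs \<Longrightarrow> i < blen \<Longrightarrow> base c + i < L"
proof -
  assume "c < length cs" "i < blen"
  then have "Suc c * blen \<le> length cs * blen" by (intro mult_le_mono1) simp
  then show ?thesis using \<open>i < blen\<close> by (simp add: base_def L_eq)
qed

lemma enc_alpha: "c < length cs \<Longrightarrow> l < length ls \<Longrightarrow> enc ! (base c + l) = int (alpha (cs ! c) (ls ! l))"
  by (simp add: enc_block blen_def block_def encode_config_def nth_append)

lemma enc_x: "c < length cs \<Longrightarrow> enc ! (base c + (length ls + 4)) = int (in_x inp (cs ! c))"
  by (subst enc_block) (auto simp: blen_def block_def encode_config_def nth_append)

lemma enc_yz: "c < length cs \<Longrightarrow> t < length js \<Longrightarrow> i < 4 \<Longrightarrow>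
    enc ! (base c + (length ls + 5 + 4 * t + i)) = yz (cs ! c) (js ! t) ! i"
proof -
  assume a: "c < length cs" "t < length js" "i < 4"
  have "enc ! (base c + (length ls + 5 + 4 * t + i)) = block (cs ! c) ! (length ls + 5 + 4 * t + i)"
    using a by (intro enc_block) (auto simp: blen_def)
  also have "\<dots> = concat (map (yz (cs ! c)) js) ! (t * 4 + i)"
    by (simp add: block_def encode_config_def nth_append mult.commute)
  also have "\<dots> = yz (cs ! c) (js ! t) ! i"
    using a by (intro nth_concat_uniform) (auto simp: yz_def)
  finally show ?thesis .
qed

text \<open>The store just before the input is overwritten. By \<open>main_fixpoint\<close> all
  arrays satisfy their defining equations in this one store, so the values below can be computed
  without intermediate stores.\<close>

definition "G = phases ((2, prodT) # main_phases) (init_store enc)"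

lemma G_0: "i < L \<Longrightarrow> G 0 (int i) = enc ! i"
proof -
  assume "i < L"
  have "G 0 = init_store enc 0"
    unfolding G_def by (rule phases_other) (auto simp: main_phases_def)
  then show ?thesis using \<open>i < L\<close> by (simp add: init_store_def L_def)
qed

lemma init_L: "init_store enc 1 0 = int L"
  by (simp add: init_store_def L_def)

lemma G_1: "G 1 0 = int L" "G (Suc 0) 0 = int L"
proof -
  have "G 1 = init_store enc 1"
    unfolding G_def by (rule phases_other) (auto simp: main_phases_def)
  then show "G 1 0 = int L" by (simp only: init_L)
  then show "G (Suc 0) 0 = int L" by simp
qed

lemma G_fix: "(a, t) \<in> set main_phases \<Longrightarrow> i < L \<Longrightarrow> G a (int i) = tval t (\<lambda>_. int i) G"
  unfolding G_def by (rule main_fixpoint) (auto simp: init_L simp del: One_nat_def)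

definition "D = (\<Prod>i<L. if 0 < enc ! i then enc ! i else 1)"

lemma D_pos: "D > 0" unfolding D_def by (rule prod_pos) auto

lemma D_dvd: "i < L \<Longrightarrow> enc ! i > 0 \<Longrightarrow> enc ! i dvd D"
  unfolding D_def by (rule dvd_trans[OF _ dvd_prodI[of _ i]]) auto

lemma G_2: "i < L \<Longrightarrow> G 2 (int i) = (\<Prod>i'\<le>i. if 0 < enc ! i' then enc ! i' else 1)"
proof -
  assume i: "i < L"
  have "G 2 (int i) = phase 2 prodT (nat (init_store enc 1 0)) (init_store enc) 2 (int i)"
    unfolding G_def phases.simps by (subst phases_other) (auto simp: main_phases_def)
  also have "\<dots> = tval prodT (\<lambda>_. int i) (phase 2 prodT i (init_store enc))"
    using i init_L by (subst phase_cell) simp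
  also have "\<dots> = (\<Prod>i'\<le>i. if 0 < init_store enc 0 (int i') then init_store enc 0 (int i') else 1)"
    by (rule prodT_value) (simp add: init_store_def)
  also have "\<dots> = (\<Prod>i'\<le>i. if 0 < enc ! i' then enc ! i' else 1)"
    using i by (intro prod.cong) (auto simp: init_store_def L_def)
  finally show ?thesis .
qed

lemma DT_val: "tval DT \<rho> G = D"
proof -
  obtain L' where L': "L = Suc L'" using L_bounds(4) by (cases L) auto
  have "tval DT \<rho> G = G 2 (int L - 1)" unfolding DT_def lenT_def by (simp add: G_1)
  also have "int L - 1 = int L'" using L' by simp
  also have "G 2 (int L') = (\<Prod>i\<le>L'. if 0 < enc ! i then enc ! i else 1)"
    by (rule G_2) (simp add: L')
  also have "\<dots> = D" unfolding D_def L' lessThan_Suc_atMost ..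
  finally show ?thesis .
qed

lemma of_rat_quotient: "(of_rat q :: real) = of_int (fst (quotient_of q)) / of_int (snd (quotient_of q))"
proof -
  have "q = of_int (fst (quotient_of q)) / of_int (snd (quotient_of q))" by (rule quotient_of_div) simp
  then have "(of_rat q :: real) = of_rat (of_int (fst (quotient_of q)) / of_int (snd (quotient_of q)))" by simp
  then show ?thesis by (simp add: of_rat_divide)
qed

text \<open>The denominator in lowest terms is a positive input entry and thus a factor of
  \<open>D\<close>, so the integer division in \<open>fracT\<close> is exact.\<close>

lemma frac_val:
  assumes "tval t \<rho> G = int i" "Suc i < L" "enc ! i = fst (quotient_of q)" "enc ! Suc i = snd (quotient_of q)"
  shows "real_of_int (tval (fracT t) \<rho> G) = of_rat q * real_of_int D"
proof -
  let ?b = "snd (quotient_of q)"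
  have b: "?b > 0" by (simp add: quotient_of_denom_pos')
  then have d: "?b dvd D" using D_dvd[of "Suc i"] assms by simp
  have "G 0 (int i + 1) = enc ! Suc i" using G_0[OF assms(2)] by (simp add: add.commute)
  then have "tval (fracT t) \<rho> G = fst (quotient_of q) * (D div ?b)"
    using assms G_0[of i] by (simp add: fracT_def inT_def DT_val)
  then show ?thesis using b d by (simp add: of_rat_quotient real_of_int_div)
qed

section \<open>Values of the terms in this store\<close>

lemma nT_val: "tval nT \<rho> G = int n"
  using G_0[of 4] L_bounds by (simp add: nT_def inT_def enc_header header_def encode_rat_def)

lemma lamT_val: "tval lamT \<rho> G = int (length ls)"
proof -
  have "9 + 2 * int n = int (9 + 2 * n)" by simp
  then show ?thesis using G_0[of "9 + 2 * n"] L_eq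
    by (simp add: lamT_def inT_def nT_val enc_lam)
qed

lemma CnT_val: "tval CnT \<rho> G = int (length cs)"
proof -
  have "10 + (2 * int n + 2 * int (length ls)) = int (10 + 2 * n + 2 * length ls)" by simp
  then show ?thesis using G_0[of "10 + 2 * n + 2 * length ls"] L_eq
    unfolding enc_Cn by (simp add: CnT_def inT_def nT_val lamT_val add.assoc)
qed

lemma size_val: "j < n \<Longrightarrow> real_of_int (G 3 (int j)) = of_rat (job_size I j) * real_of_int D"
proof -
  assume j: "j < n"
  have "G 3 (int j) = tval sizeT (\<lambda>_. int j) G"
    using L_bounds j by (intro G_fix) (auto simp: main_phases_def)
  then show ?thesis
    unfolding sizeT_def using j L_eq enc_size[of j 0] enc_size[of j 1]
    by (simp only:) (rule frac_val[where i = "9 + 2 * j"]; simp)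
qed

lemma size_less: "i < n \<Longrightarrow> j < n \<Longrightarrow> G 3 (int i) < G 3 (int j) \<longleftrightarrow> job_size I i < job_size I j"
proof -
  assume "i < n" "j < n"
  then have "real_of_int (G 3 (int i)) < real_of_int (G 3 (int j)) \<longleftrightarrow> job_size I i < job_size I j"
    using D_pos by (simp add: size_val of_rat_less)
  then show ?thesis by simp
qed

lemma size_eq: "i < n \<Longrightarrow> j < n \<Longrightarrow> G 3 (int i) = G 3 (int j) \<longleftrightarrow> job_size I i = job_size I j"
  using size_less[of i j] size_less[of j i] by (metis less_irrefl linorder_neqE)

lemma pos_quotient: "(of_rat q :: real) * of_int (snd (quotient_of q)) = of_int (fst (quotient_of q))"
  using quotient_of_denom_pos'[of q] by (simp add: of_rat_quotient)

lemma smallT_val: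
  assumes "tval t \<rho> G = int j" "j < n"
  shows "tval (smallT t) \<rho> G = of_bool (job_size I j < eps * TT)"
proof -
  let ?e = "snd (quotient_of eps)" and ?t = "snd (quotient_of TT)"
  have h: "G 0 0 = fst (quotient_of eps)" "G 0 1 = ?e" "G 0 2 = fst (quotient_of TT)" "G 0 3 = ?t"
    using G_0[of 0] G_0[of 1] G_0[of 2] G_0[of 3] L_bounds
    by (simp_all add: enc_header header_def encode_rat_def)
  have p: "real_of_int ?e * real_of_int ?t * real_of_int D > 0"
    using D_pos by (simp add: quotient_of_denom_pos')
  have "G 3 (int j) * (?e * ?t) < fst (quotient_of eps) * fst (quotient_of TT) * D \<longleftrightarrow>
     real_of_int (G 3 (int j) * (?e * ?t)) < real_of_int (fst (quotient_of eps) * fst (quotient_of TT) * D)"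
    by (simp only: of_int_less_iff)
  also have "\<dots> \<longleftrightarrow> of_rat (job_size I j) * (real_of_int ?e * real_of_int ?t * real_of_int D) <
      of_rat (eps * TT) * (real_of_int ?e * real_of_int ?t * real_of_int D)"
    by (simp add: size_val assms pos_quotient[symmetric] of_rat_mult mult_ac)
  also have "\<dots> \<longleftrightarrow> job_size I j < eps * TT"
    using p by (simp only: mult_less_cancel_right_pos of_rat_less)
  finally show ?thesis using assms by (simp add: smallT_def inT_def pT_def h DT_val)
qed

lemma rank_val: "j < n \<Longrightarrow> G 4 (int j) = int (rank (job_size I) n j)"
proof -
  assume j: "j < n"
  have "G 4 (int j) = tval rankT (\<lambda>_. int j) G"
    using L_bounds j by (intro G_fix) (auto simp: main_phases_def)
  also have "\<dots> = (\<Sum>i<L. of_bool (i < n \<and> before (job_size I) i j))"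
    unfolding rankT_def tval.simps(5) G_1 nat_int
  proof (rule sum.cong[OF refl])
    fix i
    show "tval (mulT (ltT (Var 1) nT) (addT (ltT (pT (Var 0)) (pT (Var 1)))
        (mulT (eqT (pT (Var 1)) (pT (Var 0))) (ltT (Var 1) (Var 0))))) ((\<lambda>_. int j)(1 := int i)) G =
        of_bool (i < n \<and> before (job_size I) i j)"
      using j by (cases "i < n") (auto simp: nT_val pT_def before_def size_less size_eq)
  qed
  also have "\<dots> = int (card {i. i < L \<and> i < n \<and> before (job_size I) i j})" by (rule sum_of_bool_card)
  also have "{i. i < L \<and> i < n \<and> before (job_size I) i j} = {i. i < n \<and> before (job_size I) i j}"
    using L_bounds by auto
  finally show ?thesis by (simp add: rank_def)
qed

lemma ord_less: "r < n \<Longrightarrow> ord r < n"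
  by (simp add: ord_def ranked_less)

lemma ord_val: "r < n \<Longrightarrow> G 5 (int r) = int (ord r)"
proof -
  assume r: "r < n"
  have "G 5 (int r) = tval ordT (\<lambda>_. int r) G"
    using L_bounds r by (intro G_fix) (auto simp: main_phases_def)
  also have "\<dots> = (\<Sum>j<L. of_bool (j < n \<and> j = ord r) * int j)"
    unfolding ordT_def tval.simps(5) G_1 nat_int
  proof (rule sum.cong[OF refl])
    fix j
    have "rank (job_size I) n j = r \<longleftrightarrow> j = ord r" if "j < n"
      unfolding ord_def using rank_ranked[OF r] ranked_rank[OF that] by metis
    then show "tval (mulT (mulT (ltT (Var 1) nT) (eqT (Arr 4 (Var 1)) (Var 0))) (Var 1)) ((\<lambda>_. int r)(1 := int j)) G =
        of_bool (j < n \<and> j = ord r) * int j"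
      by (cases "j < n") (auto simp: nT_val rank_val)
  qed
  also have "\<dots> = (\<Sum>j | j < L \<and> j < n \<and> j = ord r. int j)" by (rule sum_of_bool_mult)
  also have "{j. j < L \<and> j < n \<and> j = ord r} = {ord r}" using ord_less[OF r] L_bounds by auto
  finally show ?thesis by simp
qed

lemma sidx_val: "j \<le> n \<Longrightarrow> G 6 (int j) = int (card {i \<in> small_jobs eps TT I. i < j})"
proof -
  assume j: "j \<le> n"
  have "G 6 (int j) = tval sidxT (\<lambda>_. int j) G"
    using L_bounds j by (intro G_fix) (auto simp: main_phases_def)
  also have "\<dots> = (\<Sum>i<L. of_bool (i < n \<and> i < j \<and> job_size I i < eps * TT))"
    unfolding sidxT_def tval.simps(5) G_1 nat_int
  proof (rule sum.cong[OF refl])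
    fix i
    show "tval (mulT (mulT (ltT (Var 1) nT) (ltT (Var 1) (Var 0))) (smallT (Var 1))) ((\<lambda>_. int j)(1 := int i)) G =
        of_bool (i < n \<and> i < j \<and> job_size I i < eps * TT)"
      by (cases "i < n") (auto simp: nT_val smallT_val[where j = i])
  qed
  also have "\<dots> = int (card {i. i < L \<and> i < n \<and> i < j \<and> job_size I i < eps * TT})" by (rule sum_of_bool_card)
  also have "{i. i < L \<and> i < n \<and> i < j \<and> job_size I i < eps * TT} = {i \<in> small_jobs eps TT I. i < j}"
    using L_bounds by (auto simp: small_jobs_def jobs_def n_def)
  finally show ?thesis .
qed

lemma finite_small: "finite (small_jobs eps TT I)"
  by (simp add: small_jobs_def jobs_def)

lemma base_val: "c < L \<Longrightarrow> G 7 (int c) = int (base c)"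
proof -
  assume c: "c < L"
  have "{i \<in> small_jobs eps TT I. i < n} = small_jobs eps TT I"
    by (auto simp: small_jobs_def jobs_def n_def)
  then have "G 6 (int n) = int (length js)" using sidx_val[of n] by (simp add: js_def)
  moreover have "G 7 (int c) = tval baseT (\<lambda>_. int c) G"
    using c by (intro G_fix) (auto simp: main_phases_def)
  ultimately show ?thesis
    by (simp add: baseT_def nT_val lamT_val base_def blen_def)
qed

lemma xT_val: "tval t \<rho> G = int c \<Longrightarrow> c < length cs \<Longrightarrow> tval (xT t) \<rho> G = int (in_x inp (cs ! c))"
proof -
  assume a: "tval t \<rho> G = int c" "c < length cs"
  have "base c + (length ls + 4) < L" using a by (intro base_bound) (auto simp: blen_def)
  from G_0[OF this] show ?thesis
    using a L_bounds enc_x by (simp add: xT_def inT_def base_val lamT_val)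
qed

lemma small_ord: "r < n \<Longrightarrow> small r \<longleftrightarrow> ord r \<in> small_jobs eps TT I"
  using ord_less[of r] by (auto simp: small_def small_jobs_def jobs_def n_def)

lemma wT_val:
  assumes "tval rt \<rho> G = int r" "r < n" "small r" "tval ct \<rho> G = int c" "c < length cs"
  shows "real_of_int (tval (wT rt ct) \<rho> G) =
    (of_rat (in_y inp (ord r) (cs ! c)) + of_rat (in_z inp (ord r) (cs ! c))) * real_of_int D"
proof -
  define t where "t = card {i \<in> small_jobs eps TT I. i < ord r}"
  have t: "t < length js" "js ! t = ord r"
    using sorted_list_of_set_nth_card[OF finite_small, of "ord r"] assms
    by (auto simp: small_ord js_def t_def)
  define i where "i = base c + (length ls + 5 + 4 * t)"
  have i: "i + i' < L" if "i' < 4" for i'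
  proof -
    have "base c + (length ls + 5 + 4 * t + i') < L"
      using t assms that by (intro base_bound) (auto simp: blen_def)
    then show ?thesis by (simp add: i_def)
  qed
  have e: "enc ! (i + i') = yz (cs ! c) (ord r) ! i'" if "i' < 4" for i'
    using enc_yz[OF assms(5) t(1) that] t(2) by (simp add: i_def add.assoc)
  have "G 6 (int (ord r)) = int t" using sidx_val[of "ord r"] ord_less[OF assms(2)] by (simp add: t_def)
  then have b: "tval (addT (addT (Arr 7 ct) (addT lamT (Num 5))) (mulT (Num 4) (Arr 6 (ord_of rt)))) \<rho> G = int i"
    (is "tval ?b \<rho> G = _")
    using assms L_bounds by (simp add: base_val lamT_val ord_of_def ord_val i_def)
  have "real_of_int (tval (fracT ?b) \<rho> G) = of_rat (in_y inp (ord r) (cs ! c)) * real_of_int D"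
    by (rule frac_val[OF b]) (use i[of 1] e[of 0] e[of 1] in \<open>auto simp: yz_def nth_append\<close>)
  moreover have "real_of_int (tval (fracT (addT ?b (Num 2))) \<rho> G) = of_rat (in_z inp (ord r) (cs ! c)) * real_of_int D"
    by (rule frac_val[where i = "i + 2"])
      (use b i[of 3] e[of 2] e[of 3] in \<open>auto simp: yz_def nth_append numeral_3_eq_3\<close>)
  ultimately show ?thesis by (simp add: wT_def Let_def distrib_right)
qed

lemma smallT_ord: "tval t \<rho> G = int r \<Longrightarrow> r < n \<Longrightarrow> tval (smallT (ord_of t)) \<rho> G = of_bool (small r)"
  unfolding small_def by (rule smallT_val) (auto simp: ord_of_def ord_val ord_less)

lemma sameT_val:
  assumes "tval s \<rho> G = int r'" "tval t \<rho> G = int r" "r' < n" "r < n"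
  shows "tval (sameT s t) \<rho> G = of_bool (same r' r)"
proof -
  have "tval (eqT (pT (ord_of s)) (pT (ord_of t))) \<rho> G = of_bool (job_size I (ord r') = job_size I (ord r))"
    using assms by (simp add: pT_def ord_of_def ord_val size_eq ord_less)
  then show ?thesis
    using smallT_ord[OF assms(1,3)] smallT_ord[OF assms(2,4)]
    by (cases "small r"; cases "small r'") (simp_all add: sameT_def same_def)
qed

definition "cf r = nat (G 8 (int r))"

lemma cf_val: "r < L \<Longrightarrow> G 8 (int r) = int (cf r)"
proof -
  assume r: "r < L"
  have "G 8 (int r) = tval pickT (\<lambda>_. int r) G"
    using r by (intro G_fix) (auto simp: main_phases_def)
  also have "\<dots> \<ge> 0" unfolding pickT_def tval_count by simp
  finally show ?thesis by (simp add: cf_def)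
qed

text \<open>The hypotheses for all \<open>i\<close> say that \<open>rt\<close> and \<open>ct\<close>
  are not affected by the bound variable \<open>v\<close>, which rules out capture.\<close>

lemma cntT_val:
  assumes "\<And>i. tval rt (\<rho>(v := int i)) G = int r" "\<And>i. tval ct (\<rho>(v := int i)) G = int c" "r < n"
  shows "tval (cntT rt ct v) \<rho> G = int (cnt cf r c)"
proof -
  have "tval (cntT rt ct v) \<rho> G = (\<Sum>i<L. of_bool (i < r \<and> same i r \<and> cf i = c))"
    unfolding cntT_def tval.simps(5) G_1 nat_int
  proof (rule sum.cong[OF refl])
    fix i
    show "tval (mulT (mulT (ltT (Var v) rt) (sameT (Var v) rt)) (eqT (Arr 8 (Var v)) ct)) (\<rho>(v := int i)) G =
        of_bool (i < r \<and> same i r \<and> cf i = c)"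
      using assms L_bounds by (cases "i < r") (auto simp: sameT_val[where r' = i and r = r] cf_val)
  qed
  also have "\<dots> = int (card {i. i < L \<and> i < r \<and> same i r \<and> cf i = c})" by (rule sum_of_bool_card)
  also have "{i. i < L \<and> i < r \<and> same i r \<and> cf i = c} = {i. i < r \<and> same i r \<and> cf i = c}"
    using assms L_bounds by auto
  finally show ?thesis by (simp add: cnt_def)
qed

text \<open>The list of large sizes is distinct and contains the size of the job, so exactly one
  index matches.\<close>

lemma alpha_val:
  assumes "r < n" "\<not> small r" "c < length cs"
    "\<And>i. tval rt (\<rho>(v := int i)) G = int r" "\<And>i. tval ct (\<rho>(v := int i)) G = int c"
  shows "tval (Sum v (mulT (mulT (ltT (Var v) lamT)
           (eqT (fracT (addT (addT (Num 10) (mulT (Num 2) nT)) (mulT (Num 2) (Var v)))) (pT (ord_of rt))))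
         (inT (addT (Arr 7 ct) (Var v))))) \<rho> G = int (alpha (cs ! c) (job_size I (ord r)))"
    (is "tval (Sum v ?t) \<rho> G = int (alpha _ ?l)")
proof -
  have "tval (Sum v ?t) \<rho> G = (\<Sum>i<L. of_bool (i < length ls \<and> ls ! i = ?l) * enc ! (base c + i))"
    unfolding tval.simps(5) G_1 nat_int
  proof (rule sum.cong[OF refl])
    fix i
    let ?f = "fracT (addT (addT (Num 10) (mulT (Num 2) nT)) (mulT (Num 2) (Var v)))"
    show "tval ?t (\<rho>(v := int i)) G = of_bool (i < length ls \<and> ls ! i = ?l) * enc ! (base c + i)"
    proof (cases "i < length ls")
      case True
      have "real_of_int (tval ?f (\<rho>(v := int i)) G) = of_rat (ls ! i) * real_of_int D"
        by (rule frac_val[where i = "10 + 2 * n + 2 * i"])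
          (use True L_eq enc_ls[of i 0] enc_ls[of i 1] in \<open>auto simp: nT_val\<close>)
      moreover have "real_of_int (G 3 (int (ord r))) = of_rat ?l * real_of_int D"
        by (rule size_val) (rule ord_less[OF assms(1)])
      ultimately have "real_of_int (tval ?f (\<rho>(v := int i)) G) = real_of_int (G 3 (int (ord r))) \<longleftrightarrow> ls ! i = ?l"
        using D_pos by simp
      then have eq: "tval ?f (\<rho>(v := int i)) G = G 3 (int (ord r)) \<longleftrightarrow> ls ! i = ?l"
        by (simp only: of_int_eq_iff)
      have "base c + i < L" using True assms by (intro base_bound) (auto simp: blen_def)
      from G_0[OF this] have "G 0 (int (base c) + int i) = enc ! (base c + i)" by simp
      then show ?thesis
        using True assms L_bounds
        by (simp add: lamT_val pT_def ord_of_def ord_val inT_def base_val eq)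
    next
      case False
      then show ?thesis by (simp add: lamT_val)
    qed
  qed
  also have "\<dots> = (\<Sum>i | i < L \<and> i < length ls \<and> ls ! i = ?l. enc ! (base c + i))" by (rule sum_of_bool_mult)
  also have "\<dots> = int (alpha (cs ! c) ?l)"
  proof -
    have "finite (large_sizes eps TT I)" by (simp add: large_sizes_def large_jobs_def jobs_def)
    moreover have "?l \<in> large_sizes eps TT I"
      using assms(1,2) ord_less[of r] by (auto simp: large_sizes_def large_jobs_def jobs_def small_def n_def)
    ultimately have "?l \<in> set ls" "distinct ls" by (auto simp: ls_def)
    then obtain i where i: "i < length ls" "ls ! i = ?l" by (auto simp: in_set_conv_nth)
    have uniq: "i' = i" if "i' < length ls" "ls ! i' = ?l" for i'
      using nth_eq_iff_index_eq[OF \<open>distinct ls\<close> that(1) i(1)] i(2) that(2) by simp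
    have "{i. i < L \<and> i < length ls \<and> ls ! i = ?l} = {i}"
      using uniq i less_trans[OF i(1) L_bounds(2)] by blast
    then have "(\<Sum>i | i < L \<and> i < length ls \<and> ls ! i = ?l. enc ! (base c + i)) = enc ! (base c + i)"
      by (simp only: sum.insert finite.emptyI empty_iff sum.empty) simp
    then show ?thesis unfolding enc_alpha[OF assms(3) i(1)] i(2) .
  qed
  finally show ?thesis .
qed

lemma demT_val:
  assumes "r < n" "c < length cs" "\<And>i. tval rt (\<rho>(v := int i)) G = int r" "\<And>i. tval ct (\<rho>(v := int i)) G = int c"
    "tval rt \<rho> G = int r" "tval ct \<rho> G = int c"
  shows "real_of_int (tval (demT rt ct v) \<rho> G) = dem r c * real_of_int D"
proof (cases "small r")
  case True
  let ?t = "mulT (mulT (leT (Var v) rt) (smallT (ord_of (Var v)))) (wT (Var v) ct)"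
  have "tval (demT rt ct v) \<rho> G = tval (Sum v ?t) \<rho> G"
    using True assms by (simp add: demT_def smallT_ord del: tval.simps(5))
  also have "\<dots> = (\<Sum>i<L. of_bool (i \<le> r \<and> small i) * tval (wT (Var v) ct) (\<rho>(v := int i)) G)"
    unfolding tval.simps(5) G_1 nat_int
  proof (rule sum.cong[OF refl])
    fix i
    show "tval ?t (\<rho>(v := int i)) G = of_bool (i \<le> r \<and> small i) * tval (wT (Var v) ct) (\<rho>(v := int i)) G"
      using assms by (cases "i \<le> r") (auto simp: smallT_ord[where r = i])
  qed
  also have "\<dots> = (\<Sum>i | i < L \<and> i \<le> r \<and> small i. tval (wT (Var v) ct) (\<rho>(v := int i)) G)"
    by (rule sum_of_bool_mult)
  finally have "real_of_int (tval (demT rt ct v) \<rho> G) =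
      (\<Sum>i | i < L \<and> i \<le> r \<and> small i. real_of_int (tval (wT (Var v) ct) (\<rho>(v := int i)) G))" by simp
  also have "\<dots> = (\<Sum>i | i \<le> r \<and> small i.
      (of_rat (in_y inp (ord i) (cs ! c)) + of_rat (in_z inp (ord i) (cs ! c))) * real_of_int D)"
    using assms L_bounds by (intro sum.cong wT_val) auto
  finally show ?thesis using True by (simp add: dem_def sum_distrib_right)
next
  case False
  then show ?thesis
    using assms alpha_val[OF assms(1) False assms(2), of rt \<rho> v ct]
    by (simp add: demT_def smallT_ord dem_def DT_val xT_val del: tval.simps(5))
qed

lemma availT_val:
  assumes "r < n" "c < length cs" "\<And>i. tval rt (\<rho>(v := int i)) G = int r" "\<And>i. tval ct (\<rho>(v := int i)) G = int c"
    "tval rt \<rho> G = int r" "tval ct \<rho> G = int c"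
  shows "tval (availT rt ct v) \<rho> G = of_bool (avail cf r c)"
proof -
  have "D * int (cnt cf r c) < tval (demT rt ct v) \<rho> G \<longleftrightarrow>
      real_of_int (D * int (cnt cf r c)) < real_of_int (tval (demT rt ct v) \<rho> G)"
    by (simp only: of_int_less_iff)
  also have "\<dots> \<longleftrightarrow> real (cnt cf r c) < dem r c"
    using D_pos by (simp add: demT_val[OF assms] mult.commute[of "real_of_int D"])
  finally show ?thesis
    using assms by (simp add: availT_def xT_val DT_val cntT_val avail_def)
qed

text \<open>The link between program and analysis: the contents of array 8 solve the recursion, so
  \<open>rounding_run\<close> can be instantiated with them.\<close>

lemma cf_pick: "r < n \<Longrightarrow> cf r = pick cf r"
proof -
  assume r: "r < n"
  let ?\<rho> = "\<lambda>i. (\<lambda>_. int r)(1 := int i)"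
  have inner: "tval (Sum 2 (mulT (leT (Var 2) (Var 1)) (availT (Var 0) (Var 2) 3))) (?\<rho> i) G =
     int (card {c. c < L \<and> c \<le> i \<and> avail cf r c})" if i: "i < length cs" for i
  proof -
    have "tval (Sum 2 (mulT (leT (Var 2) (Var 1)) (availT (Var 0) (Var 2) 3))) (?\<rho> i) G =
      (\<Sum>c<L. of_bool (c \<le> i \<and> avail cf r c))"
      unfolding tval.simps(5) G_1 nat_int
    proof (rule sum.cong[OF refl])
      fix c
      show "tval (mulT (leT (Var 2) (Var 1)) (availT (Var 0) (Var 2) 3)) ((?\<rho> i)(2 := int c)) G =
          of_bool (c \<le> i \<and> avail cf r c)"
        using i r by (cases "c \<le> i") (auto simp: availT_val[where r = r and c = c])
    qed
    then show ?thesis by (simp only: sum_of_bool_card)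
  qed
  have "int (cf r) = tval pickT (\<lambda>_. int r) G"
    using r L_bounds cf_val[of r] G_fix[of 8 pickT r] by (simp add: main_phases_def)
  also have "\<dots> = int (card {c. c < length cs \<and> (\<forall>c'\<le>c. \<not> avail cf r c')})"
  proof -
    have *: "c < nat (G 1 0) \<and> tval (Var 1) (?\<rho> c) G < tval CnT (?\<rho> c) G \<and>
      tval (Sum 2 (mulT (leT (Var 2) (Var 1)) (availT (Var 0) (Var 2) 3))) (?\<rho> c) G < tval (Num 1) (?\<rho> c) G
      \<longleftrightarrow> c < length cs \<and> (\<forall>c'\<le>c. \<not> avail cf r c')" for c
    proof (cases "c < length cs")
      case True
      have "card {c'. c' < L \<and> c' \<le> c \<and> avail cf r c'} < 1 \<longleftrightarrow> (\<forall>c'\<le>c. \<not> avail cf r c')"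
        using True L_bounds by auto
      moreover have "c < L" using True L_bounds by simp
      ultimately show ?thesis using True inner[OF True]
        by (simp add: CnT_val G_1 del: tval.simps(5))
    qed (simp add: CnT_val)
    show ?thesis unfolding pickT_def tval_count * ..
  qed
  finally show ?thesis by (simp add: card_least pick_def)
qed

lemma mach_val: "r < n \<Longrightarrow> G 9 (int r) = int (mach cf r)"
proof -
  assume r: "r < n"
  let ?c = "Arr 8 (Var 0)"
  have rL: "r < L" using r L_bounds by simp
  have cv: "tval ?c \<rho> G = int (cf r)" if "\<rho> 0 = int r" for \<rho>
    using that cf_val[OF rL] by simp
  have "G 9 (int r) = tval machT (\<lambda>_. int r) G"
    using rL by (intro G_fix) (auto simp: main_phases_def)
  also have "\<dots> = int (mach cf r)"
  proof (cases "cf r < length cs")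
    case False
    then show ?thesis by (simp add: machT_def Let_def CnT_val mach_def cf_val[OF rL] del: tval.simps(5))
  next
    case True
    have "tval (Sum 1 (mulT (ltT (Var 1) ?c) (xT (Var 1)))) (\<lambda>_. int r) G =
       (\<Sum>c<L. of_bool (c < cf r) * int (in_x inp (cs ! c)))"
      unfolding tval.simps(5) G_1 nat_int
    proof (rule sum.cong[OF refl])
      fix c
      show "tval (mulT (ltT (Var 1) ?c) (xT (Var 1))) ((\<lambda>_. int r)(1 := int c)) G =
          of_bool (c < cf r) * int (in_x inp (cs ! c))"
        using True cf_val[OF rL] by (cases "c < cf r") (auto simp: xT_val[where c = c])
    qed
    also have "\<dots> = (\<Sum>c | c < L \<and> c < cf r. int (in_x inp (cs ! c)))" by (rule sum_of_bool_mult)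
    also have "\<dots> = int (off (cf r))"
      using True L_bounds unfolding off_def of_nat_sum by (intro sum.cong) auto
    finally have off: "tval (Sum 1 (mulT (ltT (Var 1) ?c) (xT (Var 1)))) (\<lambda>_. int r) G = int (off (cf r))" .
    have q: "tval (cntT (Var 0) ?c 1) (\<lambda>_. int r) G = int (cnt cf r (cf r))"
      by (rule cntT_val) (use r cv in auto)
    have x: "tval (xT ?c) (\<lambda>_. int r) G = int (in_x inp (cs ! cf r))"
      by (rule xT_val) (use True cv in auto)
    have m: "int a - int b * (int a div int b) = int (a mod b)" for a b
      by (simp add: minus_mult_div_eq_mod zmod_int)
    have "tval ?c (\<lambda>_. int r) G = int (cf r)" by (rule cv) simp
    then show ?thesis using True
      by (simp add: machT_def Let_def CnT_val off q x m mach_def del: tval.simps One_nat_def)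
  qed
  finally show ?thesis .
qed

end


section \<open>Existence and computation of the schedule\<close>

lemma schedule_exists:
  fixes \<epsilon> T :: rat and y z :: "nat \<Rightarrow> config \<Rightarrow> real"
  assumes "rounded_setting \<epsilon> T I" "milp_feasible \<epsilon> T I x y z"
  shows "\<exists>\<sigma>. is_schedule I \<sigma> \<and> makespan I \<sigma> \<le> (1 + 3 * \<epsilon>) * T"
proof -
  obtain cs where cs: "set cs = feasible_configs \<epsilon> T I" "distinct cs"
    using finite_distinct_list[OF finite_feasible_configs[OF assms(1)]] by blast
  obtain cf where "\<forall>r. cf r = rounding.pick \<epsilon> T I cs x y z cf r" using rounding.ex_pick by blast
  then interpret rounding_run \<epsilon> T I cs x y z cf by unfold_locales (use assms cs in auto)
  show ?thesis using sched_is_schedule makespan_bound by blast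
qed

context rounding_algorithm
begin

interpretation run: rounding_run eps TT I cs "in_x inp" "\<lambda>j c. of_rat (in_y inp j c)"
    "\<lambda>j c. of_rat (in_z inp j c)" cf
  by unfold_locales (use setting milp dist set_cs cf_pick in auto)

section \<open>The output of the program\<close>

definition "out = map (\<lambda>j. int (mach cf (rank (job_size I) n j))) [0..<n]"

lemma schedule_out: "schedule_of_list out = run.sched"
proof
  fix i
  have "schedule_of_list out i = {j. j < n \<and> mach cf (rank (job_size I) n j) = i}"
    by (auto simp: schedule_of_list_def out_def)
  also have "\<dots> = run.sched i"
  proof (intro set_eqI iffI)
    fix j assume "j \<in> {j. j < n \<and> mach cf (rank (job_size I) n j) = i}"
    then show "j \<in> run.sched i"
      unfolding run.sched_def ord_def
      by (intro image_eqI[of _ _ "rank (job_size I) n j"]) (auto simp: ranked_rank rank_less_n)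
  next
    fix j assume "j \<in> run.sched i"
    then show "j \<in> {j. j < n \<and> mach cf (rank (job_size I) n j) = i}"
      by (auto simp: run.sched_def ord_def rank_ranked ranked_less)
  qed
  finally show "schedule_of_list out i = run.sched i" .
qed

lemma out_correct:
  "length out = num_jobs I" "is_schedule I (schedule_of_list out)"
  "makespan I (schedule_of_list out) \<le> (1 + 3 * eps) * TT"
  unfolding schedule_out using run.sched_is_schedule run.makespan_bound by (auto simp: out_def n_def)

lemma phases_out:
  "phases ((2, prodT) # main_phases @ [(0, outT)]) (init_store enc) = phase 0 outT L G"
proof -
  have "phases (((2, prodT) # main_phases) @ [(0, outT)]) (init_store enc) = phases [(0, outT)] G"
    by (simp only: phases_append G_def)
  then show ?thesis by (simp only: append_Cons phases.simps(1) phases.simps(2)[of 0 outT] G_1 nat_int)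
qed

lemma output_length:
  assumes "\<And>b. b \<noteq> tmp \<Longrightarrow> s b = phases ((2, prodT) # main_phases @ [(0, outT)]) (init_store enc) b"
  shows "s 10 0 = int n"
proof -
  have "s 10 = G 10" using assms[of 10] unfolding phases_out by (simp add: phase_other)
  then show ?thesis
    using G_fix[of 10 nT 0] L_bounds by (simp add: main_phases_def nT_val)
qed

text \<open>Cell 0 of array 1 must keep the input length during the phases, as it bounds all loops;
  the update models the final assignment, which replaces it by the saved number of jobs.\<close>

lemma output_eq:
  assumes "\<And>b. b \<noteq> tmp \<Longrightarrow> s b = phases ((2, prodT) # main_phases @ [(0, outT)]) (init_store enc) b"
  shows "output_list (s(1 := (s 1)(0 := s 10 0))) = out"
proof -
  have n: "s 10 0 = int n" by (rule output_length[OF assms])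
  have o: "s 0 (int j) = int (mach cf (rank (job_size I) n j))" if j: "j < n" for j
  proof -
    have "s 0 (int j) = tval outT (\<lambda>_. int j) (phase 0 outT j G)"
      using assms[of 0] j L_bounds(1) unfolding phases_out by (simp add: phase_cell[of 0])
    also have "\<dots> = G 9 (G 4 (int j))" by (simp add: outT_def phase_other)
    finally show ?thesis using j by (simp add: rank_val mach_val rank_less_n)
  qed
  show ?thesis by (simp add: output_list_def out_def n o)
qed

section \<open>Bit-length bounds for an encoded input\<close>

lemma sum_bits: "(\<Sum>i<L. bits (enc ! i)) = encoding_length enc"
  by (simp add: encoding_length_def sum_list_sum_nth atLeast0LessThan L_def)

lemma L_le: "L \<le> encoding_length enc"
proof -
  have "(\<Sum>i<L. 1) \<le> (\<Sum>i<L. bits (enc ! i))" by (rule sum_mono) (simp add: bits_def)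
  then show ?thesis by (simp add: sum_bits)
qed

lemma L_le_pow: "int L \<le> 2 ^ encoding_length enc"
proof -
  have "int (encoding_length enc) < int (2 ^ encoding_length enc)"
    unfolding of_nat_less_iff by (rule less_exp)
  also have "int (2 ^ encoding_length enc) = 2 ^ encoding_length enc" by simp
  finally show ?thesis using L_le by linarith
qed

lemma enc_bound: "i < L \<Longrightarrow> \<bar>enc ! i\<bar> \<le> 2 ^ encoding_length enc"
proof -
  assume "i < L"
  then have "bits (enc ! i) \<le> (\<Sum>i<L. bits (enc ! i))" by (intro member_le_sum) auto
  then show ?thesis using abs_le_pow_bits[of "enc ! i"] pow2_int_mono unfolding sum_bits by blast
qed

lemma init_bounded: "bounded_store (encoding_length enc) (init_store enc)"
proof -
  have "encoding_length enc \<ge> 1" using L_le L_bounds(4) by linarith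
  moreover have "\<bar>init_store enc a i\<bar> \<le> 2 ^ encoding_length enc" for a i
  proof -
    consider "a = 0" "0 \<le> i" "i < int L" "init_store enc a i = enc ! nat i"
      | "init_store enc a i = int L" | "init_store enc a i = 0"
      unfolding init_store_def L_def by presburger
    then show ?thesis
    proof cases
      case 1
      then show ?thesis using enc_bound[of "nat i"] by (simp add: nat_less_iff)
    next
      case 2
      then show ?thesis using L_le_pow by simp
    qed simp
  qed
  ultimately show ?thesis by (simp add: bounded_store_def)
qed

text \<open>Each factor is at most two to the power of its bit length, and these lengths add up to
  at most the encoding length; so the products stay within the bound of the initial store.\<close>

lemma prod_phase_bounded: "i \<le> L \<Longrightarrow> bounded_store (encoding_length enc) (phase 2 prodT i (init_store enc))"
proof (rule phase_bounded[OF init_bounded order_refl])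
  fix j assume j: "j < i" "i \<le> L"
  let ?pos = "\<lambda>k. if 0 < enc ! k then enc ! k else 1"
  have eq: "tval prodT (\<lambda>_. int j) (phase 2 prodT j (init_store enc)) = (\<Prod>k\<le>j. ?pos k)"
    using j by (subst prodT_value) (auto simp: init_store_def L_def intro!: prod.cong)
  have "\<bar>\<Prod>k\<le>j. ?pos k\<bar> = (\<Prod>k\<le>j. ?pos k)" by (intro abs_of_nonneg prod_nonneg) auto
  also have "\<dots> \<le> (\<Prod>k\<le>j. 2 ^ bits (enc ! k))"
  proof (rule prod_mono, intro conjI)
    fix k
    show "0 \<le> ?pos k" by simp
    have "(1::int) \<le> 2 ^ bits (enc ! k)" by simp
    then show "?pos k \<le> 2 ^ bits (enc ! k)" using abs_le_pow_bits[of "enc ! k"] by (cases "0 < enc ! k") auto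
  qed
  also have "\<dots> = 2 ^ (\<Sum>k\<le>j. bits (enc ! k))" by (simp add: power_sum)
  also have "\<dots> \<le> 2 ^ (\<Sum>k<L. bits (enc ! k))"
    using j by (intro power_increasing sum_mono2) auto
  finally show "\<bar>tval prodT (\<lambda>_. int j) (phase 2 prodT j (init_store enc))\<bar> \<le> 2 ^ encoding_length enc"
    unfolding eq sum_bits .
qed

lemma all_bounded:
  assumes "\<kappa> \<ge> 1" "\<And>s B. bounded_store B s \<Longrightarrow> bounded_phases (B * \<kappa>) (main_phases @ [(0, outT)]) s"
  shows "bounded_phases (encoding_length enc * \<kappa>) ((2, prodT) # main_phases @ [(0, outT)]) (init_store enc)"
  unfolding bounded_phases.simps init_L nat_int
  using assms(1) by (intro conjI allI impI assms(2) prod_phase_bounded order_refl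
      bounded_store_mono[OF prod_phase_bounded]) auto

end

lemma poly_time_rounding:
  "poly_time_search {w. is_rounding_input w} encode_input
     (\<lambda>w out. length out = num_jobs (in_instance w) \<and>
              is_schedule (in_instance w) (schedule_of_list out) \<and>
              makespan (in_instance w) (schedule_of_list out) \<le> (1 + 3 * in_eps w) * in_T w)"
proof -
  let ?ps = "(2, prodT) # main_phases @ [(0, outT)]"
  let ?fin = "Assign 1 (Const 0) (Cell 10 (Const 0))"
  let ?P = "Seq (phases_prog ?ps) ?fin"
  obtain K where K: "realizes (phases_prog ?ps) (\<lambda>B. bounded_phases B ?ps) (phases ?ps) K"
    using phases_correct[OF wf_main] by blast
  obtain \<kappa> where \<kappa>: "\<kappa> \<ge> 1" "\<And>s B. bounded_store B s \<Longrightarrow> bounded_phases (B * \<kappa>) (main_phases @ [(0, outT)]) s"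
    using bounded_phases_tame[OF main_tame] by blast
  \<comment> \<open>The base is \<open>2 + (\<kappa> + 1) * N\<close> for encoding length
    \<open>N\<close>: it dominates \<open>N * \<kappa> + L + 2\<close>, since
    \<open>L \<le> N\<close>. The exponent combines \<open>K\<close> for the phases with
    \<open>10 + 1 + 2\<close> for the final assignment.\<close>
  define q where "q = [:2, \<kappa> + 1:] ^ (K + (10 + 1 + 2) + 1)"
  have "\<exists>t s. exec ?P (init_store (encode_input w)) t s \<and> t \<le> poly q (encoding_length (encode_input w)) \<and>
      length (output_list s) = num_jobs (in_instance w) \<and>
      is_schedule (in_instance w) (schedule_of_list (output_list s)) \<and>
      makespan (in_instance w) (schedule_of_list (output_list s)) \<le> (1 + 3 * in_eps w) * in_T w"
    if "is_rounding_input w" for w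
  proof -
    interpret rounding_algorithm w by unfold_locales (rule that)
    let ?N = "encoding_length enc"
    let ?X = "?N * \<kappa> + L + 2"
    obtain c s where c: "exec (phases_prog ?ps) (init_store enc) c s" "c \<le> ?X ^ K"
      and s: "\<And>b. b \<noteq> tmp \<Longrightarrow> s b = phases ?ps (init_store enc) b"
      using realizesD[OF K, of "init_store enc" "init_store enc" "?N * \<kappa>"] all_bounded[OF \<kappa>]
      by (metis (no_types, lifting) init_L nat_int)
    have fin: "exec ?fin s (1 + bits 0 + (bits 0 + bits (s 10 0))) (s(1 := (s 1)(0 := s 10 0)))"
      by (rule exec_AssignI) simp_all
    have "\<bar>s 10 0\<bar> \<le> 2 ^ ?N"
    proof -
      have "s 10 0 = int n" by (rule output_length[OF s])
      also have "\<dots> \<le> 2 ^ ?N"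
        using L_le_pow L_bounds(1) by linarith
      finally show ?thesis using \<open>s 10 0 = int n\<close> by simp
    qed
    then have "bits (s 10 0) \<le> ?N + 2" by (rule bits_le)
    moreover have "?N \<le> ?N * \<kappa>" using \<kappa>(1) by simp
    moreover have "bits 0 \<le> 2" using bits_le[of 0 0] by simp
    ultimately have "1 + bits 0 + (bits 0 + bits (s 10 0)) \<le> 10 + ?N * \<kappa> * 1" by linarith
    then have "1 + bits 0 + (bits 0 + bits (s 10 0)) \<le> ?X ^ (10 + 1 + 2)" by (rule affine_le_pow)
    then have "c + (1 + bits 0 + (bits 0 + bits (s 10 0))) \<le> ?X ^ (K + (10 + 1 + 2) + 1)"
      by (intro le_pow_add c) auto
    also have "\<dots> \<le> (2 + ?N * (\<kappa> + 1)) ^ (K + (10 + 1 + 2) + 1)"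
      using L_le by (intro power_mono) auto
    also have "\<dots> = poly q ?N" by (simp only: q_def poly_power poly_pCons poly_0 mult_zero_right add_0_right)
    finally have "c + (1 + bits 0 + (bits 0 + bits (s 10 0))) \<le> poly q ?N" .
    moreover have "output_list (s(1 := (s 1)(0 := s 10 0))) = out" by (rule output_eq[OF s])
    ultimately show ?thesis
      using Seq[OF c(1) fin] out_correct unfolding enc_def[symmetric] by metis
  qed
  then show ?thesis unfolding poly_time_search_def by blast
qed

theorem theorem2:
  shows
    "(\<forall>(\<epsilon>::rat) (T::rat) (I::sup_instance)
        (x :: config \<Rightarrow> nat) (y :: nat \<Rightarrow> config \<Rightarrow> real) (z :: nat \<Rightarrow> config \<Rightarrow> real).
        rounded_setting \<epsilon> T I \<longrightarrow> milp_feasible \<epsilon> T I x y z \<longrightarrow>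
        (\<exists>\<sigma>. is_schedule I \<sigma> \<and> makespan I \<sigma> \<le> (1 + 3 * \<epsilon>) * T))
     \<and>
     poly_time_search {w. is_rounding_input w} encode_input
       (\<lambda>w out. length out = num_jobs (in_instance w) \<and>
                is_schedule (in_instance w) (schedule_of_list out) \<and>
                makespan (in_instance w) (schedule_of_list out) \<le> (1 + 3 * in_eps w) * in_T w)"
  using schedule_exists poly_time_rounding by blast

end
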